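(* Let $X_s=B_s+\sum_{i=1}^{N_s}\eta_i$ be a Brownian motion with random jumps as described in the context. For a piecewise linear function $b(\cdot)$ on $[0,t]$ that is linear on each subinterval of the partition $0=s_0<s_1<\cdots<s_{n-1}<s_n=t$, it holds $$\begin{aligned} &P\Big(\max_{0\le s<t}\{X_s-b(s)\}<0\Big)=\sum_{k=0}^{\infty}P(N_t=k)\int_{\mathcal S_k^t}dF_k(u_1,\ldots,u_k)\int_{\mathbb R^k}dG_k(h_1,\ldots,h_k)\\ &\quad\int_{-\infty}^{\beta_1}\cdots\int_{-\infty}^{\beta_m}\ \prod_{i=1}^m\Big(1-e^{-2(b_{i-1}-x_{i-1})(b_i-x_i)/(t_i-t_{i-1})}\Big)\\ &\quad\cdot\Big(\Phi\Big(\frac{b(t)-x_m}{\sqrt{t-t_m}}\Big)-\exp\Big(-\frac{2(b(t)-b_m)(b_m-x_m)}{t-t_m}\Big)\Phi\Big(\frac{b(t)-2b_m+x_m}{\sqrt{t-t_m}}\Big)\Big)\\ &\quad d\Phi_{t_1}(x_1)\,d\Phi_{t_2-t_1}(x_2-x_1)\cdots d\Phi_{t_m-t_{m-1}}(x_m-x_{m-1}), \end{aligned}$$ where $0=t_0<t_1<\cdots<t_m<t$ with $m=k+n-1$ are the points of $\{u_1,\ldots,u_k\}\cup\{s_1,\ldots,s_{n-1}\}$ in increasing order, $x_0=0$, $$b_i=b(t_i)-\sum_{j=1}^k\mathbf 1_{\{t_i>u_j\}}h_j,\qquad \beta_i=\min\{b_i,\ b_i-h_i\},$$ and in the formula for $\beta_i$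 the symbol $h_i$ denotes the jump height at $t_i$ (equal to $0$ if $t_i$ is not a jump time).
   Context: $(B_s)_{s\ge0}$ is a standard Brownian motion; $(N_s)_{s\ge0}$ is any integer-valued stochastic process starting with $N_0=0$ (for example a Poisson process); $(\eta_i)_{i\ge1}$ is a family of real random variables representing jump sizes, not necessarily independent or identically distributed. $(B_s)$, $(N_s)$ and $(\eta_i)$ are mutually independent. The jump times are $\tau_1=\inf\{s>0: N_s\ne N_{s^-}\}$ and $\tau_k=\inf\{s>\tau_{k-1}: N_s\ne N_{s^-}\}$ for $k\ge2$, where $N_{s^-}=\lim_{r\to s^-}N_r$. For each $k\ge1$, $F_k$ is the joint distribution function of the jump times $(\tau_1,\ldots,\tau_k)$ and $G_k$ is the joint distribution function of the corresponding jump heights $(\eta_1,\ldots,\eta_k)$. For each $t>0$ the support of $F_k$ is $\mathcal S_k^t=\{(s_1,\ldots,s_k):0<s_1<\cdots<s_k<t\}$. The probability that a jump time falls on one of the points $s_i$ is zero, so the realized jump times $u_1,\ldots,u_k$ and the points $s_1,\ldots,s_{n-1}$ are assumed distinct. $\Phi_s(x)=\frac1{\sqrt{2\pi s}}\int_{-\infty}^xe^{-y^2/(2s)}dy$ is the distribution function of $B_s$, and $\Phi=\Phi_1$.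
   Formalization: Corrected formula: in the product b_{i-1} becomes b_{i-1}-h_{i-1}; the last factor uses b_m-h_m and b(t)-sum of h_j for b_m and b(t). Added: b(0)>=0; N is right-continuous with left limits and unit upward jumps. F_k is the law given N_t=k; max is read as supremum. *)

theory Defs
  imports "HOL-Probability.Probability"
begin

definition standard_brownian_motion :: "'a measure \<Rightarrow> (real \<Rightarrow> 'a \<Rightarrow> real) \<Rightarrow> bool" where
  "standard_brownian_motion M B \<longleftrightarrow>
     (\<forall>s\<ge>0. B s \<in> borel_measurable M) \<and>
     (\<forall>\<omega>\<in>space M. B 0 \<omega> = 0) \<and>
     (\<forall>\<omega>\<in>space M. continuous_on {0..} (\<lambda>s. B s \<omega>)) \<and>
     (\<forall>r s. 0 \<le> r \<longrightarrow> r < s \<longrightarrow>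
        distributed M lborel (\<lambda>\<omega>. B s \<omega> - B r \<omega>) (normal_density 0 (sqrt (s - r)))) \<and>
     (\<forall>(p::nat) (r::nat \<Rightarrow> real). 0 \<le> r 0 \<longrightarrow> (\<forall>i<p. r i < r (Suc i)) \<longrightarrow>
        prob_space.indep_vars M (\<lambda>_. borel) (\<lambda>i \<omega>. B (r (Suc i)) \<omega> - B (r i) \<omega>) {..<p})"

definition left_limit :: "(real \<Rightarrow> 'a \<Rightarrow> int) \<Rightarrow> real \<Rightarrow> 'a \<Rightarrow> int" where
  "left_limit N s \<omega> = Lim (at_left s) (\<lambda>r. N r \<omega>)"

text \<open>
  The integer-valued process that numbers the jumps. Existence of the left limits is what
  the definition of the jump times presupposes. The last clause says that the \<open>k\<close>-th jump
  of \<open>N\<close> goes from \<open>k - 1\<close> to \<open>k\<close>, i.e. that \<open>\<eta>\<^sub>k\<close> is the height of the jump of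
  \<open>X\<close> at the \<open>k\<close>-th jump time, and that \<open>N\<^sub>t = k\<close> means that exactly \<open>k\<close> jumps have
  occurred up to time \<open>t\<close>.
\<close>

definition jump_counting_process :: "'a measure \<Rightarrow> (real \<Rightarrow> 'a \<Rightarrow> int) \<Rightarrow> bool" where
  "jump_counting_process M N \<longleftrightarrow>
     (\<forall>s\<ge>0. N s \<in> measurable M (count_space UNIV)) \<and>
     (\<forall>\<omega>\<in>space M. N 0 \<omega> = 0) \<and>
     (\<forall>\<omega>\<in>space M. \<forall>s\<ge>0. ((\<lambda>r. N r \<omega>) \<longlongrightarrow> N s \<omega>) (at_right s)) \<and>
     (\<forall>\<omega>\<in>space M. \<forall>s>0. \<exists>l. ((\<lambda>r. N r \<omega>) \<longlongrightarrow> l) (at_left s)) \<and>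
     (\<forall>\<omega>\<in>space M. \<forall>s>0. N s \<omega> \<noteq> left_limit N s \<omega> \<longrightarrow> N s \<omega> = left_limit N s \<omega> + 1)"

definition process_sigma ::
    "'a measure \<Rightarrow> 'i set \<Rightarrow> ('i \<Rightarrow> 'a \<Rightarrow> 'b::topological_space) \<Rightarrow> 'a set set" where
  "process_sigma M I Z =
     sigma_sets (space M) {Z i -` A \<inter> space M | i A. i \<in> I \<and> A \<in> sets borel}"

definition mutually_independent ::
    "'a measure \<Rightarrow> (real \<Rightarrow> 'a \<Rightarrow> real) \<Rightarrow> (real \<Rightarrow> 'a \<Rightarrow> int) \<Rightarrow> (nat \<Rightarrow> 'a \<Rightarrow> real) \<Rightarrow> bool" where
  "mutually_independent M B N \<eta> \<longleftrightarrow>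
     prob_space.indep_sets M
       (\<lambda>j. [process_sigma M {0..} B, process_sigma M {0..} N, process_sigma M {1..} \<eta>] ! j)
       {..<3::nat}"

definition jump_BM ::
    "(real \<Rightarrow> 'a \<Rightarrow> real) \<Rightarrow> (real \<Rightarrow> 'a \<Rightarrow> int) \<Rightarrow> (nat \<Rightarrow> 'a \<Rightarrow> real) \<Rightarrow> real \<Rightarrow> 'a \<Rightarrow> real" where
  "jump_BM B N \<eta> s \<omega> = B s \<omega> + (\<Sum>i = 1..nat (N s \<omega>). \<eta> i \<omega>)"

text \<open>
  Jump times are extended reals, so that \<open>\<tau>\<^sub>k = \<infinity>\<close> when there are fewer than \<open>k\<close> jumps;
  \<open>\<tau>\<^sub>0 = 0\<close> is only the start of the recursion.
\<close>

primrec jump_time :: "(real \<Rightarrow> 'a \<Rightarrow> int) \<Rightarrow> nat \<Rightarrow> 'a \<Rightarrow> ereal" where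
  "jump_time N 0 \<omega> = 0"
| "jump_time N (Suc k) \<omega> =
     Inf {ereal s | s. ereal s > jump_time N k \<omega> \<and> N s \<omega> \<noteq> left_limit N s \<omega>}"

definition jump_simplex :: "nat \<Rightarrow> real \<Rightarrow> (nat \<Rightarrow> real) set" where
  "jump_simplex k t =
     {u \<in> extensional {1..k}. (\<forall>i\<in>{1..k}. 0 < u i \<and> u i < t) \<and> (\<forall>i\<in>{1..<k}. u i < u (Suc i))}"

text \<open>
  The law \<open>F\<^sub>k\<close> of \<open>(\<tau>\<^sub>1, \<dots>, \<tau>\<^sub>k)\<close>. A law concentrated on \<open>jump_simplex k t\<close> for every \<open>k\<close>
  can only be meant conditionally on the event \<open>N\<^sub>t = k\<close>, whose probability is the weight of
  the \<open>k\<close>-th term of the series.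
  (If that event has probability zero, \<open>uniform_measure\<close> yields the zero measure.)
\<close>

definition jump_time_law :: "'a measure \<Rightarrow> (real \<Rightarrow> 'a \<Rightarrow> int) \<Rightarrow> real \<Rightarrow> nat \<Rightarrow> (nat \<Rightarrow> real) measure" where
  "jump_time_law M N t k =
     distr (uniform_measure M {\<omega> \<in> space M. N t \<omega> = int k}) (PiM {1..k} (\<lambda>_. borel))
       (\<lambda>\<omega>. \<lambda>i\<in>{1..k}. real_of_ereal (jump_time N i \<omega>))"

definition jump_height_law :: "'a measure \<Rightarrow> (nat \<Rightarrow> 'a \<Rightarrow> real) \<Rightarrow> nat \<Rightarrow> (nat \<Rightarrow> real) measure" where
  "jump_height_law M \<eta> k =
     distr M (PiM {1..k} (\<lambda>_. borel)) (\<lambda>\<omega>. \<lambda>i\<in>{1..k}. \<eta> i \<omega>)"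

definition Phi :: "real \<Rightarrow> real \<Rightarrow> real" where
  "Phi s x = 1 / sqrt (2 * pi * s) * (LBINT y:{..x}. exp (- y\<^sup>2 / (2 * s)))"

text \<open>
  \<open>grid n s k u ! i\<close> is \<open>t\<^sub>i\<close>, with \<open>t\<^sub>0 = 0\<close>.
\<close>

definition grid :: "nat \<Rightarrow> (nat \<Rightarrow> real) \<Rightarrow> nat \<Rightarrow> (nat \<Rightarrow> real) \<Rightarrow> real list" where
  "grid n s k u = sorted_list_of_set (insert 0 (u ` {1..k} \<union> s ` {1..<n}))"

definition level :: "(real \<Rightarrow> real) \<Rightarrow> nat \<Rightarrow> (nat \<Rightarrow> real) \<Rightarrow> (nat \<Rightarrow> real) \<Rightarrow> real \<Rightarrow> real" where
  "level b k u h x = b x - (\<Sum>j = 1..k. if x > u j then h j else 0)"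

definition height_at :: "nat \<Rightarrow> (nat \<Rightarrow> real) \<Rightarrow> (nat \<Rightarrow> real) \<Rightarrow> real \<Rightarrow> real" where
  "height_at k u h x = (\<Sum>j = 1..k. if x = u j then h j else 0)"

text \<open>
  \<open>nested_integral T \<beta> g r i x\<close> is the \<open>r\<close>-fold iterated integral, starting with the variable
  \<open>x\<^sub>i\<close>, of \<open>g\<close> over \<open>x\<^sub>j \<le> \<beta>\<^sub>j\<close>, where \<open>x\<^sub>j\<close> is integrated against the Stieltjes
  measure of \<open>y \<mapsto> \<Phi>\<^bsub>T\<^sub>j - T\<^sub>j\<^sub>-\<^sub>1\<^esub>(y - x\<^sub>j\<^sub>-\<^sub>1)\<close>.
\<close>

primrec nested_integral ::
    "(nat \<Rightarrow> real) \<Rightarrow> (nat \<Rightarrow> real) \<Rightarrow> ((nat \<Rightarrow> real) \<Rightarrow> real) \<Rightarrow> nat \<Rightarrow> nat \<Rightarrow> (nat \<Rightarrow> real) \<Rightarrow> real" where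
  "nested_integral T \<beta> g 0 i x = g x"
| "nested_integral T \<beta> g (Suc r) i x =
     (LINT y:{..\<beta> i}|interval_measure (\<lambda>y. Phi (T i - T (i - 1)) (y - x (i - 1))).
        nested_integral T \<beta> g r (Suc i) (x(i := y)))"

text \<open>
  In terms of the Brownian coordinate, the boundary is the discontinuous function obtained
  from \<open>b\<close> by subtracting the heights of the jumps already made. Its value immediately before
  time \<open>t\<^sub>i\<close> is \<open>b\<^sub>i = level b k u h t\<^sub>i\<close>, and immediately after \<open>t\<^sub>i\<close> it is \<open>b\<^sub>i - h\<^sub>i\<close>.
  On the segment from \<open>t\<^sub>i\<^sub>-\<^sub>1\<close> to \<open>t\<^sub>i\<close> it is therefore the line from
  \<open>b\<^sub>i\<^sub>-\<^sub>1 - h\<^sub>i\<^sub>-\<^sub>1\<close> (\<open>bR (i - 1)\<close> below) to \<open>b\<^sub>i\<close> (\<open>bL i\<close>), and on the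
  last segment it ends at \<open>bt = b(t) - (h\<^sub>1 + \<dots> + h\<^sub>k)\<close>.
  These one-sided values are essential: with \<open>b\<^sub>i\<^sub>-\<^sub>1\<close>, \<open>b\<^sub>m\<close> and \<open>b(t)\<close> in place of
  \<open>bR (i - 1)\<close>, \<open>bR m\<close> and \<open>bt\<close> the formula fails as soon as there are nonzero jumps.
\<close>

definition segment_integral ::
    "(real \<Rightarrow> real) \<Rightarrow> real \<Rightarrow> nat \<Rightarrow> (nat \<Rightarrow> real) \<Rightarrow> nat \<Rightarrow> (nat \<Rightarrow> real) \<Rightarrow> (nat \<Rightarrow> real) \<Rightarrow> real" where
  "segment_integral b t n s k u h =
     (let m = k + n - 1;
          T = (\<lambda>i. grid n s k u ! i);
          bL = (\<lambda>i. level b k u h (T i));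
          bR = (\<lambda>i. bL i - height_at k u h (T i));
          \<beta> = (\<lambda>i. min (bL i) (bL i - height_at k u h (T i)));
          bt = level b k u h t
      in nested_integral T \<beta>
           (\<lambda>x. (\<Prod>i = 1..m. 1 - exp (- 2 * (bR (i - 1) - x (i - 1)) * (bL i - x i) / (T i - T (i - 1))))
              * (Phi 1 ((bt - x m) / sqrt (t - T m))
                 - exp (- (2 * (bt - bR m) * (bR m - x m) / (t - T m)))
                   * Phi 1 ((bt - 2 * bR m + x m) / sqrt (t - T m))))
           m 1 (\<lambda>_. 0))"

end

theory Submission
  imports Defs
begin

text \<open>
Condition on \<open>N t = k\<close>, on the jump times \<open>u\<close> and on the heights \<open>h\<close>. By independence what remains
  is the probability that Brownian motion stays below the boundary lowered by the heights already
  jumped, which is linear on every segment of the grid formed by \<open>u\<close> and \<open>s\<close>. On a uniform refinement of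
  each segment the survival probability is an iterated Gaussian integral, i.e. a composition of
  discrete killed kernels. After removing the slope by an exponential change of measure, the killed
  kernel is compared with the reflected kernel \<open>\<phi>\<^sub>v(y - x) - \<phi>\<^sub>v(y + x)\<close>: reflected kernels form a
  convolution semigroup on the whole line and are nonpositive above the barrier, which gives the lower
  bound; with the barrier raised by \<open>\<epsilon>\<close> they also give an upper bound, up to the probability that some
  step exceeds \<open>\<epsilon>\<close>. In the limit each segment contributes the factor
  \<open>1 - exp (- 2 (a - x) (c - y) / v)\<close>, and the last one integrates to the difference of two values of \<open>\<Phi>\<close>.
\<close>

section \<open>Gaussian kernels and the reflection principle\<close>

text \<open>Brownian motion is given only through the laws of its increments, so the reflection
  principle is proved for finite walks and carried to continuous paths by refinement; no stopping
  time occurs. Two mismatches shape the rest. The walks test weak inequalities, while the theorem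
  asks for a strictly negative supremum: the path is lifted by
  \<open>inverse (real (Suc q))\<close>, and right continuity of \<open>surv\<close> in the starting
  point removes the lift as q grows. Moreover a Bochner integral of a non-measurable function is 0
  by convention, so the series has its meaning only once \<open>segment_integral\<close> is known to
  be jointly measurable in jump times and heights, including degenerate configurations in which the
  grid has too few points. Probabilities are mostly kept as \<open>ennreal\<close> integrals, where
  Fubini is unconditional. Bochner integrals enter where a kernel changes sign
  (\<open>reflected\<close>) and where the formula itself is written with them.\<close>

definition gauss :: "real \<Rightarrow> real \<Rightarrow> real" where
  "gauss v = normal_density 0 (sqrt v)"

lemma gauss_nonneg [simp]: "0 \<le> gauss v x"
  by (simp add: gauss_def)

lemma borel_measurable_gauss [measurable]: "gauss v \<in> borel_measurable borel"
  by (simp add: gauss_def)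

lemma gauss_eq: "0 \<le> v \<Longrightarrow> gauss v x = exp (- x\<^sup>2 / (2 * v)) / sqrt (2 * pi * v)"
  by (simp add: gauss_def normal_density_def)

lemma gauss_uminus [simp]: "gauss v (- x) = gauss v x"
  by (simp add: gauss_def normal_density_def)

lemma nn_integral_shift: "f \<in> borel_measurable borel \<Longrightarrow> (\<integral>\<^sup>+w. f (w - (x::real)) \<partial>lborel) = (\<integral>\<^sup>+w. f w \<partial>lborel)"
  using nn_integral_real_affine[of f 1 "-x"] by simp

lemma nn_integral_gauss: "0 < v \<Longrightarrow> (\<integral>\<^sup>+w. ennreal (gauss v (w - x)) \<partial>lborel) = 1"
  by (subst nn_integral_shift[of "\<lambda>w. ennreal (gauss v w)"])
     (simp_all add: gauss_def nn_integral_eq_integral)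

lemma gauss_convolution:
  assumes "0 < d" "0 < v"
  shows "(\<integral>\<^sup>+w. ennreal (gauss d (w - x) * gauss v (y - w)) \<partial>lborel) = ennreal (gauss (d + v) (y - x))"
proof -
  have "(\<integral>\<^sup>+w. ennreal (gauss d (w - x) * gauss v (y - w)) \<partial>lborel) =
        (\<integral>\<^sup>+w. (\<lambda>z. ennreal (gauss v ((y - x) - z) * gauss d z)) (w - x) \<partial>lborel)"
    by (intro nn_integral_cong) (simp add: mult.commute)
  also have "\<dots> = (\<integral>\<^sup>+z. ennreal (gauss v ((y - x) - z) * gauss d z) \<partial>lborel)"
    by (intro nn_integral_shift) measurable
  also have "\<dots> = ennreal (gauss (v + d) (y - x))"
    using conv_normal_density_zero_mean[of "sqrt v" "sqrt d"] assms
    by (simp add: gauss_def fun_eq_iff)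
  finally show ?thesis by (simp add: add.commute)
qed

text \<open>The Bochner form is what can be subtracted when the signed kernel
  \<open>reflected\<close> is convolved.\<close>

lemma gauss_convolution_integral:
  assumes "0 < d" "0 < v"
  shows "has_bochner_integral lborel (\<lambda>w. gauss d (w - x) * gauss v (y - w)) (gauss (d + v) (y - x))"
  by (rule has_bochner_integral_nn_integral) (use gauss_convolution[OF assms] in simp_all)

text \<open>Uniform in v: it bounds the kernel after any number of steps by a quantity that depends
  only on the variance d of a single step.\<close>

lemma gauss_le: "0 < d \<Longrightarrow> d \<le> v \<Longrightarrow> gauss v x \<le> 1 / sqrt d"
proof -
  assume d: "0 < d" "d \<le> v"
  have "gauss v x \<le> 1 / sqrt (2 * pi * v)"
    using d by (simp add: gauss_eq divide_simps)
  also have "\<dots> \<le> 1 / sqrt d"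
  proof -
    have "d \<le> 1 * v" using d by simp
    also have "1 * v \<le> 2 * pi * v" using d pi_gt3 by (intro mult_right_mono) auto
    finally show ?thesis using d by (intro divide_left_mono) auto
  qed
  finally show ?thesis .
qed

lemma gauss_mono: "0 < v \<Longrightarrow> \<bar>y\<bar> \<le> \<bar>x\<bar> \<Longrightarrow> gauss v x \<le> gauss v y"
  by (simp add: gauss_eq divide_simps abs_le_square_iff)

text \<open>Method of images for the barrier e: the source x has its mirror image at 2 e - x. For x
  and y below e this is the transition density of Brownian motion killed at e; on the whole line it
  is the extension that is antisymmetric under reflection of x.\<close>

definition reflected :: "real \<Rightarrow> real \<Rightarrow> real \<Rightarrow> real \<Rightarrow> real" where
  "reflected e v x y = gauss v (y - x) - gauss v (y + x - 2 * e)"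

text \<open>The sign here and in the next lemma is decided by whether y is closer to x or to the
  mirror image 2 e - x.\<close>

lemma reflected_nonneg: "0 < v \<Longrightarrow> x \<le> e \<Longrightarrow> y \<le> e \<Longrightarrow> 0 \<le> reflected e v x y"
  by (simp add: reflected_def, rule gauss_mono) auto

lemma reflected_nonpos: "0 < v \<Longrightarrow> e \<le> x \<Longrightarrow> y \<le> e \<Longrightarrow> reflected e v x y \<le> 0"
  by (simp add: reflected_def, rule gauss_mono) auto

text \<open>Mirroring the target y instead of the source makes the image term an ordinary Gaussian
  convolution, so both terms are instances of the same identity.\<close>

lemma reflected_convolution:
  assumes "0 < d" "0 < v"
  shows "has_bochner_integral lborel (\<lambda>w. gauss d (w - x) * reflected e v w y) (reflected e (d + v) x y)"
proof -
  have "has_bochner_integral lborel (\<lambda>w. gauss d (w - x) * gauss v ((2 * e - y) - w)) (gauss (d + v) ((2 * e - y) - x))"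
    by (rule gauss_convolution_integral[OF assms])
  moreover have "gauss u ((2 * e - y) - z) = gauss u (y + z - 2 * e)" for u z
    using gauss_uminus[of u "y + z - 2 * e"] by (simp add: algebra_simps)
  ultimately show ?thesis
    using has_bochner_integral_diff[OF gauss_convolution_integral[OF assms, of x y]]
    by (simp add: reflected_def right_diff_distrib)
qed

text \<open>Density at y of a Gaussian walk started at x, with n + 1 steps of variance d, killed
  when one of the n intermediate positions is positive. The two end points are not tested.\<close>

primrec neg_walk :: "real \<Rightarrow> nat \<Rightarrow> real \<Rightarrow> real \<Rightarrow> ennreal" where
  "neg_walk d 0 x y = ennreal (gauss d (y - x))"
| "neg_walk d (Suc n) x y = (\<integral>\<^sup>+w. ennreal (gauss d (w - x)) * indicator {..0} w * neg_walk d n w y \<partial>lborel)"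

lemma measurable_neg_walk [measurable]:
  "(\<lambda>(x, y). neg_walk d n x y) \<in> borel_measurable (borel \<Otimes>\<^sub>M borel)"
proof (induction n)
  case (Suc n)
  note Suc[measurable]
  show ?case by simp measurable
qed simp

lemma reflected_le_neg_walk:
  fixes d x y :: real
  assumes d: "0 < d" and "x \<le> 0" "y \<le> 0"
  shows "ennreal (reflected 0 (d * real (Suc n)) x y) \<le> neg_walk d n x y"
  using \<open>x \<le> 0\<close>
proof (induction n arbitrary: x)
  case 0
  then show ?case by (auto simp: reflected_def intro!: ennreal_leI)
next
  case (Suc n)
  let ?f = "\<lambda>w. gauss d (w - x) * reflected 0 (d * Suc n) w y"
  have *: "has_bochner_integral lborel ?f (reflected 0 (d * Suc (Suc n)) x y)"
  proof -
    have "0 < d * Suc n" using d by simp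
    from reflected_convolution[OF d this, of x 0 y] show ?thesis by (simp add: algebra_simps)
  qed
  have i: "integrable lborel ?f" and e: "integral\<^sup>L lborel ?f = reflected 0 (d * Suc (Suc n)) x y"
    using * by (auto simp: has_bochner_integral_iff)
  \<comment> \<open>The integrand is signed; its positive part dominates it and can be handed over
    to an \<open>ennreal\<close> integral, and on w > 0, where the walk is killed, this positive
    part is 0.\<close>
  have m: "integrable lborel (\<lambda>w. max 0 (?f w))"
    using i by (intro integrable_max) auto
  have "ennreal (reflected 0 (d * Suc (Suc n)) x y) \<le> ennreal (\<integral>w. max 0 (?f w) \<partial>lborel)"
    unfolding e[symmetric] by (intro ennreal_leI integral_mono i m) auto
  also have "\<dots> = (\<integral>\<^sup>+w. ennreal (max 0 (?f w)) \<partial>lborel)"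
    by (rule nn_integral_eq_integral[symmetric, OF m]) auto
  also have "\<dots> \<le> (\<integral>\<^sup>+w. ennreal (gauss d (w - x)) * indicator {..0} w * neg_walk d n w y \<partial>lborel)"
  proof (intro nn_integral_mono)
    fix w :: real
    show "ennreal (max 0 (?f w)) \<le> ennreal (gauss d (w - x)) * indicator {..0} w * neg_walk d n w y"
    proof (cases "w \<le> 0")
      case True
      then have "max 0 (?f w) = ?f w"
        using reflected_nonneg[of "d * Suc n" w 0 y] d assms(3) by (simp add: max_def)
      then show ?thesis
        using True Suc.IH[OF True] by (simp add: ennreal_mult' mult_left_mono)
    next
      case False
      then have "?f w \<le> 0"
        using reflected_nonpos[of "d * Suc n" 0 w y] d assms(3) by (simp add: mult_nonneg_nonpos)
      then show ?thesis using False by simp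
    qed
  qed
  finally show ?case by simp
qed

text \<open>Why the fourth moment: a step exceeds e with probability of order d^2 / e^4, the kernel
  is at most 1 / sqrt d, and there are about v / d steps, so the total error is of order sqrt d. The
  second moment would give an error that grows like 1 / sqrt d.\<close>

lemma fourth_moment_gauss:
  "0 < d \<Longrightarrow> has_bochner_integral lborel (\<lambda>w. gauss d (w - x) * (w - x)^4) (3 * d\<^sup>2)"
  using normal_moment_even[of "sqrt d" x 2]
  by (simp add: gauss_def normal_density_def fact_numeral power_divide field_simps)

text \<open>Raising the barrier by \<open>e\<close> makes the reflected kernel an upper bound up to the probability
  that a single step exceeds \<open>e\<close>, which is controlled by the fourth moment.\<close>

lemma neg_walk_le_reflected:
  fixes d e x y :: real
  assumes d: "0 < d" and e: "0 < e" and "x \<le> 0" "y \<le> 0"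
  shows "neg_walk d n x y \<le> ennreal (reflected e (d * Suc n) x y + (gauss d (2 * e) + n * (3 * d\<^sup>2 / (sqrt d * e^4))))"
  using \<open>x \<le> 0\<close>
proof (induction n arbitrary: x)
  case 0
  then have "gauss d (y + x - 2 * e) \<le> gauss d (2 * e)"
    using assms by (intro gauss_mono) auto
  then show ?case by (auto simp: reflected_def intro!: ennreal_leI)
next
  case (Suc n)
  \<comment> \<open>The summand \<open>gauss d (2 * e)\<close> is the image term of a single step,
    maximal at x = y = 0. Each further step adds Markov's bound 3 d^2 / e^4 for a step longer than
    e, times the bound 1 / sqrt d on the kernel.\<close>
  let ?c = "gauss d (2 * e) + n * (3 * d\<^sup>2 / (sqrt d * e^4))"
  let ?R = "\<lambda>w. reflected e (d * Suc n) w y"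
  let ?g = "\<lambda>w. gauss d (w - x) * ?R w + (gauss d (w - x) * ?c + gauss d (w - x) * (w - x)^4 * (1 / (sqrt d * e^4)))"
  have c: "0 \<le> ?c" using e d by auto
  have 1: "has_bochner_integral lborel (\<lambda>w. gauss d (w - x) * ?R w) (reflected e (d * Suc (Suc n)) x y)"
  proof -
    have "0 < d * Suc n" using d by simp
    from reflected_convolution[OF d this, of x e y] show ?thesis by (simp add: algebra_simps)
  qed
  have "has_bochner_integral lborel (\<lambda>w. gauss d (w - x)) 1"
    by (rule has_bochner_integral_nn_integral) (use nn_integral_gauss[OF d] in auto)
  then have 2: "has_bochner_integral lborel (\<lambda>w. gauss d (w - x) * ?c) ?c"
    using has_bochner_integral_mult_left[of ?c lborel "\<lambda>w. gauss d (w - x)" 1] by simp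
  have 3: "has_bochner_integral lborel (\<lambda>w. gauss d (w - x) * (w - x)^4 * (1 / (sqrt d * e^4))) (3 * d\<^sup>2 * (1 / (sqrt d * e^4)))"
    by (rule has_bochner_integral_mult_left) (use fourth_moment_gauss[OF d] in auto)
  have g: "has_bochner_integral lborel ?g (reflected e (d * Suc (Suc n)) x y + (?c + 3 * d\<^sup>2 * (1 / (sqrt d * e^4))))"
    by (intro has_bochner_integral_add 1 2 3)
  \<comment> \<open>The killed walk sees only w at most 0, but the convolution identity integrates
    over the whole line. Hence \<open>?g\<close> must dominate on the half-line and be nonnegative
    everywhere else.\<close>
  have gap: "ennreal (gauss d (w - x)) * indicator {..0} w * ennreal (?R w + ?c) \<le> ennreal (?g w) \<and> 0 \<le> ?g w" for w
  proof -
    have 4: "0 \<le> gauss d (w - x) * (w - x)^4 * (1 / (sqrt d * e^4))" using e d by auto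
    have 5: "0 \<le> gauss d (w - x) * ?R w + gauss d (w - x) * (w - x)^4 * (1 / (sqrt d * e^4))"
    proof (cases "w \<le> e")
      case True
      then have "0 \<le> ?R w" using reflected_nonneg[of "d * Suc n" w e y] d e assms(4) by simp
      then show ?thesis using 4 by simp
    next
      case False
      \<comment> \<open>Since x is at most 0, reaching w > e needs a step longer than e; the
        fourth-moment term then outweighs the negative value of the reflected kernel.\<close>
      have "e^4 \<le> (w - x)^4" using False Suc.prems e by (intro power_mono) auto
      then have "1 / sqrt d \<le> (w - x)^4 / (sqrt d * e^4)"
        using d e by (simp add: divide_simps)
      moreover have "- ?R w \<le> 1 / sqrt d"
        using gauss_le[of d "d * Suc n" "y + w - 2 * e"] d
          gauss_nonneg[of "d * real (Suc n)" "y - w"] unfolding reflected_def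
        by (simp add: algebra_simps del: gauss_nonneg)
      ultimately have "0 \<le> ?R w + (w - x)^4 / (sqrt d * e^4)" by linarith
      then have "0 \<le> gauss d (w - x) * (?R w + (w - x)^4 / (sqrt d * e^4))"
        by (intro mult_nonneg_nonneg) auto
      then show ?thesis by (simp add: distrib_left)
    qed
    have 6: "0 \<le> gauss d (w - x) * ?c" using c by (intro mult_nonneg_nonneg) auto
    from 5 6 have g0: "0 \<le> ?g w" by linarith
    have "ennreal (gauss d (w - x)) * ennreal (?R w + ?c) \<le> ennreal (?g w)"
    proof -
      have "ennreal (gauss d (w - x)) * ennreal (?R w + ?c) = ennreal (gauss d (w - x) * (?R w + ?c))"
        by (simp add: ennreal_mult')
      also have "\<dots> \<le> ennreal (?g w)"
        using 4 by (intro ennreal_leI) (simp add: distrib_left)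
      finally show ?thesis .
    qed
    then show ?thesis using g0 by (auto simp: indicator_def)
  qed
  have "neg_walk d (Suc n) x y \<le> (\<integral>\<^sup>+w. ennreal (gauss d (w - x)) * indicator {..0} w * ennreal (?R w + ?c) \<partial>lborel)"
    unfolding neg_walk.simps using Suc.IH
    by (intro nn_integral_mono) (auto simp: indicator_def intro!: mult_left_mono)
  also have "\<dots> \<le> (\<integral>\<^sup>+w. ennreal (?g w) \<partial>lborel)"
    using gap by (intro nn_integral_mono) blast
  also have "\<dots> = ennreal (reflected e (d * Suc (Suc n)) x y + (?c + 3 * d\<^sup>2 * (1 / (sqrt d * e^4))))"
    using g gap by (subst nn_integral_eq_integral) (auto simp: has_bochner_integral_iff)
  finally show ?case by (simp add: algebra_simps add_divide_distrib)
qed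

text \<open>From exp (- a) at most 1 / a with a = e^2 / (2 d); any bound that vanishes with d for
  fixed e would do.\<close>

lemma gauss_le_sqrt:
  assumes "e \<noteq> 0" "0 < d"
  shows "gauss d e \<le> 2 * sqrt d / e\<^sup>2"
proof -
  define a where "a = e\<^sup>2 / (2 * d)"
  have a: "0 < a" using assms by (simp add: a_def)
  have "a \<le> exp a" using exp_ge_add_one_self[of a] by linarith
  then have "exp (- a) \<le> 1 / a" using a by (simp add: exp_minus divide_simps)
  then have 1: "exp (- e\<^sup>2 / (2 * d)) \<le> 2 * d / e\<^sup>2" by (simp add: a_def)
  have "1 * d \<le> 2 * pi * d" using assms pi_gt3 by (intro mult_right_mono) auto
  then have 2: "inverse (sqrt (2 * pi * d)) \<le> inverse (sqrt d)"
    using assms by (intro le_imp_inverse_le) auto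
  have "gauss d e \<le> (2 * d / e\<^sup>2) * inverse (sqrt d)"
    unfolding gauss_eq[OF less_imp_le[OF assms(2)]] divide_inverse[of "exp _"]
    using 1 2 assms by (intro mult_mono) auto
  also have "\<dots> = 2 * (d / sqrt d) / e\<^sup>2" by (simp add: divide_inverse)
  also have "\<dots> = 2 * sqrt d / e\<^sup>2" using assms by (simp add: real_div_sqrt)
  finally show ?thesis .
qed

lemma LIMSEQ_div_Suc: "(\<lambda>n. v / real (Suc n)) \<longlonglongrightarrow> 0"
  using tendsto_mult[OF tendsto_const LIMSEQ_inverse_real_of_nat, of v]
  by (simp add: divide_inverse)

text \<open>The lower bound holds for every n. For the upper bound the order of choices matters: e
  is fixed first, small enough that the raised kernel still lies below the given bound, and only
  then does n grow and remove the error belonging to that e.\<close>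

lemma neg_walk_tendsto:
  assumes v: "0 < v" and x: "x \<le> 0" and y: "y \<le> 0"
  shows "(\<lambda>n. neg_walk (v / real (Suc n)) n x y) \<longlonglongrightarrow> ennreal (gauss v (y - x) - gauss v (y + x))"
proof (rule order_tendstoI)
  have low: "ennreal (gauss v (y - x) - gauss v (y + x)) \<le> neg_walk (v / real (Suc n)) n x y" for n
    using reflected_le_neg_walk[of "v / real (Suc n)" x y n] assms by (simp add: reflected_def)
  fix a assume "a < ennreal (gauss v (y - x) - gauss v (y + x))"
  then show "\<forall>\<^sub>F n in sequentially. a < neg_walk (v / real (Suc n)) n x y"
    by (intro always_eventually allI) (rule less_le_trans[OF _ low])
next
  define D where "D n = v / real (Suc n)" for n
  have D: "0 < D n" for n using v by (simp add: D_def)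
  fix a assume a: "ennreal (gauss v (y - x) - gauss v (y + x)) < a"
  have "((\<lambda>e. ennreal (reflected e v x y)) \<longlongrightarrow> ennreal (reflected 0 v x y)) (at_right 0)"
    unfolding reflected_def gauss_eq[OF less_imp_le[OF v]] using v by (intro tendsto_intros tendsto_ennrealI) auto
  then have "\<forall>\<^sub>F e in at_right 0. ennreal (reflected e v x y) < a"
    using a by (intro order_tendstoD(2)) (auto simp: reflected_def)
  moreover have "\<forall>\<^sub>F e in at_right (0::real). 0 < e"
    by (simp add: eventually_at_right_less)
  ultimately have "\<forall>\<^sub>F e in at_right (0::real). 0 < e \<and> ennreal (reflected e v x y) < a"
    by eventually_elim auto
  then obtain e :: real where e: "0 < e" "ennreal (reflected e v x y) < a"
    using eventually_happens'[OF trivial_limit_at_right_real] by blast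
  have Dv: "D n * real (Suc n) = v" for n by (simp add: D_def)
  have D0: "D \<longlonglongrightarrow> 0"
    unfolding D_def by (rule LIMSEQ_div_Suc)
  have up: "neg_walk (D n) n x y \<le> ennreal (reflected e v x y + (gauss (D n) (2 * e) + n * (3 * (D n)\<^sup>2 / (sqrt (D n) * e^4))))" for n
    using neg_walk_le_reflected[OF D[of n] e(1) x y, of n] unfolding Dv .
  have g: "(\<lambda>n. gauss (D n) (2 * e)) \<longlonglongrightarrow> 0"
  proof (rule tendsto_sandwich[OF _ _ tendsto_const])
    show "\<forall>\<^sub>F n in sequentially. gauss (D n) (2 * e) \<le> 2 * sqrt (D n) / (2 * e)\<^sup>2"
      using gauss_le_sqrt[of "2 * e"] D e by (intro always_eventually allI) auto
    have "(\<lambda>n. 2 * sqrt (D n) / (2 * e)\<^sup>2) \<longlonglongrightarrow> 2 * sqrt 0 / (2 * e)\<^sup>2"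
      using e by (intro tendsto_intros D0) auto
    then show "(\<lambda>n. 2 * sqrt (D n) / (2 * e)\<^sup>2) \<longlonglongrightarrow> 0" by simp
  qed simp
  have h: "(\<lambda>n. n * (3 * (D n)\<^sup>2 / (sqrt (D n) * e^4))) \<longlonglongrightarrow> 0"
  proof (rule tendsto_sandwich[OF _ _ tendsto_const])
    have "n * (3 * (D n)\<^sup>2 / (sqrt (D n) * e^4)) \<le> v * (3 / e^4) * sqrt (D n)" for n
    proof -
      have "n * (3 * (D n)\<^sup>2 / (sqrt (D n) * e^4)) = (n * D n) * (3 / e^4) * (D n / sqrt (D n))"
        by (simp add: power2_eq_square mult_ac)
      also have "\<dots> = (n * D n) * (3 / e^4) * sqrt (D n)"
        using D[of n] by (simp add: real_div_sqrt)
      also have "\<dots> \<le> v * (3 / e^4) * sqrt (D n)"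
        using D[of n] Dv[of n] e by (intro mult_right_mono) (auto simp: algebra_simps)
      finally show ?thesis .
    qed
    then show "\<forall>\<^sub>F n in sequentially. n * (3 * (D n)\<^sup>2 / (sqrt (D n) * e^4)) \<le> v * (3 / e^4) * sqrt (D n)"
      by simp
    show "\<forall>\<^sub>F n in sequentially. 0 \<le> n * (3 * (D n)\<^sup>2 / (sqrt (D n) * e^4))"
      using D e by (intro always_eventually allI) (simp add: less_imp_le)
    have "(\<lambda>n. v * (3 / e^4) * sqrt (D n)) \<longlonglongrightarrow> v * (3 / e^4) * sqrt 0"
      by (intro tendsto_intros D0)
    then show "(\<lambda>n. v * (3 / e^4) * sqrt (D n)) \<longlonglongrightarrow> 0" by simp
  qed
  have "(\<lambda>n. ennreal (reflected e v x y + (gauss (D n) (2 * e) + n * (3 * (D n)\<^sup>2 / (sqrt (D n) * e^4))))) \<longlonglongrightarrow> ennreal (reflected e v x y + (0 + 0))"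
    by (intro tendsto_intros tendsto_ennrealI g h)
  then have "\<forall>\<^sub>F n in sequentially. ennreal (reflected e v x y + (gauss (D n) (2 * e) + n * (3 * (D n)\<^sup>2 / (sqrt (D n) * e^4)))) < a"
    using e by (intro order_tendstoD(2)) auto
  then show "\<forall>\<^sub>F n in sequentially. neg_walk (v / real (Suc n)) n x y < a"
    unfolding D_def[symmetric] by eventually_elim (rule le_less_trans[OF up])
qed

text \<open>\<open>a\<close> is the height of the line at the current time and is raised by
  \<open>\<mu> * d\<close> with every step. As in \<open>neg_walk\<close> neither end point is
  tested; the constraint at the final point is supplied later by a separate bound.\<close>

primrec line_walk :: "real \<Rightarrow> real \<Rightarrow> nat \<Rightarrow> real \<Rightarrow> real \<Rightarrow> real \<Rightarrow> ennreal" where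
  "line_walk \<mu> d 0 a x y = ennreal (gauss d (y - x))"
| "line_walk \<mu> d (Suc n) a x y =
     (\<integral>\<^sup>+z. ennreal (gauss d (z - x)) * indicator {..a + \<mu> * d} z * line_walk \<mu> d n (a + \<mu> * d) z y \<partial>lborel)"

lemma measurable_line_walk [measurable]:
  "(\<lambda>(x, y). line_walk \<mu> d n a x y) \<in> borel_measurable (borel \<Otimes>\<^sub>M borel)"
proof (induction n arbitrary: a)
  case 0
  show ?case by simp
next
  case (Suc n)
  note Suc[measurable]
  show ?case by simp measurable
qed

text \<open>Forgetting the line leaves the free walk. The bound depends only on the total duration
  and so serves as the dominating function for all refinements.\<close>

lemma line_walk_le: "0 < d \<Longrightarrow> line_walk \<mu> d n a x y \<le> ennreal (gauss (d * real (Suc n)) (y - x))"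
proof (induction n arbitrary: a x)
  case (Suc n)
  have "line_walk \<mu> d (Suc n) a x y \<le> (\<integral>\<^sup>+z. ennreal (gauss d (z - x) * gauss (d * real (Suc n)) (y - z)) \<partial>lborel)"
    unfolding line_walk.simps using Suc
    by (intro nn_integral_mono) (auto simp: indicator_def ennreal_mult' simp del: of_nat_Suc intro!: mult_left_mono)
  also have "\<dots> = ennreal (gauss (d + d * real (Suc n)) (y - x))"
    using Suc.prems by (intro gauss_convolution) auto
  finally show ?case by (simp add: algebra_simps)
qed simp

text \<open>Completing the square: the Cameron-Martin density of one step.\<close>

lemma gauss_add_drift:
  "0 < d \<Longrightarrow> gauss d (z + d * \<mu>) = exp (- \<mu> * z - \<mu>\<^sup>2 * d / 2) * gauss d z"
  by (simp add: gauss_eq exp_add[symmetric] field_simps power2_eq_square)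

text \<open>A discrete form of Girsanov's theorem, in coordinates relative to the line.\<close>

lemma line_walk_eq:
  assumes d: "0 < d"
  shows "line_walk \<mu> d n a (x + a) (y + a + real (Suc n) * (\<mu> * d)) =
         ennreal (exp (- \<mu> * (y - x) - \<mu>\<^sup>2 * (real (Suc n) * d) / 2)) * neg_walk d n x y"
proof (induction n arbitrary: a x)
  case 0
  show ?case
    using gauss_add_drift[OF d, of "y - x" \<mu>] by (simp add: ennreal_mult'[symmetric] algebra_simps)
next
  case (Suc n)
  let ?Y = "y + a + real (Suc (Suc n)) * (\<mu> * d)"
  have Y: "?Y = y + (a + \<mu> * d) + real (Suc n) * (\<mu> * d)" by (simp add: algebra_simps)
  let ?c = "exp (- \<mu> * (y - x) - \<mu>\<^sup>2 * (real (Suc (Suc n)) * d) / 2)"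
  let ?F = "\<lambda>z. ennreal (gauss d (z + (a + \<mu> * d) - (x + a))) * indicator {..a + \<mu> * d} (z + (a + \<mu> * d)) *
      line_walk \<mu> d n (a + \<mu> * d) (z + (a + \<mu> * d)) ?Y"
  have "line_walk \<mu> d (Suc n) a (x + a) ?Y = (\<integral>\<^sup>+z. ?F (z - (a + \<mu> * d)) \<partial>lborel)"
    by simp
  also have "\<dots> = (\<integral>\<^sup>+z. ?F z \<partial>lborel)"
    by (rule nn_integral_shift) measurable
  also have "\<dots> = (\<integral>\<^sup>+z. ennreal ?c * (ennreal (gauss d (z - x)) * indicator {..0} z * neg_walk d n z y) \<partial>lborel)"
  proof (rule nn_integral_cong)
    fix z
    have 1: "gauss d (z + (a + \<mu> * d) - (x + a)) = exp (- \<mu> * (z - x) - \<mu>\<^sup>2 * d / 2) * gauss d (z - x)"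
      using gauss_add_drift[OF d, of "z - x" \<mu>] by (simp add: algebra_simps)
    have 2: "line_walk \<mu> d n (a + \<mu> * d) (z + (a + \<mu> * d)) ?Y =
        ennreal (exp (- \<mu> * (y - z) - \<mu>\<^sup>2 * (real (Suc n) * d) / 2)) * neg_walk d n z y"
      unfolding Y by (rule Suc.IH)
    \<comment> \<open>The weight is multiplicative along the path because its exponent is additive
      in displacement and in time.\<close>
    have 3: "?c = exp (- \<mu> * (z - x) - \<mu>\<^sup>2 * d / 2) * exp (- \<mu> * (y - z) - \<mu>\<^sup>2 * (real (Suc n) * d) / 2)"
      unfolding exp_add[symmetric] by (rule arg_cong[of _ _ exp]) (simp add: field_simps)
    show "?F z = ennreal ?c * (ennreal (gauss d (z - x)) * indicator {..0} z * neg_walk d n z y)"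
      unfolding 1 2 3 by (simp add: ennreal_mult' mult_ac indicator_def)
  qed
  also have "\<dots> = ennreal ?c * neg_walk d (Suc n) x y"
    by (simp add: nn_integral_cmult)
  finally show ?case .
qed

text \<open>For x at most a and y at most c: the Gaussian transition density in time v, times the
  probability that the Brownian bridge from x to y stays below the line from a to c.\<close>

definition bridge :: "real \<Rightarrow> real \<Rightarrow> real \<Rightarrow> real \<Rightarrow> real \<Rightarrow> real" where
  "bridge v a c x y = (1 - exp (- 2 * (a - x) * (c - y) / v)) * gauss v (y - x)"

text \<open>Relative to the line, the slope survives only as an exponential weight that does not
  depend on n, so the limit is that of the horizontal barrier.\<close>

lemma line_walk_tendsto:
  assumes v: "0 < v" and x: "x \<le> a" and y: "y \<le> a + \<mu> * v"
  shows "(\<lambda>n. line_walk \<mu> (v / real (Suc n)) n a x y) \<longlonglongrightarrow> ennreal (bridge v a (a + \<mu> * v) x y)"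
proof -
  define x' where "x' = x - a"
  define y' where "y' = y - (a + \<mu> * v)"
  let ?c = "exp (- \<mu> * (y' - x') - \<mu>\<^sup>2 * v / 2)"
  have eq: "line_walk \<mu> (v / real (Suc n)) n a x y = ennreal ?c * neg_walk (v / real (Suc n)) n x' y'" for n
  proof -
    define d where "d = v / real (Suc n)"
    have d: "0 < d" "real (Suc n) * d = v" using v by (auto simp: d_def)
    have "y = y' + a + real (Suc n) * (\<mu> * d)"
      using d(2) by (simp add: y'_def mult.left_commute del: of_nat_Suc)
    moreover have "x = x' + a" by (simp add: x'_def)
    ultimately show ?thesis
      using line_walk_eq[OF d(1), of \<mu> n a x' y'] d(2) unfolding d_def[symmetric] by simp
  qed
  have "(\<lambda>n. ennreal ?c * neg_walk (v / real (Suc n)) n x' y') \<longlonglongrightarrow> ennreal ?c * ennreal (gauss v (y' - x') - gauss v (y' + x'))"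
    using assms by (intro ennreal_tendsto_cmult neg_walk_tendsto) (auto simp: x'_def y'_def)
  \<comment> \<open>The weight restores the free density, and the image term is the direct term
    times exp (- 2 x' y' / v); this is the origin of the exponential in
    \<open>bridge\<close>.\<close>
  moreover have "?c * (gauss v (y' - x') - gauss v (y' + x')) = bridge v a (a + \<mu> * v) x y"
  proof -
    have 1: "gauss v (y - x) = ?c * gauss v (y' - x')"
      using gauss_add_drift[OF v, of "y' - x'" \<mu>] by (simp add: x'_def y'_def algebra_simps)
    have "gauss v (y' + x') = exp (- 2 * x' * y' / v) * gauss v (y' - x')"
      using v by (simp add: gauss_eq exp_add[symmetric] field_simps power2_eq_square)
    moreover have "- 2 * x' * y' / v = - 2 * (a - x) * (a + \<mu> * v - y) / v"
      by (simp add: x'_def y'_def algebra_simps)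
    ultimately show ?thesis
      unfolding bridge_def 1 by (simp add: algebra_simps)
  qed
  ultimately show ?thesis
    unfolding eq by (simp add: ennreal_mult'[symmetric])
qed

section \<open>Brownian motion on a finite set of times\<close>

text \<open>Each pair consists of the duration of a step and the upper bound at its end. The
  continuation f, evaluated at the last position, is what makes concatenation of lists a
  composition.\<close>

primrec walk_int :: "(real \<times> real) list \<Rightarrow> (real \<Rightarrow> ennreal) \<Rightarrow> real \<Rightarrow> ennreal" where
  "walk_int [] f x = f x"
| "walk_int (p # L) f x = (\<integral>\<^sup>+y. ennreal (gauss (fst p) (y - x)) * indicator {..snd p} y * walk_int L f y \<partial>lborel)"

primrec path_ok :: "(real \<Rightarrow> real) \<Rightarrow> real \<Rightarrow> (real \<times> real) list \<Rightarrow> bool" where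
  "path_ok w a [] \<longleftrightarrow> True"
| "path_ok w a (p # L) \<longleftrightarrow> w (a + fst p) \<le> snd p \<and> path_ok w (a + fst p) L"

text \<open>The condition of \<open>path_ok\<close> in terms of increments alone, so that it can be
  evaluated under the product law of independent increments.\<close>

primrec sums_ok :: "(nat \<Rightarrow> real) \<Rightarrow> nat \<Rightarrow> real \<Rightarrow> (real \<times> real) list \<Rightarrow> bool" where
  "sums_ok z i x [] \<longleftrightarrow> True"
| "sums_ok z i x (p # L) \<longleftrightarrow> x + z i \<le> snd p \<and> sums_ok z (Suc i) (x + z i) L"

lemma measurable_walk_int [measurable]:
  assumes [measurable]: "f \<in> borel_measurable borel"
  shows "walk_int L f \<in> borel_measurable borel"
proof (induction L)
  case Nil
  then show ?case by simp
next
  case (Cons p L)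
  note Cons[measurable]
  show ?case by simp measurable
qed

lemma walk_int_append: "walk_int (L @ L') f x = walk_int L (walk_int L' f) x"
  by (induction L arbitrary: x) simp_all

lemma path_ok_append:
  "path_ok w a (L @ L') \<longleftrightarrow> path_ok w a L \<and> path_ok w (a + sum_list (map fst L)) L'"
  by (induction L arbitrary: a) (simp_all add: add.assoc)

lemma sums_ok_cong: "(\<And>j. i \<le> j \<Longrightarrow> z j = z' j) \<Longrightarrow> sums_ok z i x L = sums_ok z' i x L"
  by (induction L arbitrary: i x) auto

lemma sums_ok_increments:
  assumes "\<And>j. j < length L \<Longrightarrow> s (Suc (i + j)) = s (i + j) + fst (L ! j)"
    and "\<And>j. j < length L \<Longrightarrow> z (i + j) = w (s (Suc (i + j))) - w (s (i + j))"
  shows "sums_ok z i (x + w (s i)) L \<longleftrightarrow> path_ok (\<lambda>r. x + w r) (s i) L"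
  using assms
proof (induction L arbitrary: i)
  case (Cons p L)
  have 1: "s (Suc i) = s i + fst p" "z i = w (s (Suc i)) - w (s i)"
    using Cons.prems(1)[of 0] Cons.prems(2)[of 0] by auto
  have "sums_ok z (Suc i) (x + w (s (Suc i))) L \<longleftrightarrow> path_ok (\<lambda>r. x + w r) (s (Suc i)) L"
    using Cons.prems(1)[of "Suc _"] Cons.prems(2)[of "Suc _"] by (intro Cons.IH) auto
  moreover have "x + w (s i) + z i = x + w (s (Suc i))" using 1(2) by simp
  ultimately show ?case using 1(1) by (simp add: add.assoc)
qed simp

lemma measurable_sums_ok [measurable (raw)]:
  assumes "\<And>j. j < length L \<Longrightarrow> (\<lambda>\<omega>. z \<omega> (i + j)) \<in> borel_measurable M"
    and "x \<in> borel_measurable M"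
  shows "Measurable.pred M (\<lambda>\<omega>. sums_ok (z \<omega>) i (x \<omega>) L)"
  using assms
proof (induction L arbitrary: i x)
  case (Cons p L)
  have [measurable]: "(\<lambda>\<omega>. z \<omega> i) \<in> borel_measurable M" using Cons.prems(1)[of 0] by simp
  note Cons.prems(2)[measurable]
  have [measurable]: "Measurable.pred M (\<lambda>\<omega>. sums_ok (z \<omega>) (Suc i) (x \<omega> + z \<omega> i) L)"
    using Cons.prems(1)[of "Suc _"] by (intro Cons.IH) auto
  show ?case by simp
qed simp

lemma sigma_finite_gauss: "0 < d \<Longrightarrow> sigma_finite_measure (density lborel (\<lambda>x. ennreal (gauss d x)))"
  using prob_space_normal_density[of "sqrt d" 0]
  by (auto simp: gauss_def intro!: finite_measure.axioms prob_space.finite_measure prob_space_imp_sigma_finite)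

text \<open>Induction over the list, splitting off the first coordinate of the product measure; the
  remaining increments start from the shifted position.\<close>

lemma nn_integral_sums_ok:
  assumes d: "\<And>j. 0 < d j" and L: "\<And>j. j < length L \<Longrightarrow> fst (L ! j) = d (i + j)"
  shows "(\<integral>\<^sup>+z. indicator {z. sums_ok z i x L} z \<partial>(\<Pi>\<^sub>M j\<in>{i..<i + length L}. density lborel (\<lambda>x. ennreal (gauss (d j) x)))) =
         walk_int L (\<lambda>_. 1) x"
  using L
proof (induction L arbitrary: i x)
  case Nil
  show ?case by (simp add: PiM_empty nn_integral_count_space_finite)
next
  case (Cons p L)
  let ?N = "\<lambda>j. density lborel (\<lambda>x. ennreal (gauss (d j) x))"
  interpret product_sigma_finite ?N
    by (rule product_sigma_finite.intro) (rule sigma_finite_gauss[OF d])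
  let ?I = "{Suc i..<Suc i + length L}"
  have I: "{i..<i + length (p # L)} = insert i ?I" by auto
  have p: "fst p = d i" using Cons.prems[of 0] by simp
  have sets: "sets (PiM J ?N) = sets (PiM J (\<lambda>_. borel))" for J
    by (intro sets_PiM_cong) auto
  have m: "(\<lambda>z. indicator {z. sums_ok z i x (p # L)} z :: ennreal) \<in> borel_measurable (PiM (insert i ?I) ?N)"
  proof -
    have "Measurable.pred (PiM (insert i ?I) (\<lambda>_. borel)) (\<lambda>z. sums_ok z i x (p # L))"
      by (rule measurable_sums_ok) (auto intro!: measurable_component_singleton)
    then have [measurable]: "Measurable.pred (PiM (insert i ?I) ?N) (\<lambda>z. sums_ok z i x (p # L))"
      by (simp add: measurable_cong_sets[OF sets refl])
    show ?thesis by measurable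
  qed
  have "(\<integral>\<^sup>+z. indicator {z. sums_ok z i x (p # L)} z \<partial>PiM {i..<i + length (p # L)} ?N) =
        (\<integral>\<^sup>+y. \<integral>\<^sup>+z. indicator {z. sums_ok z i x (p # L)} (z(i := y)) \<partial>PiM ?I ?N \<partial>?N i)"
    unfolding I by (rule product_nn_integral_insert_rev) (auto intro: m)
  also have "\<dots> = (\<integral>\<^sup>+y. indicator {..snd p} (x + y) * walk_int L (\<lambda>_. 1) (x + y) \<partial>?N i)"
  proof (rule nn_integral_cong)
    fix y
    have "(\<integral>\<^sup>+z. indicator {z. sums_ok z i x (p # L)} (z(i := y)) \<partial>PiM ?I ?N) =
          (\<integral>\<^sup>+z. indicator {..snd p} (x + y) * indicator {z. sums_ok z (Suc i) (x + y) L} z \<partial>PiM ?I ?N)"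
      by (intro nn_integral_cong)
         (auto simp: indicator_def sums_ok_cong[of "Suc i" "_(i := y)" _ "x + y" L])
    also have "\<dots> = indicator {..snd p} (x + y) * (\<integral>\<^sup>+z. indicator {z. sums_ok z (Suc i) (x + y) L} z \<partial>PiM ?I ?N)"
      by (auto simp: indicator_def)
    also have "(\<integral>\<^sup>+z. indicator {z. sums_ok z (Suc i) (x + y) L} z \<partial>PiM ?I ?N) = walk_int L (\<lambda>_. 1) (x + y)"
      using Cons.prems[of "Suc _"] by (intro Cons.IH) auto
    finally show "(\<integral>\<^sup>+z. indicator {z. sums_ok z i x (p # L)} (z(i := y)) \<partial>PiM ?I ?N) =
        indicator {..snd p} (x + y) * walk_int L (\<lambda>_. 1) (x + y)" .
  qed
  also have "\<dots> = (\<integral>\<^sup>+y. ennreal (gauss (d i) y) * (indicator {..snd p} (x + y) * walk_int L (\<lambda>_. 1) (x + y)) \<partial>lborel)"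
    by (rule nn_integral_density) measurable
  \<comment> \<open>Translation by x replaces the increment by the position reached, which is the
    variable of \<open>walk_int\<close>.\<close>
  also have "\<dots> = (\<integral>\<^sup>+y. (\<lambda>y. ennreal (gauss (d i) y) * (indicator {..snd p} (x + y) * walk_int L (\<lambda>_. 1) (x + y))) (y - x) \<partial>lborel)"
    by (rule nn_integral_shift[symmetric]) measurable
  finally show ?case by (simp add: p mult.assoc)
qed

lemma brownian_walk:
  assumes M: "prob_space M" and BM: "standard_brownian_motion M B"
    and L: "\<And>p. p \<in> set L \<Longrightarrow> 0 < fst p"
  shows "{\<omega> \<in> space M. path_ok (\<lambda>r. x + B r \<omega>) 0 L} \<in> sets M"
    and "emeasure M {\<omega> \<in> space M. path_ok (\<lambda>r. x + B r \<omega>) 0 L} = walk_int L (\<lambda>_. 1) x"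
proof -
  interpret prob_space M by fact
  define n where "n = length L"
  \<comment> \<open>The value 1 beyond the list keeps every variance positive, so that the whole
    family of factors is sigma-finite.\<close>
  define d where "d j = (if j < n then fst (L ! j) else 1)" for j
  define s where "s j = (\<Sum>i<j. d i)" for j
  define Z where "Z j \<omega> = B (s (Suc j)) \<omega> - B (s j) \<omega>" for j \<omega>
  let ?N = "\<lambda>j. density lborel (\<lambda>x. ennreal (gauss (d j) x))"
  have d: "0 < d j" for j using L by (auto simp: d_def n_def)
  have s: "s 0 = 0" "s (Suc j) = s j + d j" for j by (simp_all add: s_def)
  have s0: "0 \<le> s j" for j unfolding s_def by (intro sum_nonneg less_imp_le d)
  have B: "B r \<in> borel_measurable M" if "0 \<le> r" for r
    using BM that by (simp add: standard_brownian_motion_def)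
  have Z: "Z j \<in> borel_measurable M" for j
    unfolding Z_def using B[OF s0] by measurable
  have B0: "B 0 \<omega> = 0" if "\<omega> \<in> space M" for \<omega>
    using BM that by (simp add: standard_brownian_motion_def)
  have iff: "sums_ok (\<lambda>j. Z j \<omega>) 0 x L \<longleftrightarrow> path_ok (\<lambda>r. x + B r \<omega>) 0 L" if "\<omega> \<in> space M" for \<omega>
    using sums_ok_increments[of L s 0 "\<lambda>j. Z j \<omega>" "\<lambda>r. B r \<omega>" x] s d_def B0[OF that]
    by (simp add: n_def Z_def)
  have ev: "{\<omega> \<in> space M. path_ok (\<lambda>r. x + B r \<omega>) 0 L} = {\<omega> \<in> space M. sums_ok (\<lambda>j. Z j \<omega>) 0 x L}"
    using iff by auto
  have [measurable]: "Measurable.pred M (\<lambda>\<omega>. sums_ok (\<lambda>j. Z j \<omega>) 0 x L)"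
    using Z by (intro measurable_sums_ok) auto
  show "{\<omega> \<in> space M. path_ok (\<lambda>r. x + B r \<omega>) 0 L} \<in> sets M"
    unfolding ev by measurable
  show "emeasure M {\<omega> \<in> space M. path_ok (\<lambda>r. x + B r \<omega>) 0 L} = walk_int L (\<lambda>_. 1) x"
  \<comment> \<open>The description of independence by a product law is applied to a nonempty index
    set.\<close>
  proof (cases "n = 0")
    case True
    then show ?thesis by (simp add: n_def emeasure_space_1)
  next
    case False
    have "indep_vars (\<lambda>_. borel) Z {..<n}"
    proof -
      have "\<forall>(p::nat) (r::nat \<Rightarrow> real). 0 \<le> r 0 \<longrightarrow> (\<forall>i<p. r i < r (Suc i)) \<longrightarrow>
          indep_vars (\<lambda>_. borel) (\<lambda>i \<omega>. B (r (Suc i)) \<omega> - B (r i) \<omega>) {..<p}"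
        using BM by (simp add: standard_brownian_motion_def)
      from this[rule_format, of s n] show ?thesis
        using s(1) s(2) d unfolding Z_def[abs_def] by simp
    qed
    then have D: "distr M (\<Pi>\<^sub>M i\<in>{..<n}. borel) (\<lambda>\<omega>. \<lambda>i\<in>{..<n}. Z i \<omega>) = (\<Pi>\<^sub>M i\<in>{..<n}. distr M borel (Z i))"
      using False Z by (subst (asm) indep_vars_iff_distr_eq_PiM) (auto simp: lessThan_empty_iff)
    have DZ: "distr M borel (Z j) = ?N j" for j
    proof -
      have "distributed M lborel (Z j) (normal_density 0 (sqrt (s (Suc j) - s j)))"
      proof -
        have "\<forall>r u. 0 \<le> r \<longrightarrow> r < u \<longrightarrow> distributed M lborel (\<lambda>\<omega>. B u \<omega> - B r \<omega>) (normal_density 0 (sqrt (u - r)))"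
          using BM by (simp add: standard_brownian_motion_def)
        from this[rule_format, of "s j" "s (Suc j)"] show ?thesis
          using s0[of j] s(2)[of j] d[of j] unfolding Z_def[abs_def] by simp
      qed
      then have "distr M lborel (Z j) = ?N j"
        by (simp add: distributed_def gauss_def s)
      then show ?thesis by (simp cong: distr_cong)
    qed
    have m: "(\<lambda>\<omega>. \<lambda>i\<in>{..<n}. Z i \<omega>) \<in> measurable M (\<Pi>\<^sub>M i\<in>{..<n}. borel)"
      using Z by (intro measurable_restrict) auto
    have p: "Measurable.pred (\<Pi>\<^sub>M i\<in>{..<n}. borel) (\<lambda>z. sums_ok z 0 x L)"
      by (rule measurable_sums_ok) (auto intro!: measurable_component_singleton simp: n_def)
    have restr: "sums_ok (\<lambda>i\<in>{..<n}. Z i \<omega>) 0 x L \<longleftrightarrow> sums_ok (\<lambda>j. Z j \<omega>) 0 x L" if "\<omega> \<in> space M" for \<omega>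
      using sums_ok_increments[of L s 0 "\<lambda>i\<in>{..<n}. Z i \<omega>" "\<lambda>r. B r \<omega>" x] s d_def B0[OF that] iff[OF that]
      by (simp add: n_def Z_def)
    have "emeasure M {\<omega> \<in> space M. sums_ok (\<lambda>j. Z j \<omega>) 0 x L} =
          (\<integral>\<^sup>+\<omega>. indicator {z. sums_ok z 0 x L} (\<lambda>i\<in>{..<n}. Z i \<omega>) \<partial>M)"
    proof -
      have "{\<omega> \<in> space M. sums_ok (\<lambda>j. Z j \<omega>) 0 x L} \<in> sets M" by measurable
      then have "emeasure M {\<omega> \<in> space M. sums_ok (\<lambda>j. Z j \<omega>) 0 x L} =
          (\<integral>\<^sup>+\<omega>. indicator {\<omega> \<in> space M. sums_ok (\<lambda>j. Z j \<omega>) 0 x L} \<omega> \<partial>M)"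
        by (rule nn_integral_indicator[symmetric])
      also have "\<dots> = (\<integral>\<^sup>+\<omega>. indicator {z. sums_ok z 0 x L} (\<lambda>i\<in>{..<n}. Z i \<omega>) \<partial>M)"
        by (intro nn_integral_cong) (simp add: indicator_def restr)
      finally show ?thesis .
    qed
    also have "\<dots> = (\<integral>\<^sup>+z. indicator {z. sums_ok z 0 x L} z \<partial>distr M (\<Pi>\<^sub>M i\<in>{..<n}. borel) (\<lambda>\<omega>. \<lambda>i\<in>{..<n}. Z i \<omega>))"
      using p by (intro nn_integral_distr[symmetric] m)
        (simp add: borel_measurable_indicator_iff pred_def Int_def conj_commute)
    also have "\<dots> = walk_int L (\<lambda>_. 1) x"
      using nn_integral_sums_ok[of d L 0 x] d unfolding D DZ
      by (simp add: n_def d_def atLeast0LessThan)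
    finally show ?thesis unfolding ev .
  qed
qed

section \<open>Brownian motion below a piecewise linear boundary\<close>

text \<open>The final bound is a separate argument because the boundary may jump at the end of a
  segment, where the smaller of its two one-sided values counts.\<close>

primrec steps :: "real \<Rightarrow> real \<Rightarrow> nat \<Rightarrow> real \<Rightarrow> real \<Rightarrow> (real \<times> real) list" where
  "steps \<mu> d 0 a \<beta> = [(d, \<beta>)]"
| "steps \<mu> d (Suc n) a \<beta> = (d, a + \<mu> * d) # steps \<mu> d n (a + \<mu> * d) \<beta>"

lemma steps_pos: "0 < d \<Longrightarrow> p \<in> set (steps \<mu> d n a \<beta>) \<Longrightarrow> 0 < fst p"
  by (induction n arbitrary: a) auto

lemma sum_list_steps: "sum_list (map fst (steps \<mu> d n a \<beta>)) = real (Suc n) * d"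
  by (induction n arbitrary: a) (auto simp: algebra_simps)

lemma path_ok_steps:
  "path_ok w s (steps \<mu> d n a \<beta>) \<longleftrightarrow>
     (\<forall>l\<in>{1..n}. w (s + real l * d) \<le> a + \<mu> * (real l * d)) \<and> w (s + real (Suc n) * d) \<le> \<beta>"
proof (induction n arbitrary: s a)
  case (Suc n)
  have *: "(\<forall>l\<in>{1..Suc n}. P l) \<longleftrightarrow> P 1 \<and> (\<forall>l\<in>{1..n}. P (Suc l))" for P
    by (auto simp: Ball_def) (metis One_nat_def Suc_le_mono not0_implies_Suc not_less_eq_eq le0)
  show ?case
    unfolding * by (simp add: Suc.IH algebra_simps)
qed simp

text \<open>Fubini brings the end point of the segment to the outside. Everything that depends on
  the refinement of this segment is then inside \<open>line_walk\<close>, whose limit is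
  known.\<close>

lemma walk_int_steps:
  assumes [measurable]: "f \<in> borel_measurable borel"
  shows "walk_int (steps \<mu> d n a \<beta>) f x = (\<integral>\<^sup>+y. line_walk \<mu> d n a x y * (indicator {..\<beta>} y * f y) \<partial>lborel)"
proof (induction n arbitrary: a x)
  case 0
  show ?case by (simp add: mult.assoc)
next
  case (Suc n)
  let ?a = "a + \<mu> * d"
  have "walk_int (steps \<mu> d (Suc n) a \<beta>) f x =
        (\<integral>\<^sup>+z. \<integral>\<^sup>+y. ennreal (gauss d (z - x)) * indicator {..?a} z * (line_walk \<mu> d n ?a z y * (indicator {..\<beta>} y * f y)) \<partial>lborel \<partial>lborel)"
    by (simp add: Suc.IH nn_integral_cmult)
  also have "\<dots> = (\<integral>\<^sup>+y. \<integral>\<^sup>+z. ennreal (gauss d (z - x)) * indicator {..?a} z * (line_walk \<mu> d n ?a z y * (indicator {..\<beta>} y * f y)) \<partial>lborel \<partial>lborel)"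
    by (rule lborel_pair.Fubini') measurable
  also have "\<dots> = (\<integral>\<^sup>+y. \<integral>\<^sup>+z. ennreal (gauss d (z - x)) * indicator {..?a} z * line_walk \<mu> d n ?a z y * (indicator {..\<beta>} y * f y) \<partial>lborel \<partial>lborel)"
    by (simp add: mult.assoc)
  also have "\<dots> = (\<integral>\<^sup>+y. line_walk \<mu> d (Suc n) a x y * (indicator {..\<beta>} y * f y) \<partial>lborel)"
    by (intro nn_integral_cong) (simp add: nn_integral_multc)
  finally show ?case .
qed

lemma measurable_bridge [measurable]: "(\<lambda>(x, y). bridge v a c x y) \<in> borel_measurable (borel \<Otimes>\<^sub>M borel)"
  unfolding bridge_def by measurable

lemma bridge_nonneg:
  assumes "0 < v" "x \<le> a" "y \<le> c"
  shows "0 \<le> bridge v a c x y"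
proof -
  have "0 \<le> 2 * ((a - x) * (c - y)) / v" using assms by simp
  moreover have "- 2 * (a - x) * (c - y) / v = - (2 * ((a - x) * (c - y)) / v)"
    by (simp only: minus_divide_left mult_minus_left mult.assoc)
  ultimately have "exp (- 2 * (a - x) * (c - y) / v) \<le> 1" by simp
  then show ?thesis unfolding bridge_def by (intro mult_nonneg_nonneg) auto
qed

lemma bridge_le_gauss:
  assumes "0 < v" "y \<le> c"
  shows "ennreal (bridge v a c x y) \<le> ennreal (gauss v (y - x))"
proof -
  have "bridge v a c x y \<le> 1 * gauss v (y - x)"
    unfolding bridge_def by (intro mult_right_mono) auto
  then show ?thesis by (simp add: ennreal_leI)
qed

text \<open>One integrable bound for all small shifts, from y^2 at most 2 (y - x)^2 + 2 x^2: the
  variance doubles, sqrt 2 adjusts the normalisation, and the exponential absorbs x^2.\<close>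

lemma gauss_shift_le:
  assumes v: "0 < v" and x: "\<bar>x\<bar> \<le> 1"
  shows "gauss v (y - x) \<le> sqrt 2 * exp (1 / (2 * v)) * gauss (2 * v) y"
proof -
  have "y\<^sup>2 \<le> 2 * (y - x)\<^sup>2 + 2 * x\<^sup>2"
    using zero_le_power2[of "y - 2 * x"] by (simp add: power2_eq_square algebra_simps)
  moreover have "x\<^sup>2 \<le> 1" using x by (simp add: abs_square_le_1)
  ultimately have "- (y - x)\<^sup>2 / (2 * v) \<le> 1 / (2 * v) + - y\<^sup>2 / (2 * (2 * v))"
    using v by (simp add: field_simps)
  then have "exp (- (y - x)\<^sup>2 / (2 * v)) \<le> exp (1 / (2 * v)) * exp (- y\<^sup>2 / (2 * (2 * v)))"
    by (simp add: exp_add[symmetric])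
  moreover have "sqrt (2 * pi * (2 * v)) = sqrt 2 * sqrt (2 * pi * v)"
    by (simp add: real_sqrt_mult)
  ultimately show ?thesis
    using v by (simp add: gauss_eq divide_right_mono)
qed

lemma walk_int_le_1: "(\<And>q. q \<in> set L \<Longrightarrow> 0 < fst q) \<Longrightarrow> walk_int L (\<lambda>_. 1) x \<le> 1"
proof (induction L arbitrary: x)
  case (Cons q L)
  have "walk_int (q # L) (\<lambda>_. 1) x \<le> (\<integral>\<^sup>+y. ennreal (gauss (fst q) (y - x)) \<partial>lborel)"
    unfolding walk_int.simps
  proof (intro nn_integral_mono)
    fix y
    have "walk_int L (\<lambda>_. 1) y \<le> 1" using Cons by simp
    then have "ennreal (gauss (fst q) (y - x)) * indicator {..snd q} y * walk_int L (\<lambda>_. 1) y \<le> ennreal (gauss (fst q) (y - x)) * 1 * 1"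
      by (intro mult_mono) (auto simp: indicator_def)
    then show "ennreal (gauss (fst q) (y - x)) * indicator {..snd q} y * walk_int L (\<lambda>_. 1) y \<le> ennreal (gauss (fst q) (y - x))"
      by simp
  qed
  then show ?case using nn_integral_gauss[of "fst q" x] Cons.prems by simp
qed simp

text \<open>There are m + 1 segments; on segment j, from \<open>T j\<close> to
  \<open>T (Suc j)\<close>, the boundary is the line from \<open>A j\<close> to \<open>C j\<close>.
  A jump of the boundary at \<open>T (Suc j)\<close> shows as a difference between
  \<open>C j\<close> and \<open>A (Suc j)\<close>.\<close>

locale barrier =
  fixes m :: nat and T A C :: "nat \<Rightarrow> real"
  assumes T0: "T 0 = 0" and T_less: "\<And>j. j \<le> m \<Longrightarrow> T j < T (Suc j)"
begin

text \<open>The \<beta> of the theorem, shifted by one index: \<open>gate j\<close> acts at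
  \<open>T (Suc j)\<close>. After the last segment there is no right-hand value to compare
  with.\<close>

definition gate :: "nat \<Rightarrow> real" where
  "gate j = (if j < m then min (C j) (A (Suc j)) else C j)"

definition slope :: "nat \<Rightarrow> real" where
  "slope j = (C j - A j) / (T (Suc j) - T j)"

definition line :: "nat \<Rightarrow> real \<Rightarrow> real" where
  "line j r = A j + slope j * (r - T j)"

text \<open>For x at most \<open>A j\<close>, this will be the probability of surviving the next k
  segments when starting from x at time \<open>T j\<close>.\<close>

primrec surv :: "nat \<Rightarrow> nat \<Rightarrow> real \<Rightarrow> ennreal" where
  "surv 0 j x = 1"
| "surv (Suc k) j x = (\<integral>\<^sup>+y. ennreal (bridge (T (Suc j) - T j) (A j) (C j) x y) * (indicator {..gate j} y * surv k (Suc j) y) \<partial>lborel)"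

primrec refine :: "nat \<Rightarrow> nat \<Rightarrow> nat \<Rightarrow> (real \<times> real) list" where
  "refine p 0 j = []"
| "refine p (Suc k) j = steps (slope j) ((T (Suc j) - T j) / real (Suc p)) p (A j) (gate j) @ refine p k (Suc j)"

lemma gate_le: "gate j \<le> C j" "j < m \<Longrightarrow> gate j \<le> A (Suc j)"
  by (auto simp: gate_def)

lemma line_end: "j \<le> m \<Longrightarrow> line j (T (Suc j)) = C j"
  using T_less[of j] by (simp add: line_def slope_def)

lemma line_start [simp]: "line j (T j) = A j"
  by (simp add: line_def)

lemma refine_pos: "j + k \<le> Suc m \<Longrightarrow> q \<in> set (refine p k j) \<Longrightarrow> 0 < fst q"
proof (induction k arbitrary: j q)
  case (Suc k)
  have "0 < (T (Suc j) - T j) / real (Suc p)" using T_less[of j] Suc.prems by simp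
  note steps_pos[OF this]
  moreover have "\<And>q. q \<in> set (refine p k (Suc j)) \<Longrightarrow> 0 < fst q"
    using Suc.IH[of "Suc j"] Suc.prems(1) by auto
  ultimately show ?case using Suc.prems(2) unfolding refine.simps set_append by blast
qed simp

lemma measurable_surv [measurable]: "surv k j \<in> borel_measurable borel"
proof (induction k arbitrary: j)
  case 0
  show ?case by simp
next
  case (Suc k)
  note Suc[measurable]
  show ?case by simp measurable
qed

lemma surv_le_1: "j + k \<le> Suc m \<Longrightarrow> surv k j x \<le> 1"
proof (induction k arbitrary: j x)
  case (Suc k)
  let ?v = "T (Suc j) - T j"
  have v: "0 < ?v" using T_less[of j] Suc.prems by simp
  have "surv (Suc k) j x \<le> (\<integral>\<^sup>+y. ennreal (gauss ?v (y - x)) \<partial>lborel)"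
    unfolding surv.simps
  proof (intro nn_integral_mono)
    fix y
    have "ennreal (bridge ?v (A j) (C j) x y) \<le> ennreal (gauss ?v (y - x))" if "y \<le> gate j"
      using that gate_le(1)[of j] by (intro bridge_le_gauss v) simp
    then show "ennreal (bridge ?v (A j) (C j) x y) * (indicator {..gate j} y * surv k (Suc j) y) \<le> ennreal (gauss ?v (y - x))"
      using mult_mono[of "ennreal (bridge ?v (A j) (C j) x y)" "ennreal (gauss ?v (y - x))" "surv k (Suc j) y" 1] Suc.IH[of "Suc j" y] Suc.prems
      by (auto simp: indicator_def)
  qed
  then show ?case using nn_integral_gauss[OF v] by simp
qed simp

lemma walk_int_refine_le_1: "j + k \<le> Suc m \<Longrightarrow> walk_int (refine p k j) (\<lambda>_. 1) x \<le> 1"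
  by (rule walk_int_le_1) (rule refine_pos)

text \<open>Induction from the last segment backwards. In each segment the kernel and the
  continuation converge pointwise, and the free Gaussian density dominates.\<close>

lemma walk_int_tendsto:
  "j + k \<le> Suc m \<Longrightarrow> x \<le> A j \<Longrightarrow> (\<lambda>p. walk_int (refine p k j) (\<lambda>_. 1) x) \<longlonglongrightarrow> surv k j x"
proof (induction k arbitrary: j x)
  case (Suc k)
  let ?v = "T (Suc j) - T j"
  let ?f = "\<lambda>p. walk_int (refine p k (Suc j)) (\<lambda>_. 1)"
  let ?W = "\<lambda>p y. line_walk (slope j) (?v / real (Suc p)) p (A j) x y"
  have v: "0 < ?v" using T_less[of j] Suc.prems by simp
  have C: "A j + slope j * ?v = C j" using v by (simp add: slope_def)
  have "(\<lambda>p. \<integral>\<^sup>+y. ?W p y * (indicator {..gate j} y * ?f p y) \<partial>lborel) \<longlonglongrightarrow> surv (Suc k) j x"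
    unfolding surv.simps
  proof (rule nn_integral_dominated_convergence[where w = "\<lambda>y. ennreal (gauss ?v (y - x))"])
    show "AE y in lborel. ?W p y * (indicator {..gate j} y * ?f p y) \<le> ennreal (gauss ?v (y - x))" for p
    proof (intro AE_I2)
      fix y
      have "?W p y \<le> ennreal (gauss ?v (y - x))"
        using line_walk_le[of "?v / real (Suc p)" "slope j" p "A j" x y] v by simp
      then have "?W p y * (indicator {..gate j} y * ?f p y) \<le> ennreal (gauss ?v (y - x)) * (1 * 1)"
        using Suc.prems by (intro mult_mono walk_int_refine_le_1) (auto simp: indicator_def)
      then show "?W p y * (indicator {..gate j} y * ?f p y) \<le> ennreal (gauss ?v (y - x))" by simp
    qed
    show "(\<integral>\<^sup>+y. ennreal (gauss ?v (y - x)) \<partial>lborel) < \<infinity>"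
      using nn_integral_gauss[OF v] by simp
    show "AE y in lborel. (\<lambda>p. ?W p y * (indicator {..gate j} y * ?f p y)) \<longlonglongrightarrow>
        ennreal (bridge ?v (A j) (C j) x y) * (indicator {..gate j} y * surv k (Suc j) y)"
    proof (intro AE_I2)
      fix y
      show "(\<lambda>p. ?W p y * (indicator {..gate j} y * ?f p y)) \<longlonglongrightarrow>
        ennreal (bridge ?v (A j) (C j) x y) * (indicator {..gate j} y * surv k (Suc j) y)"
      proof (cases "y \<le> gate j")
        case True
        have W: "(\<lambda>p. ?W p y) \<longlonglongrightarrow> ennreal (bridge ?v (A j) (C j) x y)"
          using line_walk_tendsto[OF v, of x "A j" y "slope j"] Suc.prems True gate_le(1)[of j]
          unfolding C by simp
        have f: "(\<lambda>p. ?f p y) \<longlonglongrightarrow> surv k (Suc j) y"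
        \<comment> \<open>After the last segment the continuation is constantly 1. Otherwise j < m,
          so that \<open>gate j\<close> is at most \<open>A (Suc j)\<close> and the induction
          hypothesis is available at y.\<close>
        proof (cases k)
          case 0
          then show ?thesis by simp
        next
          case (Suc k')
          then show ?thesis
            using Suc.IH[of "Suc j" y] Suc.prems True gate_le(2)[of j] by simp
        qed
        have "(\<lambda>p. ?W p y * ?f p y) \<longlonglongrightarrow> ennreal (bridge ?v (A j) (C j) x y) * surv k (Suc j) y"
          using W f by (rule tendsto_mult_ennreal)
             (use surv_le_1[of "Suc j" k y] Suc.prems in \<open>auto simp: top_unique\<close>)
        then show ?thesis using True by simp
      qed simp
    qed
  qed measurable
  then show ?case
    by (simp add: walk_int_append walk_int_steps)
qed simp

end

section \<open>Continuous paths and strict inequalities\<close>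

context barrier begin

lemma T_nonneg: "j \<le> Suc m \<Longrightarrow> 0 \<le> T j"
proof (induction j)
  case (Suc j)
  then show ?case using T_less[of j] by simp
qed (simp add: T0)

lemma path_ok_refine:
  "j + k \<le> Suc m \<Longrightarrow> path_ok w (T j) (refine p k j) \<longleftrightarrow>
     (\<forall>i\<in>{j..<j + k}. (\<forall>l\<in>{1..p}. w (T i + real l * ((T (Suc i) - T i) / real (Suc p))) \<le>
          line i (T i + real l * ((T (Suc i) - T i) / real (Suc p)))) \<and> w (T (Suc i)) \<le> gate i)"
proof (induction k arbitrary: j)
  case (Suc k)
  have I: "{j..<j + Suc k} = insert j {Suc j..<Suc j + k}" by auto
  have e: "T j + real (Suc p) * ((T (Suc j) - T j) / real (Suc p)) = T (Suc j)"
    by (simp del: of_nat_Suc)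
  show ?case
    using Suc.IH[of "Suc j"] Suc.prems
    unfolding I refine.simps path_ok_append path_ok_steps sum_list_steps e
    by (simp add: line_def)
qed simp

text \<open>Closed segments overlap at the grid points, so both one-sided values of the boundary are
  tested there.\<close>

definition below :: "(real \<Rightarrow> real) \<Rightarrow> bool" where
  "below w \<longleftrightarrow> (\<forall>j\<le>m. \<forall>r\<in>{T j..T (Suc j)}. w r \<le> line j r)"

lemma continuous_on_line: "continuous_on S (line j)"
  unfolding line_def[abs_def] by (intro continuous_intros)

lemma below_imp_path_ok:
  assumes "below w"
  shows "path_ok w 0 (refine p (Suc m) 0)"
proof -
  have w: "w r \<le> line j r" if "j \<le> m" "T j \<le> r" "r \<le> T (Suc j)" for j r
    using assms that by (auto simp: below_def)
  have "w (T i + real l * ((T (Suc i) - T i) / real (Suc p))) \<le>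
        line i (T i + real l * ((T (Suc i) - T i) / real (Suc p)))" if "i \<le> m" "l \<le> p" for i l
  proof (rule w[OF \<open>i \<le> m\<close>])
    have d: "0 \<le> T (Suc i) - T i" using T_less[OF \<open>i \<le> m\<close>] by simp
    then show "T i \<le> T i + real l * ((T (Suc i) - T i) / real (Suc p))" by simp
    have "real l / real (Suc p) * (T (Suc i) - T i) \<le> 1 * (T (Suc i) - T i)"
      using d \<open>l \<le> p\<close> by (intro mult_right_mono) auto
    then show "T i + real l * ((T (Suc i) - T i) / real (Suc p)) \<le> T (Suc i)" by simp
  qed
  moreover have "w (T (Suc i)) \<le> gate i" if "i \<le> m" for i
    using w[of i "T (Suc i)"] w[of "Suc i" "T (Suc i)"] T_less[of i] T_less[of "Suc i"] that
    by (auto simp: gate_def line_end)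
  ultimately show ?thesis
    using path_ok_refine[of 0 "Suc m" w p] by (simp add: T0)
qed

text \<open>By continuity a violation persists on a small interval, and every fine enough grid meets
  that interval. Successive refinements are not nested, hence the formulation with
  eventually.\<close>

lemma not_below_imp_not_path_ok:
  assumes w: "continuous_on {0..} w" and w0: "w 0 \<le> A 0" and nb: "\<not> below w"
  shows "\<forall>\<^sub>F p in sequentially. \<not> path_ok w 0 (refine p (Suc m) 0)"
proof -
  obtain j r where j: "j \<le> m" and r: "T j \<le> r" "r \<le> T (Suc j)" and gt: "line j r < w r"
    using nb by (auto simp: below_def not_le)
  have ok_top: "w (T (Suc i)) \<le> gate i" if "path_ok w 0 (refine p (Suc m) 0)" "i \<le> m" for i p
    using that path_ok_refine[of 0 "Suc m" w p] by (simp add: T0)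
  have ok_line: "w (T i + real l * ((T (Suc i) - T i) / real (Suc p))) \<le>
        line i (T i + real l * ((T (Suc i) - T i) / real (Suc p)))"
    if "path_ok w 0 (refine p (Suc m) 0)" "i \<le> m" "l \<in> {1..p}" for i l p
    using that path_ok_refine[of 0 "Suc m" w p] by (simp add: T0)
  \<comment> \<open>A violation at a grid point is seen by the \<open>gate\<close> belonging to that
    point. The point \<open>T 0\<close> has no gate, and \<open>w0\<close> excludes a violation
    there.\<close>
  consider "r = T j" | "r = T (Suc j)" | "T j < r" "r < T (Suc j)" using r by linarith
  then show ?thesis
  proof cases
    case 1
    then have "A j < w (T j)" using gt by simp
    then obtain i where i: "j = Suc i" using w0 T0 by (cases j) auto
    then have "gate i < w (T (Suc i))" using gate_le(2)[of i] \<open>A j < w (T j)\<close> j by simp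
    then show ?thesis using ok_top[of _ i] i j by (intro always_eventually) (auto simp: not_le[symmetric])
  next
    case 2
    then have "gate j < w (T (Suc j))" using gt line_end[OF j] gate_le(1)[of j] by simp
    then show ?thesis using ok_top[of _ j] j by (intro always_eventually) (auto simp: not_le[symmetric])
  next
    case 3
    let ?v = "T (Suc j) - T j"
    have v: "0 < ?v" using T_less[OF j] by simp
    \<comment> \<open>Index of the first refinement point not before r; these points tend to r from
      the right.\<close>
    define l where "l p = nat \<lceil>real (Suc p) * ((r - T j) / ?v)\<rceil>" for p
    define q where "q p = T j + real (l p) * (?v / real (Suc p))" for p
    have lb: "real (Suc p) * ((r - T j) / ?v) \<le> real (l p)" "real (l p) < real (Suc p) * ((r - T j) / ?v) + 1" for p
    proof -
      have "0 \<le> real (Suc p) * ((r - T j) / ?v)" using v 3 by simp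
      then show "real (Suc p) * ((r - T j) / ?v) \<le> real (l p)" "real (l p) < real (Suc p) * ((r - T j) / ?v) + 1"
        unfolding l_def by linarith+
    qed
    have q_ge: "r \<le> q p" for p
    proof -
      have "r - T j = real (Suc p) * ((r - T j) / ?v) * (?v / real (Suc p))"
        using v by (simp del: of_nat_Suc)
      also have "\<dots> \<le> real (l p) * (?v / real (Suc p))"
        using v by (intro mult_right_mono lb) auto
      finally show ?thesis by (simp add: q_def)
    qed
    have q_le: "q p \<le> r + ?v / real (Suc p)" for p
    proof -
      have "real (l p) * (?v / real (Suc p)) \<le> (real (Suc p) * ((r - T j) / ?v) + 1) * (?v / real (Suc p))"
        using v by (intro mult_right_mono less_imp_le[OF lb(2)]) auto
      also have "\<dots> = (r - T j) + ?v / real (Suc p)"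
        using v by (simp add: distrib_right add_divide_distrib del: of_nat_Suc)
      finally show ?thesis by (simp add: q_def)
    qed
    have q: "q \<longlonglongrightarrow> r"
    proof (rule tendsto_sandwich[OF _ _ tendsto_const])
      show "\<forall>\<^sub>F p in sequentially. r \<le> q p" "\<forall>\<^sub>F p in sequentially. q p \<le> r + ?v / real (Suc p)"
        using q_ge q_le by (auto intro: always_eventually)
      show "(\<lambda>p. r + ?v / real (Suc p)) \<longlonglongrightarrow> r"
        using tendsto_add[OF tendsto_const LIMSEQ_div_Suc[of ?v], of r] by simp
    qed
    have q0: "0 \<le> q p" for p using q_ge[of p] r T_nonneg[of j] j by simp
    have "(\<lambda>p. w (q p) - line j (q p)) \<longlonglongrightarrow> w r - line j r"
    proof (rule continuous_on_tendsto_compose[OF _ q])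
      show "continuous_on {0..} (\<lambda>x. w x - line j x)"
        by (intro continuous_intros w continuous_on_line)
    qed (use r T_nonneg[of j] j q0 in auto)
    then have "\<forall>\<^sub>F p in sequentially. 0 < w (q p) - line j (q p)"
      using gt by (intro order_tendstoD) auto
    moreover have "\<forall>\<^sub>F p in sequentially. q p < T (Suc j)"
      using q 3 by (intro order_tendstoD)
    ultimately show ?thesis
    proof eventually_elim
      case (elim p)
      have "0 < real (Suc p) * ((r - T j) / ?v)" using v 3 by simp
      then have "1 \<le> l p" using lb(1)[of p] by linarith
      moreover have "l p \<le> p"
      proof (rule ccontr)
        assume "\<not> l p \<le> p"
        then have "real (Suc p) * (?v / real (Suc p)) \<le> real (l p) * (?v / real (Suc p))"
          using v by (intro mult_right_mono) auto
        then have "T (Suc j) \<le> q p" by (simp add: q_def del: of_nat_Suc)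
        then show False using elim by simp
      qed
      ultimately have "l p \<in> {1..p}" by simp
      then show ?case
        using ok_line[of p j "l p"] elim(1) j unfolding q_def by linarith
    qed
  qed
qed

lemma brownian_below:
  assumes M: "prob_space M" and BM: "standard_brownian_motion M B" and x: "x \<le> A 0"
  shows "{\<omega> \<in> space M. below (\<lambda>r. x + B r \<omega>)} \<in> sets M"
    and "emeasure M {\<omega> \<in> space M. below (\<lambda>r. x + B r \<omega>)} = surv (Suc m) 0 x"
proof -
  interpret prob_space M by fact
  let ?E = "{\<omega> \<in> space M. below (\<lambda>r. x + B r \<omega>)}"
  let ?P = "\<lambda>p. {\<omega> \<in> space M. path_ok (\<lambda>r. x + B r \<omega>) 0 (refine p (Suc m) 0)}"
  have pos: "\<And>q. q \<in> set (refine p (Suc m) 0) \<Longrightarrow> 0 < fst q" for p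
    using refine_pos[of 0 "Suc m" _ p] by simp
  have P: "?P p \<in> sets M" "emeasure M (?P p) = walk_int (refine p (Suc m) 0) (\<lambda>_. 1) x" for p
    by (rule brownian_walk[OF M BM pos], assumption)+
  have ev: "\<forall>\<^sub>F p in sequentially. \<omega> \<in> ?P p \<longleftrightarrow> \<omega> \<in> ?E" if "\<omega> \<in> space M" for \<omega>
  proof (cases "below (\<lambda>r. x + B r \<omega>)")
    case True
    then show ?thesis using below_imp_path_ok[OF True] that by simp
  next
    case False
    have "continuous_on {0..} (\<lambda>r. x + B r \<omega>)" "x + B 0 \<omega> \<le> A 0"
      using BM that x by (auto simp: standard_brownian_motion_def intro!: continuous_on_add)
    from not_below_imp_not_path_ok[OF this False] show ?thesis
      using False by (auto elim: eventually_mono)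
  qed
  \<comment> \<open>The event involves uncountably many times. Since the refined events agree with
    it eventually at every \<omega>, it is their limit inferior and therefore measurable.\<close>
  have "?E = (\<Union>P. \<Inter>p\<in>{P..}. ?P p)"
  proof (intro set_eqI iffI)
    fix \<omega> assume "\<omega> \<in> ?E"
    then show "\<omega> \<in> (\<Union>P. \<Inter>p\<in>{P..}. ?P p)"
      using ev[of \<omega>] by (auto simp: eventually_sequentially)
  next
    fix \<omega> assume "\<omega> \<in> (\<Union>P. \<Inter>p\<in>{P..}. ?P p)"
    then obtain P where P: "\<And>p. P \<le> p \<Longrightarrow> \<omega> \<in> ?P p" by auto
    then have "\<omega> \<in> space M" by auto
    from ev[OF this] obtain P' where P': "\<And>p. P' \<le> p \<Longrightarrow> \<omega> \<in> ?P p \<longleftrightarrow> \<omega> \<in> ?E"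
      by (auto simp: eventually_sequentially)
    then show "\<omega> \<in> ?E" using P[OF max.cobounded1, of P'] P'[OF max.cobounded2, of P] by iprover
  qed
  also have "\<dots> \<in> sets M"
  proof -
    have "(\<Inter>p\<in>{P..}. ?P p) \<in> sets M" for P
      by (rule sets.countable_INT') (use P(1) in auto)
    then show ?thesis by blast
  qed
  finally show E: "?E \<in> sets M" .
  have "(\<lambda>p. \<integral>\<^sup>+\<omega>. indicator (?P p) \<omega> \<partial>M) \<longlonglongrightarrow> (\<integral>\<^sup>+\<omega>. indicator ?E \<omega> \<partial>M)"
  proof (rule nn_integral_dominated_convergence[where w = "\<lambda>_. 1"])
    show "AE \<omega> in M. (\<lambda>p. indicator (?P p) \<omega> :: ennreal) \<longlonglongrightarrow> indicator ?E \<omega>"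
    proof (intro AE_I2 tendsto_eventually)
      fix \<omega> assume "\<omega> \<in> space M"
      from ev[OF this] show "\<forall>\<^sub>F p in sequentially. indicator (?P p) \<omega> = (indicator ?E \<omega> :: ennreal)"
        by eventually_elim (simp add: indicator_def)
    qed
  qed (use P(1) E in \<open>auto simp: emeasure_space_1 indicator_def intro!: borel_measurable_indicator\<close>)
  then have "(\<lambda>p. walk_int (refine p (Suc m) 0) (\<lambda>_. 1) x) \<longlonglongrightarrow> emeasure M ?E"
    using E by (simp only: nn_integral_indicator P)
  moreover have "(\<lambda>p. walk_int (refine p (Suc m) 0) (\<lambda>_. 1) x) \<longlonglongrightarrow> surv (Suc m) 0 x"
    by (rule walk_int_tendsto) (use x in auto)
  ultimately show "emeasure M ?E = surv (Suc m) 0 x"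
    by (rule LIMSEQ_unique)
qed

text \<open>Only the first kernel depends on the starting point, and \<open>gauss_shift_le\<close>
  dominates it uniformly in the lifts, which are all at most 1.\<close>

lemma surv_right_continuous:
  assumes A: "0 < A 0"
  shows "(\<lambda>q. surv (Suc m) 0 (inverse (real (Suc q)))) \<longlonglongrightarrow> surv (Suc m) 0 0"
  unfolding surv.simps
proof (rule nn_integral_dominated_convergence[where w = "\<lambda>y. ennreal (sqrt 2 * exp (1 / (2 * (T (Suc 0) - T 0))) * gauss (2 * (T (Suc 0) - T 0)) y)"])
  let ?v = "T (Suc 0) - T 0"
  have v: "0 < ?v" using T_less[of 0] by simp
  let ?x = "\<lambda>q. inverse (real (Suc q))"
  show "AE y in lborel. ennreal (bridge ?v (A 0) (C 0) (?x q) y) * (indicator {..gate 0} y * surv m (Suc 0) y) \<le>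
      ennreal (sqrt 2 * exp (1 / (2 * ?v)) * gauss (2 * ?v) y)" for q
  proof (intro AE_I2)
    fix y
    have "ennreal (gauss ?v (y - ?x q)) \<le> ennreal (sqrt 2 * exp (1 / (2 * ?v)) * gauss (2 * ?v) y)"
      by (intro ennreal_leI gauss_shift_le v) (simp add: inverse_le_1_iff)
    moreover have "ennreal (bridge ?v (A 0) (C 0) (?x q) y) \<le> ennreal (gauss ?v (y - ?x q))" if "y \<le> gate 0"
      using that gate_le(1)[of 0] by (intro bridge_le_gauss v) simp
    ultimately have *: "ennreal (bridge ?v (A 0) (C 0) (?x q) y) \<le> ennreal (sqrt 2 * exp (1 / (2 * ?v)) * gauss (2 * ?v) y)" if "y \<le> gate 0"
      using that by (blast intro: order_trans)
    show "ennreal (bridge ?v (A 0) (C 0) (?x q) y) * (indicator {..gate 0} y * surv m (Suc 0) y) \<le>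
      ennreal (sqrt 2 * exp (1 / (2 * ?v)) * gauss (2 * ?v) y)"
      using mult_mono[OF *  surv_le_1[of "Suc 0" m y]] by (auto simp: indicator_def)
  qed
  show "(\<integral>\<^sup>+y. ennreal (sqrt 2 * exp (1 / (2 * ?v)) * gauss (2 * ?v) y) \<partial>lborel) < \<infinity>"
    using nn_integral_gauss[of "2 * ?v" 0] v by (simp add: ennreal_mult' nn_integral_cmult ennreal_mult_less_top)
  show "AE y in lborel. (\<lambda>q. ennreal (bridge ?v (A 0) (C 0) (?x q) y) * (indicator {..gate 0} y * surv m (Suc 0) y)) \<longlonglongrightarrow>
      ennreal (bridge ?v (A 0) (C 0) 0 y) * (indicator {..gate 0} y * surv m (Suc 0) y)"
  proof (intro AE_I2)
    fix y
    have "(\<lambda>q. ennreal (bridge ?v (A 0) (C 0) (?x q) y)) \<longlonglongrightarrow> ennreal (bridge ?v (A 0) (C 0) 0 y)"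
      unfolding bridge_def gauss_eq[OF less_imp_le[OF v]]
      using v by (intro tendsto_intros tendsto_ennrealI LIMSEQ_inverse_real_of_nat) auto
    moreover have "(indicator {..gate 0} y * surv m (Suc 0) y :: ennreal) \<noteq> top"
      using surv_le_1[of "Suc 0" m y] by (auto simp: indicator_def top_unique)
    ultimately show "(\<lambda>q. ennreal (bridge ?v (A 0) (C 0) (?x q) y) * (indicator {..gate 0} y * surv m (Suc 0) y)) \<longlonglongrightarrow>
      ennreal (bridge ?v (A 0) (C 0) 0 y) * (indicator {..gate 0} y * surv m (Suc 0) y)"
      by (intro tendsto_mult_ennreal tendsto_const) auto
  qed
qed measurable

text \<open>The lift decreases with q, so the events increase and continuity from below applies.
  Lifts above \<open>A 0\<close> give the empty event, because the path starts at 0.\<close>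

lemma brownian_strictly_below:
  assumes M: "prob_space M" and BM: "standard_brownian_motion M B" and A: "0 \<le> A 0"
  shows "{\<omega> \<in> space M. \<exists>q. below (\<lambda>r. inverse (real (Suc q)) + B r \<omega>)} \<in> sets M"
    and "emeasure M {\<omega> \<in> space M. \<exists>q. below (\<lambda>r. inverse (real (Suc q)) + B r \<omega>)} = surv (Suc m) 0 0"
proof -
  let ?x = "\<lambda>q. inverse (real (Suc q))"
  let ?E = "\<lambda>q. {\<omega> \<in> space M. below (\<lambda>r. ?x q + B r \<omega>)}"
  have U: "{\<omega> \<in> space M. \<exists>q. below (\<lambda>r. ?x q + B r \<omega>)} = (\<Union>q. ?E q)" by auto
  have B0: "B 0 \<omega> = 0" if "\<omega> \<in> space M" for \<omega>
    using BM that by (simp add: standard_brownian_motion_def)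
  have empty: "?E q = {}" if "A 0 < ?x q" for q
  proof -
    have "\<not> below (\<lambda>r. ?x q + B r \<omega>)" if "\<omega> \<in> space M" for \<omega>
      using \<open>A 0 < ?x q\<close> B0[OF that] T_less[of 0] line_start[of 0]
      unfolding below_def T0 by (auto intro!: exI[of _ 0] bexI[of _ 0] simp: T0 not_le)
    then show ?thesis by auto
  qed
  have E: "?E q \<in> sets M" for q
  proof (cases "A 0 < ?x q")
    case True
    show ?thesis unfolding empty[OF True] by (rule sets.empty_sets)
  next
    case False
    then show ?thesis using brownian_below(1)[OF M BM, of "?x q"] by simp
  qed
  then show "{\<omega> \<in> space M. \<exists>q. below (\<lambda>r. ?x q + B r \<omega>)} \<in> sets M"
    unfolding U by blast
  show "emeasure M {\<omega> \<in> space M. \<exists>q. below (\<lambda>r. ?x q + B r \<omega>)} = surv (Suc m) 0 0"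
  \<comment> \<open>A path that starts on the boundary never has positive room, and the factor in
    \<open>bridge\<close> vanishes at x = a, so both sides are 0.\<close>
  proof (cases "A 0 = 0")
    case True
    have "?E q = {}" for q by (rule empty) (simp add: True)
    then have "(\<Union>q. ?E q) = {}" by blast
    moreover have "surv (Suc m) 0 0 = 0" by (simp add: bridge_def True)
    ultimately show ?thesis unfolding U by (simp only: emeasure_empty)
  next
    case False
    then have pos: "0 < A 0" using A by simp
    have "incseq ?E"
    proof (rule incseq_SucI)
      fix q
      have "?x (Suc q) \<le> ?x q" by (intro le_imp_inverse_le) auto
      then have "below (\<lambda>r. ?x (Suc q) + w r)" if "below (\<lambda>r. ?x q + w r)" for w
        using that unfolding below_def by (meson add_right_mono order_trans)
      from this[of "\<lambda>r. B r _"] show "?E q \<subseteq> ?E (Suc q)"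
        by (intro Collect_mono) blast
    qed
    then have "(\<lambda>q. emeasure M (?E q)) \<longlonglongrightarrow> emeasure M (\<Union>q. ?E q)"
      using E by (intro Lim_emeasure_incseq) auto
    moreover have "\<forall>\<^sub>F q in sequentially. emeasure M (?E q) = surv (Suc m) 0 (?x q)"
    proof -
      have "\<forall>\<^sub>F q in sequentially. ?x q < A 0"
        using LIMSEQ_inverse_real_of_nat pos by (rule order_tendstoD)
      then show ?thesis
        by eventually_elim (rule brownian_below(2)[OF M BM less_imp_le])
    qed
    ultimately have "(\<lambda>q. surv (Suc m) 0 (?x q)) \<longlonglongrightarrow> emeasure M (\<Union>q. ?E q)"
      by (rule Lim_transform_eventually)
    then show ?thesis
      unfolding U using surv_right_continuous[OF pos] by (rule LIMSEQ_unique)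
  qed
qed

end

section \<open>Paths of the counting process\<close>

locale counting_path =
  fixes N :: "real \<Rightarrow> 'a \<Rightarrow> int" and \<omega> :: 'a
  assumes start: "N 0 \<omega> = 0"
    and right_cont: "0 \<le> r \<Longrightarrow> ((\<lambda>r. N r \<omega>) \<longlongrightarrow> N r \<omega>) (at_right r)"
    and left_lim: "0 < r \<Longrightarrow> \<exists>l. ((\<lambda>r. N r \<omega>) \<longlongrightarrow> l) (at_left r)"
    and unit_jump: "0 < r \<Longrightarrow> N r \<omega> \<noteq> left_limit N r \<omega> \<Longrightarrow> N r \<omega> = left_limit N r \<omega> + 1"
begin

text \<open>For integer values the topology is discrete, so one-sided limits mean that the path is
  constant on a one-sided neighbourhood; the same argument gives \<open>left_const\<close>.\<close>

lemma right_const: "0 \<le> r \<Longrightarrow> \<exists>d>0. \<forall>x. r \<le> x \<and> x < r + d \<longrightarrow> N x \<omega> = N r \<omega>"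
proof -
  assume "0 \<le> r"
  from right_cont[OF this] have "\<forall>\<^sub>F x in at_right r. N x \<omega> = N r \<omega>"
    by (simp add: tendsto_discrete)
  then obtain b where "r < b" "\<And>x. r < x \<Longrightarrow> x < b \<Longrightarrow> N x \<omega> = N r \<omega>"
    unfolding eventually_at_right_field by blast
  then show ?thesis by (intro exI[of _ "b - r"]) (auto simp: le_less)
qed

lemma left_const: "0 < r \<Longrightarrow> \<exists>d>0. \<forall>x. r - d < x \<and> x < r \<longrightarrow> N x \<omega> = left_limit N r \<omega>"
proof -
  assume "0 < r"
  from left_lim[OF this] obtain l where l: "((\<lambda>r. N r \<omega>) \<longlongrightarrow> l) (at_left r)" by blast
  then have "left_limit N r \<omega> = l"
    unfolding left_limit_def by (intro tendsto_Lim) simp_all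
  moreover from l have "\<forall>\<^sub>F x in at_left r. N x \<omega> = l"
    by (simp add: tendsto_discrete)
  then obtain b where "b < r" "\<And>x. b < x \<Longrightarrow> x < r \<Longrightarrow> N x \<omega> = l"
    unfolding eventually_at_left_field by blast
  ultimately show ?thesis by (intro exI[of _ "r - b"]) auto
qed

text \<open>Compactness of \<open>[a, b]\<close>: whatever holds across every single jump holds across \<open>[a, b]\<close>.\<close>

lemma chain:
  assumes "0 \<le> a" "a \<le> b"
    and trans: "\<And>x y z. R x y \<Longrightarrow> R y z \<Longrightarrow> R x z" and refl: "\<And>x. R x x"
    and jump: "\<And>r. a < r \<Longrightarrow> r \<le> b \<Longrightarrow> R (left_limit N r \<omega>) (N r \<omega>)"
  shows "R (N a \<omega>) (N b \<omega>)"
proof -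
  have "a \<le> a \<and> b \<le> b \<longrightarrow> R (N a \<omega>) (N b \<omega>)"
  \<comment> \<open>Bisection principle for interval properties that hold locally and pass to unions
    of adjacent intervals. The containment in [a, b] is part of the property because the small
    intervals around a point may stick out.\<close>
  proof (rule Bolzano[OF \<open>a \<le> b\<close>, where P = "\<lambda>y z. a \<le> y \<and> z \<le> b \<longrightarrow> R (N y \<omega>) (N z \<omega>)"])
    fix x assume x: "a \<le> x" "x \<le> b"
    obtain d1 where d1: "0 < d1" "\<And>y. x \<le> y \<Longrightarrow> y < x + d1 \<Longrightarrow> N y \<omega> = N x \<omega>"
      using right_const[of x] x \<open>0 \<le> a\<close> by auto
    obtain d2 where d2: "0 < d2" "\<And>y. 0 < x \<Longrightarrow> x - d2 < y \<Longrightarrow> y < x \<Longrightarrow> N y \<omega> = left_limit N x \<omega>"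
      using left_const[of x] zero_less_one by blast
    show "\<exists>d>0. \<forall>y z. y \<le> x \<and> x \<le> z \<and> z - y < d \<longrightarrow> a \<le> y \<and> z \<le> b \<longrightarrow> R (N y \<omega>) (N z \<omega>)"
    proof (intro exI[of _ "min d1 d2"] conjI allI impI; (elim conjE)?)
      fix y z assume yz: "y \<le> x" "x \<le> z" "z - y < min d1 d2" "a \<le> y" "z \<le> b"
      have z: "N z \<omega> = N x \<omega>" using yz by (intro d1) auto
      show "R (N y \<omega>) (N z \<omega>)"
      proof (cases "y = x")
        case True
        then show ?thesis using z refl by simp
      next
        case False
        then have "N y \<omega> = left_limit N x \<omega>" using yz \<open>0 \<le> a\<close> by (intro d2) auto
        then show ?thesis using jump[of x] False yz z by simp
      qed
    qed (use d1 d2 in simp)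
  next
    fix x y z assume "a \<le> x \<and> y \<le> b \<longrightarrow> R (N x \<omega>) (N y \<omega>)" "a \<le> y \<and> z \<le> b \<longrightarrow> R (N y \<omega>) (N z \<omega>)" "x \<le> y" "y \<le> z"
    then show "a \<le> x \<and> z \<le> b \<longrightarrow> R (N x \<omega>) (N z \<omega>)" using trans by fastforce
  qed
  then show ?thesis by simp
qed

lemma mono: "0 \<le> a \<Longrightarrow> a \<le> b \<Longrightarrow> N a \<omega> \<le> N b \<omega>"
proof (rule chain[where R = "(\<le>)"])
  fix r assume "0 \<le> a" "a < r"
  then show "left_limit N r \<omega> \<le> N r \<omega>" using unit_jump[of r] by (cases "N r \<omega> = left_limit N r \<omega>") auto
qed auto

lemma nonneg: "0 \<le> r \<Longrightarrow> 0 \<le> N r \<omega>"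
  using mono[of 0 r] start by simp

lemma left_limit_attained: "0 < r \<Longrightarrow> c < r \<Longrightarrow> \<exists>x. max 0 c < x \<and> x < r \<and> N x \<omega> = left_limit N r \<omega>"
proof -
  assume "0 < r" "c < r"
  obtain d where d: "0 < d" "\<And>x. r - d < x \<Longrightarrow> x < r \<Longrightarrow> N x \<omega> = left_limit N r \<omega>"
    using left_const[OF \<open>0 < r\<close>] by auto
  obtain x where "max (max 0 c) (r - d) < x" "x < r"
    using dense[of "max (max 0 c) (r - d)" r] \<open>0 < r\<close> \<open>c < r\<close> d(1) by auto
  then show ?thesis using d(2) by (intro exI[of _ x]) auto
qed

lemma jump_time_nonneg: "0 \<le> jump_time N k \<omega>"
proof (induction k)
  case (Suc k)
  show ?case
    unfolding jump_time.simps
  proof (intro Inf_greatest, clarify)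
    fix s assume "jump_time N k \<omega> < ereal s"
    with Suc show "0 \<le> ereal s" by (meson less_imp_le order_trans)
  qed
qed simp

text \<open>Rests on jumps of size 1 and on local constancy from the right, which prevents jump
  times from accumulating at a point from the right. It reduces every later question about jump
  times to the values of N.\<close>

lemma jump_time_le_iff: "0 \<le> r \<Longrightarrow> jump_time N k \<omega> \<le> ereal r \<longleftrightarrow> int k \<le> N r \<omega>"
proof (induction k arbitrary: r)
  case 0
  then show ?case using nonneg by (simp add: zero_ereal_def)
next
  case (Suc k)
  let ?J = "{ereal x | x. ereal x > jump_time N k \<omega> \<and> N x \<omega> \<noteq> left_limit N x \<omega>}"
  show ?case
  proof
    assume "jump_time N (Suc k) \<omega> \<le> ereal r"
    then have J: "Inf ?J \<le> ereal r" by simp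
    \<comment> \<open>The infimum might be approached by jump times after r; constancy on [r, r + d)
      rules this out and produces an actual jump at or before r.\<close>
    obtain d where d: "0 < d" "\<And>x. r \<le> x \<Longrightarrow> x < r + d \<Longrightarrow> N x \<omega> = N r \<omega>"
      using right_const[OF Suc.prems] by auto
    have "Inf ?J < ereal (r + d)" using J d(1) by (auto intro: le_less_trans)
    then obtain x where x: "x < r + d" "jump_time N k \<omega> < ereal x" "N x \<omega> \<noteq> left_limit N x \<omega>"
      unfolding Inf_less_iff by auto
    have "0 < ereal x" using x(2) jump_time_nonneg[of k] by (rule order_le_less_trans[rotated])
    then have x0: "0 < x" by simp
    have "x \<le> r"
    proof (rule ccontr)
      assume "\<not> x \<le> r"
      then obtain y where "max 0 r < y" "y < x" "N y \<omega> = left_limit N x \<omega>"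
        using left_limit_attained[OF x0, of r] by auto
      then show False using d(2)[of y] d(2)[of x] x by simp
    qed
    obtain c where c: "jump_time N k \<omega> = ereal c" "0 \<le> c" "c < x"
      using x(2) jump_time_nonneg[of k] by (cases "jump_time N k \<omega>") auto
    obtain y where y: "max 0 c < y" "y < x" "N y \<omega> = left_limit N x \<omega>"
      using left_limit_attained[OF x0 c(3)] by auto
    have "int k \<le> N y \<omega>" using Suc.IH[of y] y c by simp
    moreover have "N x \<omega> = N y \<omega> + 1" using unit_jump[OF x0 x(3)] y by simp
    moreover have "N x \<omega> \<le> N r \<omega>" using mono x0 \<open>x \<le> r\<close> by simp
    ultimately show "int (Suc k) \<le> N r \<omega>" by simp
  next
    assume N: "int (Suc k) \<le> N r \<omega>"
    then have "jump_time N k \<omega> \<le> ereal r" using Suc by simp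
    then obtain c where c: "jump_time N k \<omega> = ereal c" "0 \<le> c" "c \<le> r"
      using jump_time_nonneg[of k] by (cases "jump_time N k \<omega>") auto
    \<comment> \<open>At the k-th jump time c the value cannot exceed k: with a unit jump it would
      be at least k shortly before c, and the k-th jump would have come earlier. So a further jump
      lies in (c, r].\<close>
    have "N c \<omega> \<le> int k"
    proof (rule ccontr)
      assume *: "\<not> N c \<omega> \<le> int k"
      then have "0 < c" using start c(2) by (cases "c = 0") auto
      then obtain y where y: "0 < y" "y < c" "N y \<omega> = left_limit N c \<omega>"
        using left_limit_attained[of c 0] by auto
      have "N c \<omega> \<le> N y \<omega> + 1" using unit_jump[OF \<open>0 < c\<close>] y by force
      then have "int k \<le> N y \<omega>" using * by simp
      then have "jump_time N k \<omega> \<le> ereal y" using Suc.IH[of y] y by simp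
      then show False using c y by simp
    qed
    then have "N c \<omega> \<noteq> N r \<omega>" using N by simp
    then obtain x where x: "c < x" "x \<le> r" "left_limit N x \<omega> \<noteq> N x \<omega>"
      using chain[of c r "(=)"] c by auto
    then have "ereal x \<in> ?J" using c by auto
    then have "Inf ?J \<le> ereal x" by (rule Inf_lower)
    then show "jump_time N (Suc k) \<omega> \<le> ereal r" using x(2) by (auto intro: order_trans)
  qed
qed

text \<open>\<open>real_of_ereal\<close> sends an infinite time to 0; for j at most k on the event N
  t = k the jump time is finite, so nothing is lost.\<close>

lemma real_jump_time_le_iff:
  assumes "N t \<omega> = int k" "0 \<le> t" "j \<le> k" "0 \<le> r" "r \<le> t"
  shows "real_of_ereal (jump_time N j \<omega>) \<le> r \<longleftrightarrow> int j \<le> N r \<omega>"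
proof -
  have "jump_time N j \<omega> \<le> ereal t" using jump_time_le_iff[of t j] assms by simp
  then obtain c where "jump_time N j \<omega> = ereal c"
    using jump_time_nonneg[of j] by (cases "jump_time N j \<omega>") auto
  then show ?thesis using jump_time_le_iff[of r j] assms by simp
qed

text \<open>On N t = k this makes the jump part of X a function of jump times and heights, the form
  needed for conditioning.\<close>

lemma sum_jumps:
  fixes h :: "nat \<Rightarrow> real"
  assumes "N t \<omega> = int k" "0 \<le> t" "0 \<le> r" "r \<le> t"
  shows "(\<Sum>j = 1..nat (N r \<omega>). h j) = (\<Sum>j = 1..k. if real_of_ereal (jump_time N j \<omega>) \<le> r then h j else 0)"
proof -
  have "N r \<omega> \<le> int k" using mono[of r t] assms by simp
  then have "{1..nat (N r \<omega>)} = {j \<in> {1..k}. real_of_ereal (jump_time N j \<omega>) \<le> r}"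
    using real_jump_time_le_iff[OF assms(1,2) _ assms(3,4)] nonneg[OF assms(3)] by auto
  then show ?thesis by (simp only: sum.inter_filter finite_atLeastAtMost)
qed

end

lemma counting_path:
  "jump_counting_process M N \<Longrightarrow> \<omega> \<in> space M \<Longrightarrow> counting_path N \<omega>"
  by (auto simp: jump_counting_process_def counting_path_def)

section \<open>Conditioning on jump times and heights\<close>

lemma ennreal_mult_divide_cancel: "a \<noteq> 0 \<Longrightarrow> a \<noteq> top \<Longrightarrow> a * (b / a) = (b :: ennreal)"
  by (simp add: ennreal_times_divide mult.commute[of a] ennreal_mult_divide_eq)

text \<open>Given A, the triple (X, Y, Z) has a product law. A is paired with X because in the
  application both are determined by N, while heights and Brownian path are independent of that
  pair.\<close>

lemma (in prob_space) emeasure_conditional_product: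
  assumes X[measurable]: "X \<in> measurable M P" and Y[measurable]: "Y \<in> measurable M Q" and Z[measurable]: "Z \<in> measurable M R"
    and A[measurable]: "A \<in> events"
    and indep: "\<And>C D E. C \<in> sets P \<Longrightarrow> D \<in> sets Q \<Longrightarrow> E \<in> sets R \<Longrightarrow>
      prob ((A \<inter> X -` C) \<inter> (Y -` D \<inter> space M) \<inter> (Z -` E \<inter> space M)) =
      prob (A \<inter> X -` C) * prob (Y -` D \<inter> space M) * prob (Z -` E \<inter> space M)"
    and F[measurable]: "F \<in> sets (P \<Otimes>\<^sub>M (Q \<Otimes>\<^sub>M R))"
  shows "emeasure M {\<omega> \<in> A. (X \<omega>, Y \<omega>, Z \<omega>) \<in> F} =
    emeasure M A * (\<integral>\<^sup>+x. \<integral>\<^sup>+y. emeasure M {\<omega> \<in> space M. (x, y, Z \<omega>) \<in> F} \<partial>distr M Q Y \<partial>distr (uniform_measure M A) P X)"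
\<comment> \<open>Conditioning on a null event gives no probability measure; here both sides are
  0.\<close>
proof (cases "emeasure M A = 0")
  case True
  have "emeasure M {\<omega> \<in> A. (X \<omega>, Y \<omega>, Z \<omega>) \<in> F} \<le> emeasure M A"
    by (intro emeasure_mono) auto
  then show ?thesis using True by simp
next
  case False
  have AS: "A \<subseteq> space M" using sets.sets_into_space[OF A] .
  have XC: "A \<inter> X -` C \<in> events" if "C \<in> sets P" for C
  proof -
    have "A \<inter> X -` C = A \<inter> (X -` C \<inter> space M)" using AS by auto
    then show ?thesis using measurable_sets[OF X that] by auto
  qed
  interpret Y: prob_space "distr M Q Y" by (rule prob_space_distr) measurable
  interpret Z: prob_space "distr M R Z" by (rule prob_space_distr) measurable
  interpret YZ: pair_prob_space "distr M Q Y" "distr M R Z" ..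
  have U: "prob_space (uniform_measure M A)"
    using False by (intro prob_space_uniform_measure) (auto simp: emeasure_eq_measure)
  interpret X: prob_space "distr (uniform_measure M A) P X"
    by (rule prob_space.prob_space_distr[OF U]) simp
  \<comment> \<open>The product identity is extended from rectangles in two rounds: first in (D, E)
    for fixed C, where conditioning on G again requires positive mass, and afterwards in C.\<close>
  have YZ: "emeasure M (G \<inter> {\<omega> \<in> space M. (Y \<omega>, Z \<omega>) \<in> B}) = emeasure M G * emeasure (distr M Q Y \<Otimes>\<^sub>M distr M R Z) B"
    if C: "C \<in> sets P" and G: "G = A \<inter> X -` C" and B: "B \<in> sets (Q \<Otimes>\<^sub>M R)" for C G B
  proof (cases "emeasure M G = 0")
    case True
    have "emeasure M (G \<inter> {\<omega> \<in> space M. (Y \<omega>, Z \<omega>) \<in> B}) \<le> emeasure M G"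
      using XC[OF C] by (intro emeasure_mono) (auto simp: G)
    then show ?thesis using True by simp
  next
    case False
    have GM[measurable]: "G \<in> events" using XC[OF C] by (simp add: G)
    have "distr M Q Y \<Otimes>\<^sub>M distr M R Z = distr (uniform_measure M G) (Q \<Otimes>\<^sub>M R) (\<lambda>\<omega>. (Y \<omega>, Z \<omega>))"
    proof (rule pair_measure_eqI)
      show "sets (distr M Q Y \<Otimes>\<^sub>M distr M R Z) = sets (distr (uniform_measure M G) (Q \<Otimes>\<^sub>M R) (\<lambda>\<omega>. (Y \<omega>, Z \<omega>)))"
        by (simp cong: sets_pair_measure_cong)
      fix D E assume "D \<in> sets (distr M Q Y)" "E \<in> sets (distr M R Z)"
      then have DE: "D \<in> sets Q" "E \<in> sets R" by auto
      have 1: "(\<lambda>\<omega>. (Y \<omega>, Z \<omega>)) -` (D \<times> E) \<inter> space M = (Y -` D \<inter> space M) \<inter> (Z -` E \<inter> space M)" by auto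
      have DM: "Y -` D \<inter> space M \<in> events" "Z -` E \<inter> space M \<in> events"
        using DE by (auto intro: measurable_sets[OF Y] measurable_sets[OF Z])
      have "emeasure (distr (uniform_measure M G) (Q \<Otimes>\<^sub>M R) (\<lambda>\<omega>. (Y \<omega>, Z \<omega>))) (D \<times> E) =
          emeasure (uniform_measure M G) ((Y -` D \<inter> space M) \<inter> (Z -` E \<inter> space M))"
        using DE by (subst emeasure_distr) (auto simp: 1)
      also have "\<dots> = emeasure M (G \<inter> ((Y -` D \<inter> space M) \<inter> (Z -` E \<inter> space M))) / emeasure M G"
        using DM by (subst emeasure_uniform_measure) auto
      also have "\<dots> = ennreal (prob G * prob (Y -` D \<inter> space M) * prob (Z -` E \<inter> space M)) / ennreal (prob G)"
        using indep[OF C DE] by (simp add: emeasure_eq_measure G Int_assoc)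
      also have "\<dots> = ennreal (prob (Y -` D \<inter> space M) * prob (Z -` E \<inter> space M))"
        using False by (subst divide_ennreal) (auto simp: emeasure_eq_measure zero_less_measure_iff)
      also have "\<dots> = emeasure (distr M Q Y) D * emeasure (distr M R Z) E"
        using DE by (simp add: emeasure_distr emeasure_eq_measure ennreal_mult)
      finally show "emeasure (distr M Q Y) D * emeasure (distr M R Z) E =
          emeasure (distr (uniform_measure M G) (Q \<Otimes>\<^sub>M R) (\<lambda>\<omega>. (Y \<omega>, Z \<omega>))) (D \<times> E)" ..
    qed (unfold_locales)
    then have "emeasure (distr M Q Y \<Otimes>\<^sub>M distr M R Z) B = emeasure (uniform_measure M G) ((\<lambda>\<omega>. (Y \<omega>, Z \<omega>)) -` B \<inter> space M)"
      using B by (simp add: emeasure_distr)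
    also have "(\<lambda>\<omega>. (Y \<omega>, Z \<omega>)) -` B \<inter> space M = {\<omega> \<in> space M. (Y \<omega>, Z \<omega>) \<in> B}" by auto
    also have "emeasure (uniform_measure M G) \<dots> = emeasure M (G \<inter> {\<omega> \<in> space M. (Y \<omega>, Z \<omega>) \<in> B}) / emeasure M G"
      using B by (subst emeasure_uniform_measure) auto
    finally show ?thesis
      using False by (simp add: ennreal_mult_divide_cancel)
  qed
  have "distr (uniform_measure M A) P X \<Otimes>\<^sub>M (distr M Q Y \<Otimes>\<^sub>M distr M R Z) =
        distr (uniform_measure M A) (P \<Otimes>\<^sub>M (Q \<Otimes>\<^sub>M R)) (\<lambda>\<omega>. (X \<omega>, Y \<omega>, Z \<omega>))"
  proof (rule pair_measure_eqI)
    show "sets (distr (uniform_measure M A) P X \<Otimes>\<^sub>M (distr M Q Y \<Otimes>\<^sub>M distr M R Z)) =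
      sets (distr (uniform_measure M A) (P \<Otimes>\<^sub>M (Q \<Otimes>\<^sub>M R)) (\<lambda>\<omega>. (X \<omega>, Y \<omega>, Z \<omega>)))"
      by (simp cong: sets_pair_measure_cong)
    fix C B assume "C \<in> sets (distr (uniform_measure M A) P X)" "B \<in> sets (distr M Q Y \<Otimes>\<^sub>M distr M R Z)"
    then have C: "C \<in> sets P" and B: "B \<in> sets (Q \<Otimes>\<^sub>M R)"
      by (auto cong: sets_pair_measure_cong)
    have "emeasure (distr (uniform_measure M A) (P \<Otimes>\<^sub>M (Q \<Otimes>\<^sub>M R)) (\<lambda>\<omega>. (X \<omega>, Y \<omega>, Z \<omega>))) (C \<times> B) =
        emeasure (uniform_measure M A) ((X -` C \<inter> space M) \<inter> {\<omega> \<in> space M. (Y \<omega>, Z \<omega>) \<in> B})"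
    proof -
      have "(\<lambda>\<omega>. (X \<omega>, Y \<omega>, Z \<omega>)) -` (C \<times> B) \<inter> space M = (X -` C \<inter> space M) \<inter> {\<omega> \<in> space M. (Y \<omega>, Z \<omega>) \<in> B}"
        by auto
      then show ?thesis using C B by (subst emeasure_distr) (auto simp del: emeasure_uniform_measure)
    qed
    also have "\<dots> = emeasure M (A \<inter> ((X -` C \<inter> space M) \<inter> {\<omega> \<in> space M. (Y \<omega>, Z \<omega>) \<in> B})) / emeasure M A"
      using C B by (subst emeasure_uniform_measure) auto
    also have "A \<inter> ((X -` C \<inter> space M) \<inter> {\<omega> \<in> space M. (Y \<omega>, Z \<omega>) \<in> B}) = (A \<inter> X -` C) \<inter> {\<omega> \<in> space M. (Y \<omega>, Z \<omega>) \<in> B}"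
      using AS by auto
    also have "emeasure M \<dots> / emeasure M A = emeasure M (A \<inter> X -` C) / emeasure M A * emeasure (distr M Q Y \<Otimes>\<^sub>M distr M R Z) B"
      unfolding YZ[OF C refl B] by (simp add: divide_ennreal_def mult_ac)
    also have "emeasure M (A \<inter> X -` C) / emeasure M A = emeasure (distr (uniform_measure M A) P X) C"
    proof -
      have "A \<inter> X -` C = A \<inter> (X -` C \<inter> space M)" using AS by auto
      then show ?thesis using C by (simp add: emeasure_distr)
    qed
    finally show "emeasure (distr (uniform_measure M A) P X) C * emeasure (distr M Q Y \<Otimes>\<^sub>M distr M R Z) B =
      emeasure (distr (uniform_measure M A) (P \<Otimes>\<^sub>M (Q \<Otimes>\<^sub>M R)) (\<lambda>\<omega>. (X \<omega>, Y \<omega>, Z \<omega>))) (C \<times> B)" ..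
  qed (unfold_locales)
  note law = this
  have sF: "F \<in> sets (distr (uniform_measure M A) P X \<Otimes>\<^sub>M (distr M Q Y \<Otimes>\<^sub>M distr M R Z))"
    using F by (simp cong: sets_pair_measure_cong)
  have "{\<omega> \<in> A. (X \<omega>, Y \<omega>, Z \<omega>) \<in> F} = A \<inter> ((\<lambda>\<omega>. (X \<omega>, Y \<omega>, Z \<omega>)) -` F \<inter> space M)"
    using AS by auto
  then have "emeasure M {\<omega> \<in> A. (X \<omega>, Y \<omega>, Z \<omega>) \<in> F} = emeasure M A * (emeasure M (A \<inter> ((\<lambda>\<omega>. (X \<omega>, Y \<omega>, Z \<omega>)) -` F \<inter> space M)) / emeasure M A)"
    using False by (simp add: ennreal_mult_divide_cancel)
  also have "emeasure M (A \<inter> ((\<lambda>\<omega>. (X \<omega>, Y \<omega>, Z \<omega>)) -` F \<inter> space M)) / emeasure M A =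
      emeasure (distr (uniform_measure M A) P X \<Otimes>\<^sub>M (distr M Q Y \<Otimes>\<^sub>M distr M R Z)) F"
    unfolding law by (simp add: emeasure_distr)
  also have "\<dots> = (\<integral>\<^sup>+x. emeasure (distr M Q Y \<Otimes>\<^sub>M distr M R Z) (Pair x -` F) \<partial>distr (uniform_measure M A) P X)"
    using sF by (rule YZ.emeasure_pair_measure_alt)
  also have "\<dots> = (\<integral>\<^sup>+x. \<integral>\<^sup>+y. emeasure M {\<omega> \<in> space M. (x, y, Z \<omega>) \<in> F} \<partial>distr M Q Y \<partial>distr (uniform_measure M A) P X)"
  proof (rule nn_integral_cong)
    fix x
    have x: "Pair x -` F \<in> sets (Q \<Otimes>\<^sub>M R)" by measurable
    have "emeasure (distr M Q Y \<Otimes>\<^sub>M distr M R Z) (Pair x -` F) =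
        (\<integral>\<^sup>+y. emeasure (distr M R Z) (Pair y -` (Pair x -` F)) \<partial>distr M Q Y)"
      using x by (intro Z.emeasure_pair_measure_alt) (simp cong: sets_pair_measure_cong)
    also have "\<dots> = (\<integral>\<^sup>+y. emeasure M {\<omega> \<in> space M. (x, y, Z \<omega>) \<in> F} \<partial>distr M Q Y)"
    proof (rule nn_integral_cong)
      fix y
      have "Pair y -` (Pair x -` F) \<in> sets R" using x by measurable
      then show "emeasure (distr M R Z) (Pair y -` (Pair x -` F)) = emeasure M {\<omega> \<in> space M. (x, y, Z \<omega>) \<in> F}"
        by (subst emeasure_distr) (auto intro!: arg_cong2[where f = emeasure])
    qed
    finally show "emeasure (distr M Q Y \<Otimes>\<^sub>M distr M R Z) (Pair x -` F) =
        (\<integral>\<^sup>+y. emeasure M {\<omega> \<in> space M. (x, y, Z \<omega>) \<in> F} \<partial>distr M Q Y)" .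
  qed
  finally show ?thesis .
qed

text \<open>The generated sigma-algebra packaged as a measure, so that measurability with respect to
  a single process can be expressed; only its sets matter.\<close>

definition process_algebra :: "'a measure \<Rightarrow> 'i set \<Rightarrow> ('i \<Rightarrow> 'a \<Rightarrow> 'b::topological_space) \<Rightarrow> 'a measure" where
  "process_algebra M I Z = sigma (space M) {Z i -` A \<inter> space M | i A. i \<in> I \<and> A \<in> sets borel}"

lemma sets_process_algebra: "sets (process_algebra M I Z) = process_sigma M I Z"
  unfolding process_algebra_def process_sigma_def by (rule sets_measure_of) auto

lemma space_process_algebra [simp]: "space (process_algebra M I Z) = space M"
  unfolding process_algebra_def by (rule space_measure_of) auto

lemma measurable_process_algebra: "i \<in> I \<Longrightarrow> Z i \<in> borel_measurable (process_algebra M I Z)"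
  by (rule measurableI) (auto simp: sets_process_algebra process_sigma_def)

text \<open>The jump time is an infimum over uncountably many instants; measurability comes from
  rewriting {jump time at most r} as {N r at least k}. Measurability relative to N alone is what
  independence requires.\<close>

lemma measurable_jump_time:
  assumes N: "jump_counting_process M N"
  shows "(\<lambda>\<omega>. jump_time N k \<omega>) \<in> borel_measurable (process_algebra M {0..} N)"
  unfolding borel_measurable_iff_Iic_ereal
proof
  fix a :: ereal
  let ?S = "(\<lambda>\<omega>. jump_time N k \<omega>) -` {..a} \<inter> space (process_algebra M {0..} N)"
  have nn: "0 \<le> jump_time N k \<omega>" if "\<omega> \<in> space M" for \<omega>
    using counting_path.jump_time_nonneg[OF counting_path[OF N that]] .
  show "?S \<in> sets (process_algebra M {0..} N)"
  proof (cases a)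
    case (real r)
    show ?thesis
    proof (cases "0 \<le> r")
      case True
      have "?S = N r -` {int k..} \<inter> space (process_algebra M {0..} N)"
        using counting_path.jump_time_le_iff[OF counting_path[OF N] True] real by auto
      also have "\<dots> \<in> sets (process_algebra M {0..} N)"
        by (rule measurable_sets[OF measurable_process_algebra]) (use True in auto)
      finally show ?thesis .
    next
      case False
      have "\<omega> \<notin> ?S" for \<omega>
      proof
        assume "\<omega> \<in> ?S"
        then have "0 \<le> jump_time N k \<omega>" "jump_time N k \<omega> \<le> ereal r" using nn[of \<omega>] real by auto
        then have "0 \<le> ereal r" by (rule order_trans)
        then show False using False by simp
      qed
      then have "?S = {}" by blast
      then show ?thesis by simp
    qed
  next
    case PInf
    then have "?S = space (process_algebra M {0..} N)" by auto
    then show ?thesis by (simp only: sets.top)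
  next
    case MInf
    have "\<omega> \<notin> ?S" for \<omega> using nn[of \<omega>] MInf by auto
    then have "?S = {}" by blast
    then show ?thesis by simp
  qed
qed

text \<open>A pointwise negative function can have supremum 0, so strictness has to be expressed by
  a uniform gap.\<close>

lemma SUP_less_zero_iff:
  "(SUP r\<in>S. ereal (g r)) < 0 \<longleftrightarrow> (\<exists>q. \<forall>r\<in>S. g r \<le> - inverse (real (Suc q)))"
proof
  assume "(SUP r\<in>S. ereal (g r)) < 0"
  then obtain x where x: "(SUP r\<in>S. ereal (g r)) < ereal x" "ereal x < 0"
    using ereal_dense2 by blast
  then obtain q where q: "inverse (real (Suc q)) < - x" using reals_Archimedean[of "- x"] by auto
  have "g r \<le> - inverse (real (Suc q))" if "r \<in> S" for r
  proof -
    have "ereal (g r) < ereal x" by (rule le_less_trans[OF SUP_upper[OF that] x(1)])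
    then show ?thesis using q by simp
  qed
  then show "\<exists>q. \<forall>r\<in>S. g r \<le> - inverse (real (Suc q))" by blast
next
  assume "\<exists>q. \<forall>r\<in>S. g r \<le> - inverse (real (Suc q))"
  then obtain q where "\<And>r. r \<in> S \<Longrightarrow> g r \<le> - inverse (real (Suc q))" by blast
  then have "(SUP r\<in>S. ereal (g r)) \<le> ereal (- inverse (real (Suc q)))"
    by (intro SUP_least) auto
  also have "\<dots> < 0" by simp
  finally show "(SUP r\<in>S. ereal (g r)) < 0" .
qed

text \<open>Right continuity suffices to pass from rational times to all times, so the jumps of the
  path do no harm.\<close>

lemma rational_bound:
  fixes g :: "real \<Rightarrow> real"
  assumes right: "\<And>r. 0 \<le> r \<Longrightarrow> r < t \<Longrightarrow> (g \<longlongrightarrow> g r) (at_right r)"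
    and Q: "\<And>r. r \<in> \<rat> \<Longrightarrow> 0 \<le> r \<Longrightarrow> r < t \<Longrightarrow> g r \<le> c"
    and r: "0 \<le> r" "r < t"
  shows "g r \<le> c"
proof (rule ccontr)
  assume "\<not> g r \<le> c"
  then have "\<forall>\<^sub>F x in at_right r. c < g x" using right[OF r] by (intro order_tendstoD) auto
  then obtain b where b: "r < b" "\<And>x. r < x \<Longrightarrow> x < b \<Longrightarrow> c < g x"
    unfolding eventually_at_right_field by blast
  obtain x where x: "x \<in> \<rat>" "r < x" "x < min b t"
    using Rats_dense_in_real[of r "min b t"] b(1) r by auto
  then show False using b(2)[of x] Q[of x] r by simp
qed

text \<open>X - b with the jump configuration frozen and the Brownian path as argument. The weak
  inequality makes it right continuous, whereas \<open>level\<close> uses the strict one and gives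
  left limits.\<close>

definition compensated :: "(real \<Rightarrow> real) \<Rightarrow> nat \<Rightarrow> (nat \<Rightarrow> real) \<Rightarrow> (nat \<Rightarrow> real) \<Rightarrow> (real \<Rightarrow> real) \<Rightarrow> real \<Rightarrow> real" where
  "compensated b k u h w r = w r + (\<Sum>j = 1..k. if u j \<le> r then h j else 0) - b r"

lemma compensated_right_continuous:
  assumes w: "continuous_on {0..} w" and b: "(b \<longlongrightarrow> b r) (at_right r)" and r: "0 \<le> r"
  shows "(compensated b k u h w \<longlongrightarrow> compensated b k u h w r) (at_right r)"
  unfolding compensated_def
proof (intro tendsto_diff tendsto_add tendsto_sum b)
  show "(w \<longlongrightarrow> w r) (at_right r)"
    using w r unfolding continuous_on_def by (auto intro: tendsto_within_subset)
  fix j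
  have "\<forall>\<^sub>F x in at_right r. (if u j \<le> x then h j else 0) = (if u j \<le> r then h j else 0)"
  proof (cases "u j \<le> r")
    case True
    show ?thesis using eventually_at_right_less[of r] by eventually_elim (use True in auto)
  next
    case False
    then show ?thesis unfolding eventually_at_right_field by (intro exI[of _ "u j"]) auto
  qed
  then show "((\<lambda>x. if u j \<le> x then h j else 0) \<longlongrightarrow> (if u j \<le> r then h j else 0)) (at_right r)"
    by (rule tendsto_eventually)
qed

section \<open>Iterated integrals\<close>

lemma borel_measurable_gauss2 [measurable]: "(\<lambda>(v, z). gauss v z) \<in> borel_measurable (borel \<Otimes>\<^sub>M borel)"
  unfolding gauss_def normal_density_def by measurable

text \<open>For a negative variance the integrand of \<open>Phi\<close> is at least 1 on a
  half-line; non-integrability forces the default value 0.\<close>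

lemma not_integrable_ge_one_atMost:
  fixes f :: "real \<Rightarrow> real"
  assumes f: "\<And>y. 1 \<le> f y"
  shows "\<not> integrable lborel (\<lambda>y. indicator {..x} y *\<^sub>R f y)"
proof
  assume "integrable lborel (\<lambda>y. indicator {..x} y *\<^sub>R f y)"
  then have "integrable lborel (indicator {..x} :: real \<Rightarrow> real)"
    by (rule Bochner_Integration.integrable_bound) (auto simp: indicator_def intro: order_trans[OF f abs_ge_self])
  then have "emeasure lborel {..x} < \<infinity>"
    by (simp add: integrable_indicator_iff)
  then obtain c where c: "emeasure lborel {..x} = ennreal c" "0 \<le> c"
    by (cases "emeasure lborel {..x}") auto
  have "ennreal (c + 1) = emeasure lborel {x - (c + 1)..x}" using c by simp
  also have "\<dots> \<le> emeasure lborel {..x}" by (intro emeasure_mono) auto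
  finally show False using c by simp
qed

text \<open>The junk case \<open>v \<le> 0\<close> arises when a jump time hits a partition point, so that the grid is too
  short; although negligible, it matters for the measurability of the integrand in the jump times.\<close>

lemma Phi_nonpos: "v \<le> 0 \<Longrightarrow> Phi v x = 0"
\<comment> \<open>For v = 0 the prefactor is 1 / 0 = 0; for v < 0 the integral takes its default
  value 0.\<close>
proof (cases "v = 0")
  case False
  assume "v \<le> 0"
  then have "v < 0" using False by simp
  then have "0 \<le> - y\<^sup>2 / (2 * v)" for y
    by (intro divide_nonpos_neg) auto
  then have "1 \<le> exp (- y\<^sup>2 / (2 * v))" for y
    by (simp only: one_le_exp_iff)
  then have "(LBINT y:{..x}. exp (- y\<^sup>2 / (2 * v))) = 0"
    using not_integrable_ge_one_atMost[of "\<lambda>y. exp (- y\<^sup>2 / (2 * v))" x]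
    unfolding set_lebesgue_integral_def by (intro not_integrable_integral_eq) auto
  then show ?thesis by (simp add: Phi_def)
qed (simp add: Phi_def)

lemma Phi_eq: "0 < v \<Longrightarrow> Phi v x = (\<integral>y. indicator {..x} y * gauss v y \<partial>lborel)"
proof -
  assume v: "0 < v"
  have "(\<integral>y. indicator {..x} y * gauss v y \<partial>lborel) =
        (\<integral>y. 1 / sqrt (2 * pi * v) * (indicator {..x} y * exp (- y\<^sup>2 / (2 * v))) \<partial>lborel)"
    using v by (intro Bochner_Integration.integral_cong) (auto simp: gauss_eq)
  also have "\<dots> = Phi v x"
    unfolding Phi_def set_lebesgue_integral_def by (simp only: integral_mult_right_zero real_scaleR_def)
  finally show ?thesis ..
qed

lemma Phi_scale: "0 < v \<Longrightarrow> Phi v x = Phi 1 (x / sqrt v)"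
proof -
  assume v: "0 < v"
  have "Phi v x = (\<integral>y. indicator {..x} y * gauss v y \<partial>lborel)" by (rule Phi_eq[OF v])
  also have "\<dots> = \<bar>sqrt v\<bar> *\<^sub>R (\<integral>y. indicator {..x} (0 + sqrt v * y) * gauss v (0 + sqrt v * y) \<partial>lborel)"
    using v by (intro lborel_integral_real_affine) auto
  also have "\<dots> = (\<integral>y. sqrt v * (indicator {..x} (sqrt v * y) * gauss v (sqrt v * y)) \<partial>lborel)"
    using v by simp
  also have "\<dots> = (\<integral>y. indicator {..x / sqrt v} y * gauss 1 y \<partial>lborel)"
  proof (intro Bochner_Integration.integral_cong refl)
    fix y
    have "sqrt v * gauss v (sqrt v * y) = gauss 1 y"
      using v by (simp add: gauss_eq power_mult_distrib real_sqrt_mult)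
    moreover have "indicator {..x} (sqrt v * y) = (indicator {..x / sqrt v} y :: real)"
      using v by (simp add: indicator_def pos_le_divide_eq mult.commute)
    ultimately show "sqrt v * (indicator {..x} (sqrt v * y) * gauss v (sqrt v * y)) = indicator {..x / sqrt v} y * gauss 1 y"
      by (simp add: algebra_simps)
  qed
  also have "\<dots> = Phi 1 (x / sqrt v)" by (rule Phi_eq[symmetric]) simp
  finally show ?thesis .
qed

lemma integrable_gauss_shift: "0 < v \<Longrightarrow> integrable lborel (\<lambda>y. gauss v (y - x))"
  using nn_integral_gauss[of v x] by (intro integrableI_nonneg) auto

lemma Phi_shift: "0 < v \<Longrightarrow> (\<integral>y. indicator {..c} y * gauss v (y - x) \<partial>lborel) = Phi v (c - x)"
proof -
  assume v: "0 < v"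
  have "(\<integral>y. indicator {..c} y * gauss v (y - x) \<partial>lborel) =
      (\<integral>y. indicator {..c} (x + 1 * y) * gauss v (x + 1 * y - x) \<partial>lborel)"
    by (subst lborel_integral_real_affine[where c = 1 and t = x]) auto
  also have "\<dots> = (\<integral>y. indicator {..c - x} y * gauss v y \<partial>lborel)"
    by (intro Bochner_Integration.integral_cong) (auto simp: indicator_def)
  finally show ?thesis using Phi_eq[OF v] by simp
qed

lemma prob_space_gauss: "0 < v \<Longrightarrow> prob_space (density lborel (\<lambda>y. ennreal (gauss v (y - x))))"
  by (rule prob_spaceI) (simp add: emeasure_density nn_integral_gauss)

text \<open>Both sides are probability measures on the line with the same distribution
  function.\<close>

lemma interval_measure_Phi:
  assumes v: "0 < v"
  shows "interval_measure (\<lambda>y. Phi v (y - x)) = density lborel (\<lambda>y. ennreal (gauss v (y - x)))"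
proof -
  let ?D = "density lborel (\<lambda>y. ennreal (gauss v (y - x)))"
  interpret prob_space ?D by (rule prob_space_gauss[OF v])
  interpret real_distribution ?D by standard auto
  have cdf: "cdf ?D = (\<lambda>y. Phi v (y - x))"
  proof
    fix c
    have "emeasure ?D {..c} = (\<integral>\<^sup>+y. ennreal (indicator {..c} y * gauss v (y - x)) \<partial>lborel)"
      by (subst emeasure_density) (auto intro!: nn_integral_cong simp: indicator_def)
    also have "\<dots> = ennreal (\<integral>y. indicator {..c} y * gauss v (y - x) \<partial>lborel)"
      using integrable_real_mult_indicator[OF _ integrable_gauss_shift[OF v, of x], of "{..c}"]
      by (intro nn_integral_eq_integral) (auto simp: mult.commute)
    also have "\<dots> = ennreal (Phi v (c - x))" by (simp add: Phi_shift[OF v])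
    finally have "emeasure ?D {..c} = ennreal (Phi v (c - x))" .
    moreover have "0 \<le> Phi v (c - x)"
      unfolding Phi_shift[OF v, symmetric] by (intro integral_nonneg_AE) auto
    ultimately show "cdf ?D c = Phi v (c - x)" by (simp add: cdf_def measure_def)
  qed
  have "real_distribution (interval_measure (cdf ?D))"
    by (intro real_distribution_interval_measure cdf_nondecreasing cdf_is_right_cont cdf_lim_at_bot cdf_lim_at_top_prob)
  moreover have "cdf (interval_measure (cdf ?D)) = cdf ?D"
    by (intro cdf_interval_measure cdf_nondecreasing cdf_is_right_cont cdf_lim_at_bot)
  ultimately have "interval_measure (cdf ?D) = ?D"
    using real_distribution_axioms by (intro cdf_unique)
  then show ?thesis unfolding cdf .
qed

lemma integral_interval_measure_zero: "integral\<^sup>L (interval_measure (\<lambda>_. 0)) f = (0 :: real)"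
proof -
  have "emeasure (interval_measure (\<lambda>_. 0)) (\<Union>n. {- real n<..real n}) = 0"
    by (subst emeasure_UN_eq_0) (auto simp: emeasure_interval_measure_Ioc_eq)
  then have "emeasure (interval_measure (\<lambda>_. 0)) (space (interval_measure (\<lambda>_. 0))) = 0"
    by (simp add: UN_Ioc_eq_UNIV)
  then have "AE y in interval_measure (\<lambda>_. 0). f y = 0"
    by (intro AE_I[where N = "space (interval_measure (\<lambda>_. 0))"]) auto
  then show ?thesis by (rule integral_eq_zero_AE)
qed

text \<open>Replaces a measure that varies with v and x by a fixed measure and a kernel, for every
  real v. In this form measurability in the parameters becomes accessible.\<close>

lemma stieltjes_Phi:
  fixes f :: "real \<Rightarrow> real"
  assumes [measurable]: "f \<in> borel_measurable borel"
  shows "(LINT y:{..c}|interval_measure (\<lambda>y. Phi v (y - x)). f y) =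
     (\<integral>y. (if 0 < v then gauss v (y - x) else 0) * (indicator {..c} y * f y) \<partial>lborel)"
proof (cases "0 < v")
  case True
  then show ?thesis
    unfolding set_lebesgue_integral_def interval_measure_Phi[OF True]
    by (subst integral_density) auto
next
  case False
  then have "(\<lambda>y. Phi v (y - x)) = (\<lambda>_. 0)" by (auto simp: Phi_nonpos)
  then show ?thesis using False by (simp add: set_lebesgue_integral_def integral_interval_measure_zero)
qed

text \<open>By completing the square the image term is a Gaussian centred at 2 a - x with a weight
  free of y; each of the two Gaussians then integrates to one \<open>Phi\<close>.\<close>

lemma integral_bridge:
  assumes v: "0 < v"
  shows "(\<integral>y. bridge v a c x y * indicator {..c} y \<partial>lborel) =
    Phi 1 ((c - x) / sqrt v) - exp (- (2 * (c - a) * (a - x) / v)) * Phi 1 ((c - 2 * a + x) / sqrt v)"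
proof -
  have eq: "bridge v a c x y * indicator {..c} y = indicator {..c} y * gauss v (y - x) -
      exp (- (2 * (c - a) * (a - x) / v)) * (indicator {..c} y * gauss v (y - (2 * a - x)))" for y
  proof -
    have "exp (- 2 * (a - x) * (c - y) / v) * gauss v (y - x) = exp (- (2 * (c - a) * (a - x) / v)) * gauss v (y - (2 * a - x))"
      using v by (simp add: gauss_eq exp_add[symmetric] field_simps power2_eq_square)
    then show ?thesis by (simp add: bridge_def algebra_simps)
  qed
  have int: "integrable lborel (\<lambda>y. indicator {..c} y * gauss v (y - z))" for z
    using integrable_real_mult_indicator[OF _ integrable_gauss_shift[OF v, of z], of "{..c}"]
    by (simp add: mult.commute)
  have "c - (2 * a - x) = c - 2 * a + x" by simp
  then show ?thesis
    unfolding eq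
    by (simp only: Bochner_Integration.integral_diff int integrable_mult_right integral_mult_right_zero Phi_shift[OF v]
        Phi_scale[OF v, of "c - x"] Phi_scale[OF v, of "c - 2 * a + x"])
qed

text \<open>The integration variables live in one function on all naturals that is updated entry by
  entry, hence the product over \<open>UNIV\<close>. Joint measurability in parameter and variables
  is the form that survives each further integration.\<close>

lemma measurable_nested_integral:
  assumes T: "\<And>j. (\<lambda>\<omega>. T \<omega> j) \<in> borel_measurable \<Omega>"
    and \<beta>: "\<And>j. (\<lambda>\<omega>. \<beta> \<omega> j) \<in> borel_measurable \<Omega>"
    and g: "(\<lambda>(\<omega>, x). g \<omega> x) \<in> borel_measurable (\<Omega> \<Otimes>\<^sub>M (\<Pi>\<^sub>M j\<in>UNIV. borel))"
  shows "(\<lambda>(\<omega>, x). nested_integral (T \<omega>) (\<beta> \<omega>) (g \<omega>) r i x) \<in> borel_measurable (\<Omega> \<Otimes>\<^sub>M (\<Pi>\<^sub>M j\<in>UNIV. borel))"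
proof (induction r arbitrary: i)
  case 0
  then show ?case using g by simp
next
  case (Suc r)
  let ?X = "\<Pi>\<^sub>M j\<in>(UNIV::nat set). (borel :: real measure)"
  note [measurable] = T \<beta>
  have upd [measurable]: "(\<lambda>(x, y). x(i := y)) \<in> measurable (?X \<Otimes>\<^sub>M borel) ?X"
    unfolding case_prod_beta by (rule measurable_fun_upd[where J = UNIV]) auto
  have IH: "(\<lambda>p. nested_integral (T (fst p)) (\<beta> (fst p)) (g (fst p)) r (Suc i) (snd p)) \<in> borel_measurable (\<Omega> \<Otimes>\<^sub>M ?X)"
    using Suc[of "Suc i"] by (simp add: case_prod_beta)
  have IH2 [measurable]: "(\<lambda>(p, y). nested_integral (T (fst p)) (\<beta> (fst p)) (g (fst p)) r (Suc i) ((snd p)(i := y)))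
      \<in> borel_measurable ((\<Omega> \<Otimes>\<^sub>M ?X) \<Otimes>\<^sub>M borel)"
  proof -
    have "(\<lambda>q. (fst (fst q), (snd (fst q))(i := snd q))) \<in> measurable ((\<Omega> \<Otimes>\<^sub>M ?X) \<Otimes>\<^sub>M borel) (\<Omega> \<Otimes>\<^sub>M ?X)"
      using measurable_compose[of "\<lambda>q. (snd (fst q), snd q)" "(\<Omega> \<Otimes>\<^sub>M ?X) \<Otimes>\<^sub>M borel" "?X \<Otimes>\<^sub>M borel" _ ?X, OF _ upd]
      by (intro measurable_Pair) auto
    from measurable_compose[OF this IH] show ?thesis by (simp add: case_prod_beta)
  qed
  let ?F = "\<lambda>p y. (if 0 < T (fst p) i - T (fst p) (i - 1) then gauss (T (fst p) i - T (fst p) (i - 1)) (y - snd p (i - 1)) else 0) *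
      (if y \<le> \<beta> (fst p) i then nested_integral (T (fst p)) (\<beta> (fst p)) (g (fst p)) r (Suc i) ((snd p)(i := y)) else 0)"
  have "(\<lambda>(\<omega>, x). nested_integral (T \<omega>) (\<beta> \<omega>) (g \<omega>) (Suc r) i x) \<in> borel_measurable (\<Omega> \<Otimes>\<^sub>M ?X) \<longleftrightarrow>
      (\<lambda>p. \<integral>y. ?F p y \<partial>lborel) \<in> borel_measurable (\<Omega> \<Otimes>\<^sub>M ?X)"
  proof (rule measurable_cong)
    fix p assume p: "p \<in> space (\<Omega> \<Otimes>\<^sub>M ?X)"
    have "(\<lambda>y. nested_integral (T (fst p)) (\<beta> (fst p)) (g (fst p)) r (Suc i) ((snd p)(i := y))) \<in> borel_measurable borel"
      using measurable_Pair2[OF IH2 p] by simp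
    then show "(case p of (\<omega>, x) \<Rightarrow> nested_integral (T \<omega>) (\<beta> \<omega>) (g \<omega>) (Suc r) i x) = (\<integral>y. ?F p y \<partial>lborel)"
      by (auto simp: case_prod_beta stieltjes_Phi simp del: One_nat_def intro!: Bochner_Integration.integral_cong)
  qed
  also have "(\<lambda>p. \<integral>y. ?F p y \<partial>lborel) \<in> borel_measurable (\<Omega> \<Otimes>\<^sub>M ?X)"
  proof (rule lborel.borel_measurable_lebesgue_integral)
    have "case_prod ?F \<in> borel_measurable ((\<Omega> \<Otimes>\<^sub>M ?X) \<Otimes>\<^sub>M borel)"
      using IH2 unfolding case_prod_beta by measurable
    then show "case_prod ?F \<in> borel_measurable ((\<Omega> \<Otimes>\<^sub>M ?X) \<Otimes>\<^sub>M lborel)"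
      by (simp cong: measurable_cong_sets sets_pair_measure_cong)
  qed
  finally show ?case .
qed

section \<open>The grid of jump times and partition points\<close>

context barrier begin

lemma surv_last:
  assumes "y \<le> A m"
  shows "enn2real (surv 1 m y) =
    Phi 1 ((C m - y) / sqrt (T (Suc m) - T m)) -
    exp (- (2 * (C m - A m) * (A m - y) / (T (Suc m) - T m))) * Phi 1 ((C m - 2 * A m + y) / sqrt (T (Suc m) - T m))"
proof -
  let ?v = "T (Suc m) - T m"
  have v: "0 < ?v" using T_less[of m] by simp
  have [simp]: "gate m = C m" by (simp add: gate_def)
  have "surv 1 m y = (\<integral>\<^sup>+z. ennreal (bridge ?v (A m) (C m) y z * indicator {..C m} z) \<partial>lborel)"
    by (auto intro!: nn_integral_cong simp: indicator_def)
  moreover have "(\<integral>z. bridge ?v (A m) (C m) y z * indicator {..C m} z \<partial>lborel) =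
      enn2real (\<integral>\<^sup>+z. ennreal (bridge ?v (A m) (C m) y z * indicator {..C m} z) \<partial>lborel)"
    using bridge_nonneg[OF v assms, of _ "C m"]
    by (intro integral_eq_nn_integral) (auto simp: indicator_def)
  ultimately show ?thesis using integral_bridge[OF v, of "A m" "C m" y] by simp
qed

text \<open>The segment that ends at \<open>T i\<close> has index i - 1, which explains the shift in
  A and C relative to the theorem.\<close>

definition factor :: "(nat \<Rightarrow> real) \<Rightarrow> nat \<Rightarrow> real" where
  "factor x i = 1 - exp (- 2 * (A (i - 1) - x (i - 1)) * (C (i - 1) - x i) / (T i - T (i - 1)))"

text \<open>Induction on the number of integrals still to be done: the factors of the variables
  already fixed come out as a constant, and one more factor times the Gaussian density is a
  \<open>bridge\<close> kernel. The bounds \<beta> keep every variable where this kernel is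
  nonnegative, so Bochner and \<open>ennreal\<close> integrals agree.\<close>

lemma nested_integral_eq_surv:
  assumes T': "\<And>i. i \<le> m \<Longrightarrow> T' i = T i" and \<beta>: "\<And>i. 1 \<le> i \<Longrightarrow> i \<le> m \<Longrightarrow> \<beta> i = gate (i - 1)"
    and G: "\<And>x. x m \<le> A m \<Longrightarrow> G x = (\<Prod>i = 1..m. factor x i) * enn2real (surv 1 m (x m))"
  shows "r + i = Suc m \<Longrightarrow> 1 \<le> i \<Longrightarrow> x (i - 1) \<le> A (i - 1) \<Longrightarrow>
    nested_integral T' \<beta> G r i x = (\<Prod>j\<in>{1..<i}. factor x j) * enn2real (surv (Suc r) (i - 1) (x (i - 1)))"
proof (induction r arbitrary: i x)
  case 0
  then show ?case using G[of x] by (simp add: atLeastLessThanSuc_atLeastAtMost)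
next
  case (Suc r)
  obtain l where i: "i = Suc l" using Suc.prems(2) by (cases i) auto
  have l: "Suc l + Suc r = Suc m" using Suc.prems(1) i by simp
  let ?v = "T (Suc l) - T l"
  have v: "0 < ?v" using T_less[of l] l by simp
  have x: "x l \<le> A l" using Suc.prems(3) i by simp
  define P where "P = (\<Prod>j\<in>{1..<i}. factor x j)"
  define S where "S y = enn2real (surv (Suc r) (Suc l) y)" for y
  define f where "f y = 1 - exp (- 2 * (A l - x l) * (C l - y) / ?v)" for y
  have [measurable]: "S \<in> borel_measurable borel" "f \<in> borel_measurable borel"
    unfolding S_def[abs_def] f_def[abs_def] by measurable
  have inner: "nested_integral T' \<beta> G r (Suc i) (x(i := y)) = P * f y * S y" if "y \<le> gate l" for y
  proof -
    have "y \<le> A (Suc l)" using gate_le(2)[of l] that l by simp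
    then have "nested_integral T' \<beta> G r (Suc i) (x(i := y)) =
        (\<Prod>j\<in>{1..<Suc i}. factor (x(i := y)) j) * enn2real (surv (Suc r) (Suc i - 1) ((x(i := y)) (Suc i - 1)))"
      using Suc.prems(1) i by (intro Suc.IH) auto
    also have "surv (Suc r) (Suc i - 1) ((x(i := y)) (Suc i - 1)) = surv (Suc r) i y"
      by (simp only: diff_Suc_1 fun_upd_same)
    also have "(\<Prod>j\<in>{1..<Suc i}. factor (x(i := y)) j) = (\<Prod>j\<in>{1..<i}. factor (x(i := y)) j) * factor (x(i := y)) i"
      using Suc.prems(2) by simp
    \<comment> \<open>Factors with index below i involve only variables with index below i, so
      updating the i-th one leaves them alone.\<close>
    also have "(\<Prod>j\<in>{1..<i}. factor (x(i := y)) j) = P"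
      unfolding P_def by (intro prod.cong refl) (auto simp: factor_def)
    also have "factor (x(i := y)) i = f y"
      by (simp add: factor_def f_def i)
    finally show ?thesis unfolding S_def i .
  qed
  have gate: "\<beta> i = gate l" using \<beta>[of i] l i by simp
  have T'i: "T' i - T' (i - 1) = ?v" using T' l i by simp
  have "nested_integral T' \<beta> G (Suc r) i x =
      (LINT y:{..gate l}|interval_measure (\<lambda>y. Phi ?v (y - x l)). P * f y * S y)"
  proof -
    have xl: "x (i - 1) = x l" by (simp add: i)
    show ?thesis
      unfolding nested_integral.simps gate T'i xl
      by (rule set_lebesgue_integral_cong) (use inner in auto)
  qed
  also have "\<dots> = (\<integral>y. gauss ?v (y - x l) * (indicator {..gate l} y * (P * f y * S y)) \<partial>lborel)"
    using v by (subst stieltjes_Phi) auto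
  also have "\<dots> = (\<integral>y. P * (bridge ?v (A l) (C l) (x l) y * (indicator {..gate l} y * S y)) \<partial>lborel)"
    by (intro Bochner_Integration.integral_cong refl) (simp add: bridge_def f_def mult_ac)
  also have "\<dots> = P * (\<integral>y. bridge ?v (A l) (C l) (x l) y * (indicator {..gate l} y * S y) \<partial>lborel)"
    by (rule integral_mult_right_zero)
  also have "(\<integral>y. bridge ?v (A l) (C l) (x l) y * (indicator {..gate l} y * S y) \<partial>lborel) =
      enn2real (\<integral>\<^sup>+y. ennreal (bridge ?v (A l) (C l) (x l) y * (indicator {..gate l} y * S y)) \<partial>lborel)"
    using bridge_nonneg[OF v x, of _ "C l"] gate_le(1)[of l]
    by (intro integral_eq_nn_integral) (auto simp: indicator_def S_def intro!: mult_nonneg_nonneg)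
  also have "(\<integral>\<^sup>+y. ennreal (bridge ?v (A l) (C l) (x l) y * (indicator {..gate l} y * S y)) \<partial>lborel) = surv (Suc (Suc r)) l (x l)"
  proof -
    \<comment> \<open>Finiteness makes the passage through \<open>enn2real\<close> lossless.\<close>
    have "surv (Suc r) (Suc l) y < top" for y
      using surv_le_1[of "Suc l" "Suc r" y] l by (auto intro: le_less_trans)
    then have "ennreal (S y) = surv (Suc r) (Suc l) y" for y
      by (simp add: S_def)
    moreover have "0 \<le> S y" for y by (simp add: S_def)
    ultimately show ?thesis
      unfolding surv.simps(2)[of "Suc r" l]
      by (intro nn_integral_cong) (auto simp: indicator_def ennreal_mult'' simp del: surv.simps)
  qed
  finally show ?case by (simp add: P_def i del: surv.simps)
qed

end

lemma interval_index:
  fixes f :: "nat \<Rightarrow> real"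
  shows "f 0 \<le> r \<Longrightarrow> r < f n \<Longrightarrow> \<exists>i<n. f i \<le> r \<and> r < f (Suc i)"
proof (induction n)
  case (Suc n)
  then show ?case by (cases "r < f n") (auto simp: not_less less_Suc_eq)
qed simp

section \<open>The boundary for fixed jump times and heights\<close>

locale jump_setting =
  fixes b :: "real \<Rightarrow> real" and t :: real and n :: nat and s :: "nat \<Rightarrow> real"
  assumes n: "1 \<le> n" and s0: "s 0 = 0" and sn: "s n = t" and s_less: "\<And>i. i < n \<Longrightarrow> s i < s (Suc i)"
    and linear: "\<And>i. i < n \<Longrightarrow> \<exists>c d. \<forall>x\<in>{s i..s (Suc i)}. b x = c + d * x"
    and b0: "0 \<le> b 0"
begin

lemma s_strict_mono: "i < j \<Longrightarrow> j \<le> n \<Longrightarrow> s i < s j"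
proof (induction j)
  case (Suc j)
  then show ?case using s_less[of j] by (cases "i = j") auto
qed simp

lemma t_pos: "0 < t"
  using s_strict_mono[of 0 n] n s0 sn by simp

lemma b_right: "0 \<le> r \<Longrightarrow> r < t \<Longrightarrow> (b \<longlongrightarrow> b r) (at_right r)"
proof -
  assume r: "0 \<le> r" "r < t"
  then obtain i where i: "i < n" "s i \<le> r" "r < s (Suc i)"
    using interval_index[of s r n] s0 sn by auto
  obtain c d where cd: "\<And>x. s i \<le> x \<Longrightarrow> x \<le> s (Suc i) \<Longrightarrow> b x = c + d * x"
    using linear[OF i(1)] by auto
  have "((\<lambda>x. c + d * x) \<longlongrightarrow> c + d * r) (at_right r)" by (intro tendsto_intros)
  moreover have "\<forall>\<^sub>F x in at_right r. c + d * x = b x"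
    unfolding eventually_at_right_field using i cd by (intro exI[of _ "s (Suc i)"]) auto
  ultimately show ?thesis using cd[of r] i by (auto intro: Lim_transform_eventually)
qed

lemma b_continuous: "continuous_on {0..t} b"
proof -
  have "j \<le> n \<Longrightarrow> continuous_on {0..s j} b" for j
  proof (induction j)
    case 0
    then show ?case by (simp add: s0)
  next
    case (Suc j)
    obtain c d where cd: "\<And>x. s j \<le> x \<Longrightarrow> x \<le> s (Suc j) \<Longrightarrow> b x = c + d * x"
      using linear[of j] Suc.prems by auto
    have "continuous_on {s j..s (Suc j)} (\<lambda>x. c + d * x)" by (intro continuous_intros)
    then have "continuous_on {s j..s (Suc j)} b" by (rule continuous_on_eq) (use cd in auto)
    then have "continuous_on ({0..s j} \<union> {s j..s (Suc j)}) b"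
      using Suc by (intro continuous_on_closed_Un) auto
    moreover have "0 \<le> s j" using s_strict_mono[of 0 j] Suc.prems s0 by (cases j) auto
    ultimately show ?case using s_less[of j] Suc.prems by (simp add: ivl_disj_un)
  qed
  from this[of n] show ?thesis using sn by simp
qed

end

locale jump_instance = jump_setting +
  fixes k :: nat and u h :: "nat \<Rightarrow> real"
  assumes u: "u \<in> jump_simplex k t" and distinct: "\<And>i j. i \<in> {1..<n} \<Longrightarrow> j \<in> {1..k} \<Longrightarrow> u j \<noteq> s i"
begin

definition "m = k + n - 1"
definition "points = insert 0 (u ` {1..k} \<union> s ` {1..<n})"
text \<open>The grid is prolonged by t, so that the last stretch is a segment like the others. In
  Brownian coordinates \<open>A i\<close> is the boundary just after \<open>T i\<close>, and
  \<open>C i\<close> the boundary just before \<open>T (Suc i)\<close>.\<close>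

definition "T i = (if i \<le> m then grid n s k u ! i else t)"
definition "A i = level b k u h (T i) - height_at k u h (T i)"
definition "C i = level b k u h (T (Suc i))"

lemma u_range: "j \<in> {1..k} \<Longrightarrow> 0 < u j \<and> u j < t"
  using u by (auto simp: jump_simplex_def)

lemma u_strict_mono: "1 \<le> i \<Longrightarrow> i < j \<Longrightarrow> j \<le> k \<Longrightarrow> u i < u j"
proof (induction j)
  case (Suc j)
  then have "u j < u (Suc j)" if "1 \<le> j" using u that by (auto simp: jump_simplex_def)
  then show ?case using Suc by (cases "i = j") auto
qed simp

lemma points_range: "x \<in> points \<Longrightarrow> 0 \<le> x \<and> x < t"
  using u_range t_pos s_strict_mono[of 0] s_strict_mono[of _ n] s0 sn
  by (fastforce simp: points_def intro: less_imp_le)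

lemma finite_points: "finite points"
  by (simp add: points_def)

text \<open>Distinctness of jump times and partition points enters here: the grid then has exactly m
  + 1 entries, so all indices up to m are in range.\<close>

lemma card_points: "card points = Suc m"
proof -
  have "inj_on u {1..k}"
    by (rule linorder_inj_onI) (use u_strict_mono in \<open>force\<close>)+
  moreover have "inj_on s {1..<n}"
    by (rule linorder_inj_onI) (use s_strict_mono in \<open>force\<close>)+
  moreover have "u ` {1..k} \<inter> s ` {1..<n} = {}" using distinct by force
  ultimately have "card (u ` {1..k} \<union> s ` {1..<n}) = k + (n - 1)"
    by (simp add: card_Un_disjoint card_image)
  moreover have "0 \<notin> u ` {1..k} \<union> s ` {1..<n}"
  proof -
    have "s i \<noteq> 0" if "i \<in> {1..<n}" for i using s_strict_mono[of 0 i] s0 that by simp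
    moreover have "u j \<noteq> 0" if "j \<in> {1..k}" for j using u_range[OF that] by simp
    ultimately show ?thesis by (metis UnE imageE)
  qed
  ultimately show ?thesis using n by (simp add: points_def m_def)
qed

lemma grid_eq: "grid n s k u = sorted_list_of_set points"
  by (simp only: grid_def points_def)

lemma length_grid: "length (grid n s k u) = Suc m"
  using card_points by (simp add: grid_eq)

lemma set_grid: "set (grid n s k u) = points"
  using finite_points by (simp add: grid_eq)

lemma T_in_points: "i \<le> m \<Longrightarrow> T i \<in> points"
  using length_grid set_grid nth_mem[of i "grid n s k u"] by (simp add: T_def)

lemma T_end: "T (Suc m) = t"
  by (simp add: T_def)

lemma T_less_Suc: "i \<le> m \<Longrightarrow> T i < T (Suc i)"
proof (cases "i = m")
  case True
  then show ?thesis using points_range[OF T_in_points[of m]] by (simp add: T_end)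
next
  case False
  assume "i \<le> m"
  moreover have "sorted_wrt (<) (grid n s k u)"
    unfolding grid_eq by simp
  ultimately show ?thesis
    using False length_grid sorted_wrt_nth_less[of "(<)" "grid n s k u" i "Suc i"] by (simp add: T_def)
qed

lemma T_mono: "i \<le> j \<Longrightarrow> j \<le> Suc m \<Longrightarrow> T i \<le> T j"
proof (induction j)
  case (Suc j)
  then show ?case using T_less_Suc[of j] by (cases "i = Suc j") auto
qed simp

lemma points_T: "x \<in> points \<Longrightarrow> \<exists>i\<le>m. x = T i"
proof -
  assume "x \<in> points"
  then obtain i where "i < Suc m" "x = grid n s k u ! i"
    unfolding set_grid[symmetric] in_set_conv_nth length_grid by blast
  then show ?thesis by (intro exI[of _ i]) (simp add: T_def)
qed

lemma T_start: "T 0 = 0"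
proof -
  have "0 \<in> points" by (simp add: points_def)
  then obtain i where "i \<le> m" "T i = 0" using points_T by force
  then have "T 0 \<le> 0" using T_mono[of 0 i] by simp
  then show ?thesis using points_range[OF T_in_points[of 0]] by simp
qed

lemma no_points_between: "i \<le> m \<Longrightarrow> x \<in> points \<Longrightarrow> x \<le> T i \<or> T (Suc i) \<le> x"
proof -
  assume "i \<le> m" "x \<in> points"
  then obtain j where "j \<le> m" "x = T j" using points_T by blast
  then show ?thesis using T_mono[of j i] T_mono[of "Suc i" j] \<open>i \<le> m\<close> by (cases "j \<le> i") auto
qed

sublocale barrier m T A C
  by standard (auto simp: T_start T_less_Suc)

text \<open>No grid point lies strictly inside a segment, so there the set of past jumps is constant
  and b stays within a single linear piece.\<close>

lemma boundary_eq_line: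
  assumes i: "i \<le> m" and r: "T i \<le> r" "r < T (Suc i)"
  shows "b r - (\<Sum>j = 1..k. if u j \<le> r then h j else 0) = line i r"
proof -
  define H where "H = (\<Sum>j = 1..k. if u j \<le> T i then h j else 0)"
  have gap: "u j \<le> T i \<or> T (Suc i) \<le> u j" if "j \<in> {1..k}" for j
    using no_points_between[OF i, of "u j"] that by (auto simp: points_def)
  have H: "(\<Sum>j = 1..k. if u j \<le> r then h j else 0) = H"
    unfolding H_def using gap r by (intro sum.cong refl) force
  \<comment> \<open>The strict condition of \<open>level\<close> and the equality in
    \<open>height_at\<close> combine to \<open>u j \<le> T i\<close>.\<close>
  have "level b k u h (T i) - height_at k u h (T i) = b (T i) - H"
    unfolding level_def height_at_def H_def diff_diff_eq sum.distrib[symmetric]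
    by (intro arg_cong2[of _ _ _ _ minus] refl sum.cong) auto
  then have A: "A i = b (T i) - H" by (simp add: A_def)
  have C: "C i = b (T (Suc i)) - H"
    unfolding C_def level_def H_def using gap T_less_Suc[OF i]
    by (intro arg_cong2[of _ _ _ _ minus] refl sum.cong) force
  have Ti: "0 \<le> T i" "T i < t" using points_range[OF T_in_points[OF i]] by auto
  then obtain l where l: "l < n" "s l \<le> T i" "T i < s (Suc l)"
    using interval_index[of s "T i" n] s0 sn by auto
  have "T (Suc i) \<le> s (Suc l)"
  proof (cases "Suc l < n")
    case True
    then have "s (Suc l) \<in> points" by (auto simp: points_def)
    then show ?thesis using no_points_between[OF i] l by force
  next
    case False
    then have "s (Suc l) = t" using l sn by (metis Suc_lessI)
    then show ?thesis using T_mono[of "Suc i" "Suc m"] i T_end by simp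
  qed
  obtain c d where cd: "\<And>x. s l \<le> x \<Longrightarrow> x \<le> s (Suc l) \<Longrightarrow> b x = c + d * x"
    using linear[OF l(1)] by auto
  have bx: "b x = c + d * x" if "T i \<le> x" "x \<le> T (Suc i)" for x
    using that l \<open>T (Suc i) \<le> s (Suc l)\<close> by (intro cd) auto
  have "slope i = d"
    using T_less_Suc[OF i] bx[of "T i"] bx[of "T (Suc i)"] by (simp add: slope_def A C field_simps)
  then show ?thesis
    using bx[of r] bx[of "T i"] r T_less_Suc[OF i] unfolding H line_def A by (simp add: algebra_simps)
qed

text \<open>On half-open segments the two conditions coincide by \<open>boundary_eq_line\<close>.
  The right end point, where \<open>below\<close> tests the left limit of the boundary, is added by
  continuity; this also covers t itself.\<close>

lemma compensated_iff_below:
  assumes w: "continuous_on {0..} w"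
  shows "(\<forall>r\<in>{0..<t}. compensated b k u h w r \<le> - c) \<longleftrightarrow> below (\<lambda>r. c + w r)"
proof
  assume L: "\<forall>r\<in>{0..<t}. compensated b k u h w r \<le> - c"
  show "below (\<lambda>r. c + w r)"
    unfolding below_def
  proof (intro allI impI ballI)
    fix i r assume i: "i \<le> m" and r: "r \<in> {T i..T (Suc i)}"
    have T: "T i < T (Suc i)" "0 \<le> T i" "T (Suc i) \<le> t"
      using T_less_Suc[OF i] points_range[OF T_in_points[OF i]] T_mono[of "Suc i" "Suc m"] T_end i by auto
    have cl: "closure {T i..<T (Suc i)} = {T i..T (Suc i)}" using T by simp
    have "c + w r - line i r \<le> 0"
    proof (rule continuous_le_on_closure[of "{T i..<T (Suc i)}" "\<lambda>r. c + w r - line i r"])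
      show "continuous_on (closure {T i..<T (Suc i)}) (\<lambda>r. c + w r - line i r)"
        unfolding cl using T
        by (intro continuous_on_diff continuous_on_add continuous_on_const continuous_on_line
              continuous_on_subset[OF w]) auto
      show "c + w x - line i x \<le> 0" if "x \<in> {T i..<T (Suc i)}" for x
        using L[rule_format, of x] that T boundary_eq_line[OF i, of x] by (auto simp: compensated_def)
    qed (use r cl in auto)
    then show "c + w r \<le> line i r" by simp
  qed
next
  assume R: "below (\<lambda>r. c + w r)"
  show "\<forall>r\<in>{0..<t}. compensated b k u h w r \<le> - c"
  proof
    fix r assume r: "r \<in> {0..<t}"
    then obtain i where i: "i \<le> m" "T i \<le> r" "r < T (Suc i)"
      using interval_index[of T r "Suc m"] T_start T_end by (auto simp: less_Suc_eq_le)
    then have "c + w r \<le> line i r" using R by (auto simp: below_def)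
    then show "compensated b k u h w r \<le> - c"
      using boundary_eq_line[OF i] by (simp add: compensated_def)
  qed
qed

lemma A_0: "A 0 = b 0"
proof -
  have "(\<Sum>j = 1..k. if 0 > u j then h j else 0) = 0" "(\<Sum>j = 1..k. if 0 = u j then h j else 0) = 0"
    using u_range by (force intro!: sum.neutral)+
  then show ?thesis by (simp add: A_def T_start level_def height_at_def)
qed

lemma segment_integral_eq_surv: "segment_integral b t n s k u h = enn2real (surv (Suc m) 0 0)"
proof -
  have C': "C (i - 1) = level b k u h (T i)" if "1 \<le> i" for i
    using that by (simp add: C_def)
  have T': "grid n s k u ! i = T i" if "i \<le> m" for i using that by (simp add: T_def)
  define G where "G x = (\<Prod>i = 1..m. factor x i) *
     (Phi 1 ((C m - x m) / sqrt (T (Suc m) - T m)) -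
      exp (- (2 * (C m - A m) * (A m - x m) / (T (Suc m) - T m))) *
      Phi 1 ((C m - 2 * A m + x m) / sqrt (T (Suc m) - T m)))" for x
  define \<beta> where "\<beta> i = min (level b k u h (grid n s k u ! i)) (level b k u h (grid n s k u ! i) - height_at k u h (grid n s k u ! i))" for i
  have "segment_integral b t n s k u h = nested_integral (\<lambda>i. grid n s k u ! i) \<beta> G m 1 (\<lambda>_. 0)"
  proof -
    have Cm: "C m = level b k u h t" by (simp add: C_def T_end)
    have Am: "level b k u h (grid n s k u ! m) - height_at k u h (grid n s k u ! m) = A m"
      by (simp add: A_def T')
    have fac: "(\<Prod>i = 1..m. factor x i) = (\<Prod>i = 1..m. 1 - exp (- 2 * (level b k u h (grid n s k u ! (i - 1)) - height_at k u h (grid n s k u ! (i - 1)) - x (i - 1)) * (level b k u h (grid n s k u ! i) - x i) / (grid n s k u ! i - grid n s k u ! (i - 1))))" for x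
      by (intro prod.cong refl) (auto simp: factor_def A_def C' T' simp del: One_nat_def)
    have Tm: "T m = grid n s k u ! m" by (simp add: T')
    show ?thesis
      unfolding segment_integral_def Let_def m_def[symmetric] G_def[abs_def] \<beta>_def[abs_def] fac T_end Cm Tm Am ..
  qed
  also have "\<dots> = (\<Prod>j\<in>{1..<1}. factor (\<lambda>_. 0) j) * enn2real (surv (Suc m) (1 - 1) 0)"
  proof (rule nested_integral_eq_surv)
    show "G x = (\<Prod>i = 1..m. factor x i) * enn2real (surv 1 m (x m))" if "x m \<le> A m" for x
      unfolding G_def surv_last[OF that] ..
    show "\<beta> i = gate (i - 1)" if "1 \<le> i" "i \<le> m" for i
      using that by (simp add: \<beta>_def gate_def T' C' A_def del: One_nat_def)
        (use that in \<open>auto simp: C_def A_def\<close>)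
    show "0 \<le> A (1 - 1)" using A_0 b0 by simp
  qed (auto simp: T')
  finally show ?thesis by simp
qed

end

section \<open>Measurability in the jump times and heights\<close>

text \<open>An index beyond the end gives an unspecified value that depends only on the excess.
  These values form a countable set of constants.\<close>

lemma nth_overflow: "length xs \<le> i \<Longrightarrow> xs ! i = [] ! (i - length xs)"
proof (induction xs arbitrary: i)
  case (Cons x xs)
  then show ?case by (cases i) auto
qed simp

text \<open>Events about an order statistic become events about a count, which is a sum of
  indicators.\<close>

lemma sorted_list_of_set_nth_le_iff:
  fixes S :: "'b::linorder set"
  assumes S: "finite S" and i: "i < card S"
  shows "sorted_list_of_set S ! i \<le> c \<longleftrightarrow> i < card {x \<in> S. x \<le> c}"
proof -
  let ?xs = "sorted_list_of_set S"
  have len: "length ?xs = card S" and dist: "distinct ?xs" and sort: "sorted ?xs" and set: "set ?xs = S"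
    using S by simp_all
  show ?thesis
  proof
    assume le: "?xs ! i \<le> c"
    have "set (take (Suc i) ?xs) \<subseteq> {x \<in> S. x \<le> c}"
    proof
      fix x assume "x \<in> set (take (Suc i) ?xs)"
      then obtain j where j: "j < Suc i" "j < length ?xs" "x = ?xs ! j"
        by (auto simp: in_set_conv_nth)
      then have "x \<le> ?xs ! i" using sort i len by (auto intro!: sorted_nth_mono)
      then show "x \<in> {x \<in> S. x \<le> c}" using le j set nth_mem[of j ?xs] by auto
    qed
    from card_mono[OF _ this] have "card (set (take (Suc i) ?xs)) \<le> card {x \<in> S. x \<le> c}" using S by simp
    moreover have "card (set (take (Suc i) ?xs)) = Suc i"
      using dist i len by (subst distinct_card) auto
    ultimately show "i < card {x \<in> S. x \<le> c}" by simp
  next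
    assume less: "i < card {x \<in> S. x \<le> c}"
    show "?xs ! i \<le> c"
    proof (rule ccontr)
      assume gt: "\<not> ?xs ! i \<le> c"
      have "{x \<in> S. x \<le> c} \<subseteq> set (take i ?xs)"
      proof
        fix x assume x: "x \<in> {x \<in> S. x \<le> c}"
        then have "x \<in> set ?xs" using set by simp
        then obtain j where j: "j < length ?xs" "x = ?xs ! j"
          unfolding in_set_conv_nth by blast
        have "j < i"
        proof (rule ccontr)
          assume "\<not> j < i"
          then have "?xs ! i \<le> x" using sort j by (auto intro!: sorted_nth_mono)
          then show False using gt x by auto
        qed
        then show "x \<in> set (take i ?xs)" using j by (auto simp: in_set_conv_nth)
      qed
      from card_mono[OF _ this] have "card {x \<in> S. x \<le> c} \<le> card (set (take i ?xs))" by simp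
      also have "\<dots> \<le> i" using card_length[of "take i ?xs"] by simp
      finally show False using less by simp
    qed
  qed
qed

text \<open>Each value of the image is counted at its first occurrence, so repeated values cause no
  double counting.\<close>

lemma card_image_filter:
  fixes f :: "nat \<Rightarrow> 'b"
  shows "card {x \<in> f ` {..<K}. Q x} = (\<Sum>j<K. if Q (f j) \<and> (\<forall>i<j. f i \<noteq> f j) then 1 else 0)"
proof (induction K)
  case (Suc K)
  show ?case
  proof (cases "Q (f K) \<and> (\<forall>i<K. f i \<noteq> f K)")
    case True
    then have "{x \<in> f ` {..<Suc K}. Q x} = insert (f K) {x \<in> f ` {..<K}. Q x}" by (auto simp: less_Suc_eq)
    moreover have "f K \<notin> {x \<in> f ` {..<K}. Q x}" using True by auto
    ultimately show ?thesis using Suc True by simp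
  next
    case False
    then have "Q (f K) \<Longrightarrow> f K \<in> f ` {..<K}" by (metis imageI lessThan_iff)
    then have "{x \<in> f ` {..<Suc K}. Q x} = {x \<in> f ` {..<K}. Q x}" by (auto simp: less_Suc_eq)
    then show ?thesis using Suc False by simp
  qed
qed simp

lemma measurable_sorted_list_nth:
  fixes a :: "'p \<Rightarrow> nat \<Rightarrow> real"
  assumes a: "\<And>j. j < K \<Longrightarrow> (\<lambda>\<omega>. a \<omega> j) \<in> borel_measurable \<Omega>"
  shows "(\<lambda>\<omega>. sorted_list_of_set (a \<omega> ` {..<K}) ! i) \<in> borel_measurable \<Omega>"
  unfolding borel_measurable_iff_le
proof
  fix c :: real
  define cnt where "cnt Q \<omega> = (\<Sum>j<K. if Q (a \<omega> j) \<and> (\<forall>i<j. a \<omega> i \<noteq> a \<omega> j) then 1 else (0::real))"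
    for Q :: "real \<Rightarrow> bool" and \<omega>
  have cnt: "real (card {x \<in> a \<omega> ` {..<K}. Q x}) = cnt Q \<omega>" for Q \<omega>
    unfolding card_image_filter cnt_def of_nat_sum by (intro sum.cong) auto
  have m: "cnt Q \<in> borel_measurable \<Omega>" if [measurable]: "Measurable.pred borel Q" for Q
    unfolding cnt_def[abs_def]
  proof (rule borel_measurable_sum)
    fix j assume "j \<in> {..<K}"
    then have [measurable]: "(\<lambda>\<omega>. a \<omega> j) \<in> borel_measurable \<Omega>" "\<And>i. i < j \<Longrightarrow> (\<lambda>\<omega>. a \<omega> i) \<in> borel_measurable \<Omega>"
      using a by auto
    have [measurable]: "Measurable.pred \<Omega> (\<lambda>\<omega>. \<forall>i\<in>{..<j}. a \<omega> i \<noteq> a \<omega> j)"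
      by (rule pred_intros_finite) simp_all
    have "Measurable.pred \<Omega> (\<lambda>\<omega>. Q (a \<omega> j) \<and> (\<forall>i\<in>{..<j}. a \<omega> i \<noteq> a \<omega> j))" by measurable
    then have "(\<lambda>\<omega>. if Q (a \<omega> j) \<and> (\<forall>i\<in>{..<j}. a \<omega> i \<noteq> a \<omega> j) then 1 else 0 :: real) \<in> borel_measurable \<Omega>"
      by measurable
    then show "(\<lambda>\<omega>. if Q (a \<omega> j) \<and> (\<forall>i<j. a \<omega> i \<noteq> a \<omega> j) then 1 else 0 :: real) \<in> borel_measurable \<Omega>"
      by simp
  qed
  have [measurable]: "cnt (\<lambda>_. True) \<in> borel_measurable \<Omega>" "cnt (\<lambda>x. x \<le> c) \<in> borel_measurable \<Omega>"
    by (rule m, measurable)+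
  \<comment> \<open>Coinciding values shorten the list, so the length depends on \<omega>. The event
    is split according to the length l, with the fixed out-of-range value when i is not below
    l.\<close>
  have "sorted_list_of_set (a \<omega> ` {..<K}) ! i \<le> c \<longleftrightarrow>
      (\<exists>l\<in>{..K}. cnt (\<lambda>_. True) \<omega> = real l \<and> (if i < l then real i < cnt (\<lambda>x. x \<le> c) \<omega> else [] ! (i - l) \<le> c))" for \<omega>
  proof -
    let ?S = "a \<omega> ` {..<K}"
    have 1: "cnt (\<lambda>_. True) \<omega> = real (card ?S)" using cnt[of \<omega> "\<lambda>_. True"] by simp
    have "card ?S \<le> K" using card_image_le[of "{..<K}" "a \<omega>"] by simp
    then have "(\<exists>l\<in>{..K}. cnt (\<lambda>_. True) \<omega> = real l \<and> (if i < l then real i < cnt (\<lambda>x. x \<le> c) \<omega> else [] ! (i - l) \<le> c)) \<longleftrightarrow>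
        (if i < card ?S then real i < cnt (\<lambda>x. x \<le> c) \<omega> else [] ! (i - card ?S) \<le> c)"
      unfolding 1 by auto
    also have "\<dots> \<longleftrightarrow> sorted_list_of_set ?S ! i \<le> c"
      using sorted_list_of_set_nth_le_iff[of ?S i c] nth_overflow[of "sorted_list_of_set ?S" i]
      unfolding cnt[symmetric] by auto
    finally show ?thesis ..
  qed
  then have "{\<omega> \<in> space \<Omega>. sorted_list_of_set (a \<omega> ` {..<K}) ! i \<le> c} =
      {\<omega> \<in> space \<Omega>. \<exists>l\<in>{..K}. cnt (\<lambda>_. True) \<omega> = real l \<and> (if i < l then real i < cnt (\<lambda>x. x \<le> c) \<omega> else [] ! (i - l) \<le> c)}"
    by blast
  also have "\<dots> \<in> sets \<Omega>" by measurable
  finally show "{\<omega> \<in> space \<Omega>. sorted_list_of_set (a \<omega> ` {..<K}) ! i \<le> c} \<in> sets \<Omega>" .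
qed

lemma measurable_grid:
  assumes n: "1 \<le> n" and u: "\<And>j. j \<in> {1..k} \<Longrightarrow> (\<lambda>\<omega>. u \<omega> j) \<in> borel_measurable \<Omega>"
  shows "(\<lambda>\<omega>. grid n s k (u \<omega>) ! i) \<in> borel_measurable \<Omega>"
proof -
  \<comment> \<open>One enumeration of all grid points: index 0 is the origin, 1 to k are the jump
    times, and k + i is the partition point \<open>s i\<close>.\<close>
  define a where "a \<omega> j = (if j = 0 then 0 else if j \<le> k then u \<omega> j else s (j - k))" for \<omega> j
  have "insert 0 (u \<omega> ` {1..k} \<union> s ` {1..<n}) = a \<omega> ` {..<k + n}" for \<omega>
  proof -
    have I: "{..<k + n} = insert 0 ({1..k} \<union> (\<lambda>j. j + k) ` {1..<n})"
    proof -
      have "(\<lambda>j. j + k) ` {1..<n} = {Suc k..<n + k}" by (simp add: image_add_atLeastLessThan')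
      then show ?thesis using n by auto
    qed
    have "a \<omega> ` {1..k} = u \<omega> ` {1..k}" by (intro image_cong) (auto simp: a_def)
    moreover have "a \<omega> ` ((\<lambda>j. j + k) ` {1..<n}) = s ` {1..<n}"
      unfolding image_image by (intro image_cong) (auto simp: a_def)
    moreover have "a \<omega> 0 = 0" by (simp add: a_def)
    ultimately show ?thesis unfolding I image_insert image_Un by simp
  qed
  then have "(\<lambda>\<omega>. grid n s k (u \<omega>) ! i) = (\<lambda>\<omega>. sorted_list_of_set (a \<omega> ` {..<k + n}) ! i)"
    by (simp add: grid_def)
  also have "\<dots> \<in> borel_measurable \<Omega>"
  proof (rule measurable_sorted_list_nth)
    fix j
    show "(\<lambda>\<omega>. a \<omega> j) \<in> borel_measurable \<Omega>"
      using u[of j] by (cases "j = 0"; cases "j \<le> k") (simp_all add: a_def)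
  qed
  finally show ?thesis .
qed

lemma measurable_Phi1 [measurable]: "Phi 1 \<in> borel_measurable borel"
proof -
  have "Phi 1 = (\<lambda>x. \<integral>y. (if y \<le> x then gauss 1 y else 0) \<partial>lborel)"
    by (rule ext) (auto simp: Phi_eq indicator_def intro!: Bochner_Integration.integral_cong)
  also have "\<dots> \<in> borel_measurable borel"
    by (rule lborel.borel_measurable_lebesgue_integral) measurable
  finally show ?thesis .
qed

lemma measurable_level:
  assumes [measurable]: "b \<in> borel_measurable borel" "x \<in> borel_measurable \<Omega>"
    and "\<And>j. j \<in> {1..k} \<Longrightarrow> (\<lambda>\<omega>. u \<omega> j) \<in> borel_measurable \<Omega>" "\<And>j. j \<in> {1..k} \<Longrightarrow> (\<lambda>\<omega>. h \<omega> j) \<in> borel_measurable \<Omega>"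
  shows "(\<lambda>\<omega>. level b k (u \<omega>) (h \<omega>) (x \<omega>)) \<in> borel_measurable \<Omega>"
    and "(\<lambda>\<omega>. height_at k (u \<omega>) (h \<omega>) (x \<omega>)) \<in> borel_measurable \<Omega>"
proof -
  have "(\<lambda>\<omega>. \<Sum>j = 1..k. if x \<omega> > u \<omega> j then h \<omega> j else 0) \<in> borel_measurable \<Omega>"
    "(\<lambda>\<omega>. \<Sum>j = 1..k. if x \<omega> = u \<omega> j then h \<omega> j else 0) \<in> borel_measurable \<Omega>"
    using assms(3,4) by (auto intro!: borel_measurable_sum measurable_If borel_measurable_less borel_measurable_eq simp: pred_def)
  then show "(\<lambda>\<omega>. level b k (u \<omega>) (h \<omega>) (x \<omega>)) \<in> borel_measurable \<Omega>"
    "(\<lambda>\<omega>. height_at k (u \<omega>) (h \<omega>) (x \<omega>)) \<in> borel_measurable \<Omega>"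
    unfolding level_def height_at_def by measurable
qed

text \<open>Holds for all u and h, degenerate ones included, which is why the preceding lemmas treat
  short grids and nonpositive time differences.\<close>

lemma measurable_segment_integral:
  assumes n: "1 \<le> n" and b: "b \<in> borel_measurable borel"
  shows "(\<lambda>(u, h). segment_integral b t n s k u h) \<in>
    borel_measurable ((\<Pi>\<^sub>M i\<in>{1..k}. borel) \<Otimes>\<^sub>M (\<Pi>\<^sub>M i\<in>{1..k}. borel))"
proof -
  let ?P = "\<Pi>\<^sub>M i\<in>{1..k}. (borel :: real measure)"
  let ?X = "\<Pi>\<^sub>M i\<in>(UNIV :: nat set). (borel :: real measure)"
  define m where "m = k + n - 1"
  define T where "T p i = grid n s k (fst p) ! i" for p :: "(nat \<Rightarrow> real) \<times> (nat \<Rightarrow> real)" and i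
  define bL where "bL p i = level b k (fst p) (snd p) (T p i)" for p i
  define H where "H p i = height_at k (fst p) (snd p) (T p i)" for p i
  define bt where "bt p = level b k (fst p) (snd p) t" for p
  define G where "G p x = (\<Prod>i = 1..m. 1 - exp (- 2 * (bL p (i - 1) - H p (i - 1) - x (i - 1)) * (bL p i - x i) / (T p i - T p (i - 1))))
              * (Phi 1 ((bt p - x m) / sqrt (t - T p m))
                 - exp (- (2 * (bt p - (bL p m - H p m)) * ((bL p m - H p m) - x m) / (t - T p m)))
                   * Phi 1 ((bt p - 2 * (bL p m - H p m) + x m) / sqrt (t - T p m)))" for p x
  have comp: "(\<lambda>p. fst p j) \<in> borel_measurable (?P \<Otimes>\<^sub>M ?P)" "(\<lambda>p. snd p j) \<in> borel_measurable (?P \<Otimes>\<^sub>M ?P)" if "j \<in> {1..k}" for j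
    using that by (auto intro: measurable_compose[OF measurable_fst] measurable_compose[OF measurable_snd] measurable_component_singleton)
  have T [measurable]: "(\<lambda>p. T p i) \<in> borel_measurable (?P \<Otimes>\<^sub>M ?P)" for i
    unfolding T_def by (rule measurable_grid[OF n comp(1)])
  have [measurable]: "(\<lambda>p. bL p i) \<in> borel_measurable (?P \<Otimes>\<^sub>M ?P)" for i
    unfolding bL_def by (rule measurable_level(1)[OF b T comp])
  have [measurable]: "(\<lambda>p. H p i) \<in> borel_measurable (?P \<Otimes>\<^sub>M ?P)" for i
    unfolding H_def by (rule measurable_level(2)[OF b T comp])
  have [measurable]: "bt \<in> borel_measurable (?P \<Otimes>\<^sub>M ?P)"
    unfolding bt_def[abs_def] by (rule measurable_level(1)[OF b _ comp]) simp
  have [measurable]: "(\<lambda>x. x i) \<in> borel_measurable ?X" for i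
    by (rule measurable_component_singleton) simp
  have G: "(\<lambda>(p, x). G p x) \<in> borel_measurable ((?P \<Otimes>\<^sub>M ?P) \<Otimes>\<^sub>M ?X)"
    unfolding G_def case_prod_beta by measurable
  have "(\<lambda>(p, x). nested_integral (T p) (\<lambda>i. min (bL p i) (bL p i - H p i)) (G p) m 1 x) \<in> borel_measurable ((?P \<Otimes>\<^sub>M ?P) \<Otimes>\<^sub>M ?X)"
    by (intro measurable_nested_integral G) measurable
  from measurable_Pair1[OF this, of "\<lambda>_. 0"]
  have "(\<lambda>p. nested_integral (T p) (\<lambda>i. min (bL p i) (bL p i - H p i)) (G p) m 1 (\<lambda>_. 0)) \<in> borel_measurable (?P \<Otimes>\<^sub>M ?P)"
    by (simp add: space_PiM)
  moreover have "segment_integral b t n s k (fst p) (snd p) =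
      nested_integral (T p) (\<lambda>i. min (bL p i) (bL p i - H p i)) (G p) m 1 (\<lambda>_. 0)" for p
    unfolding segment_integral_def Let_def m_def T_def bL_def H_def bt_def G_def by (rule refl)
  ultimately show ?thesis unfolding case_prod_beta by (simp only:)
qed

section \<open>The series over the number of jumps\<close>

lemma (in jump_instance) brownian_segment:
  assumes M: "prob_space M" and BM: "standard_brownian_motion M B"
  shows "emeasure M {\<omega> \<in> space M. \<exists>q. \<forall>r\<in>{0..<t}. compensated b k u h (\<lambda>r. B r \<omega>) r \<le> - inverse (real (Suc q))} =
      ennreal (segment_integral b t n s k u h)"
    and "0 \<le> segment_integral b t n s k u h" "segment_integral b t n s k u h \<le> 1"
proof -
  have "continuous_on {0..} (\<lambda>r. B r \<omega>)" if "\<omega> \<in> space M" for \<omega>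
    using BM that by (simp add: standard_brownian_motion_def)
  then have "{\<omega> \<in> space M. \<exists>q. \<forall>r\<in>{0..<t}. compensated b k u h (\<lambda>r. B r \<omega>) r \<le> - inverse (real (Suc q))} =
      {\<omega> \<in> space M. \<exists>q. below (\<lambda>r. inverse (real (Suc q)) + B r \<omega>)}"
    using compensated_iff_below by blast
  moreover have "0 \<le> A 0" using A_0 b0 by simp
  moreover have "surv (Suc m) 0 0 \<le> 1" by (rule surv_le_1) simp
  moreover from this have "surv (Suc m) 0 0 < top" by (rule le_less_trans) simp
  ultimately show "emeasure M {\<omega> \<in> space M. \<exists>q. \<forall>r\<in>{0..<t}. compensated b k u h (\<lambda>r. B r \<omega>) r \<le> - inverse (real (Suc q))} =
      ennreal (segment_integral b t n s k u h)"
    unfolding segment_integral_eq_surv using brownian_strictly_below(2)[OF M BM] by simp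
  show "0 \<le> segment_integral b t n s k u h" "segment_integral b t n s k u h \<le> 1"
    unfolding segment_integral_eq_surv using enn2real_mono[OF \<open>surv (Suc m) 0 0 \<le> 1\<close>] by simp_all
qed

lemma measurable_subalgebra:
  "sets F \<subseteq> sets M \<Longrightarrow> space F = space M \<Longrightarrow> f \<in> measurable F P \<Longrightarrow> f \<in> measurable M P"
  using measurable_mono[of P P F M] by auto

lemma (in prob_space) mutually_independentD:
  assumes "mutually_independent M B N \<eta>"
  shows "process_sigma M {0..} B \<subseteq> events" "process_sigma M {0..} N \<subseteq> events" "process_sigma M {1..} \<eta> \<subseteq> events"
    and "\<And>a b c. a \<in> process_sigma M {0..} N \<Longrightarrow> b \<in> process_sigma M {1..} \<eta> \<Longrightarrow> c \<in> process_sigma M {0..} B \<Longrightarrow>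
      prob (a \<inter> b \<inter> c) = prob a * prob b * prob c"
proof -
  let ?F = "\<lambda>j. [process_sigma M {0..} B, process_sigma M {0..} N, process_sigma M {1..} \<eta>] ! j"
  have ind: "indep_sets ?F {..<3::nat}"
    using assms by (simp add: mutually_independent_def)
  have I: "{..<3::nat} = {0, 1, 2}" by auto
  have F: "?F j \<subseteq> events" if "j < 3" for j
    using ind that unfolding indep_sets_def by auto
  show "process_sigma M {0..} B \<subseteq> events" "process_sigma M {0..} N \<subseteq> events" "process_sigma M {1..} \<eta> \<subseteq> events"
    using F[of 0] F[of 1] F[of 2] by simp_all
  fix a b c assume "a \<in> process_sigma M {0..} N" "b \<in> process_sigma M {1..} \<eta>" "c \<in> process_sigma M {0..} B"
  then have "prob (\<Inter>j\<in>{..<3}. [c, a, b] ! j) = (\<Prod>j\<in>{..<3}. prob ([c, a, b] ! j))"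
    by (intro indep_setsD[OF ind]) (auto simp: I)
  then show "prob (a \<inter> b \<inter> c) = prob a * prob b * prob c"
    by (simp add: I Int_ac mult_ac)
qed

text \<open>Borel measurability of b on the whole line is a working assumption; the theorem is
  reduced to it by altering b off [0, t].\<close>

locale jump_model = prob_space M + jump_setting b t n s
  for M :: "'a measure" and b :: "real \<Rightarrow> real" and t n s +
  fixes B :: "real \<Rightarrow> 'a \<Rightarrow> real" and N :: "real \<Rightarrow> 'a \<Rightarrow> int" and \<eta> :: "nat \<Rightarrow> 'a \<Rightarrow> real"
  assumes b_borel [measurable]: "b \<in> borel_measurable borel"
    and BM: "standard_brownian_motion M B" and N: "jump_counting_process M N"
    and indep: "mutually_independent M B N \<eta>"
    and simplex: "\<And>k. AE u in jump_time_law M N t k. u \<in> jump_simplex k t"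
    and distinct_times: "AE \<omega> in M. \<forall>i\<in>{1..<n}. \<forall>k\<ge>1. jump_time N k \<omega> \<noteq> ereal (s i)"
begin

definition has_jumps :: "nat \<Rightarrow> 'a set" where
  "has_jumps k = {\<omega> \<in> space M. N t \<omega> = int k}"

definition times :: "nat \<Rightarrow> 'a \<Rightarrow> nat \<Rightarrow> real" where
  "times k \<omega> = (\<lambda>i\<in>{1..k}. real_of_ereal (jump_time N i \<omega>))"

definition heights :: "nat \<Rightarrow> 'a \<Rightarrow> nat \<Rightarrow> real" where
  "heights k \<omega> = (\<lambda>i\<in>{1..k}. \<eta> i \<omega>)"

text \<open>Countably many times make the path a random element of a countable product in which the
  survival event is measurable.\<close>

definition rationals :: "real set" where
  "rationals = {r \<in> \<rat>. 0 \<le> r \<and> r < t}"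

definition rational_path :: "'a \<Rightarrow> real \<Rightarrow> real" where
  "rational_path \<omega> = (\<lambda>r\<in>rationals. B r \<omega>)"

definition survival :: "nat \<Rightarrow> ((nat \<Rightarrow> real) \<times> (nat \<Rightarrow> real) \<times> (real \<Rightarrow> real)) set" where
  "survival k = {p \<in> space ((\<Pi>\<^sub>M i\<in>{1..k}. borel) \<Otimes>\<^sub>M ((\<Pi>\<^sub>M i\<in>{1..k}. borel) \<Otimes>\<^sub>M (\<Pi>\<^sub>M r\<in>rationals. borel))).
     \<exists>q. \<forall>r\<in>rationals. compensated b k (fst p) (fst (snd p)) (snd (snd p)) r \<le> - inverse (real (Suc q))}"

lemma measurable_times: "times k \<in> measurable (process_algebra M {0..} N) (\<Pi>\<^sub>M i\<in>{1..k}. borel)"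
  unfolding times_def[abs_def] using measurable_jump_time[OF N]
  by (intro measurable_restrict borel_measurable_real_of_ereal) auto

lemma measurable_heights: "heights k \<in> measurable (process_algebra M {1..} \<eta>) (\<Pi>\<^sub>M i\<in>{1..k}. borel)"
  unfolding heights_def[abs_def] by (intro measurable_restrict measurable_process_algebra) auto

lemma measurable_rational_path: "rational_path \<in> measurable (process_algebra M {0..} B) (\<Pi>\<^sub>M r\<in>rationals. borel)"
  unfolding rational_path_def[abs_def]
  by (intro measurable_restrict measurable_process_algebra) (auto simp: rationals_def)

lemma has_jumps_in_sigma: "has_jumps k \<in> process_sigma M {0..} N"
proof -
  have "has_jumps k = N t -` {int k} \<inter> space (process_algebra M {0..} N)" by (auto simp: has_jumps_def)
  also have "\<dots> \<in> sets (process_algebra M {0..} N)"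
    by (rule measurable_sets[OF measurable_process_algebra]) (use t_pos in auto)
  finally show ?thesis by (simp add: sets_process_algebra)
qed

lemma countable_rationals: "countable rationals"
  by (rule countable_subset[OF _ countable_rat]) (auto simp: rationals_def)

lemma survival_in_sets:
  "survival k \<in> sets ((\<Pi>\<^sub>M i\<in>{1..k}. borel) \<Otimes>\<^sub>M ((\<Pi>\<^sub>M i\<in>{1..k}. borel) \<Otimes>\<^sub>M (\<Pi>\<^sub>M r\<in>rationals. borel)))"
    (is "_ \<in> sets ?S")
proof -
  have c [measurable]: "(\<lambda>p. fst p j) \<in> borel_measurable ?S" "(\<lambda>p. fst (snd p) j) \<in> borel_measurable ?S" if "j \<in> {1..k}" for j
    using that by (auto intro!: measurable_compose[OF measurable_fst] measurable_compose[OF measurable_snd] measurable_component_singleton)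
  have "Measurable.pred ?S (\<lambda>p. compensated b k (fst p) (fst (snd p)) (snd (snd p)) r \<le> c)" if "r \<in> rationals" for r c
  proof -
    have [measurable]: "(\<lambda>p. snd (snd p) r) \<in> borel_measurable ?S"
      using that by (auto intro!: measurable_compose[OF measurable_snd] measurable_component_singleton)
    have [measurable]: "(\<lambda>p. \<Sum>j = 1..k. if fst p j \<le> r then fst (snd p) j else 0) \<in> borel_measurable ?S"
      using c by (intro borel_measurable_sum measurable_If) (auto simp: pred_def intro!: borel_measurable_le)
    show ?thesis unfolding compensated_def by measurable
  qed
  then have "{p \<in> space ?S. \<forall>r\<in>rationals. compensated b k (fst p) (fst (snd p)) (snd (snd p)) r \<le> - inverse (real (Suc q))} \<in> sets ?S" for q
    unfolding pred_def by (intro sets.sets_Collect_countable_All' countable_rationals)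
  then show ?thesis unfolding survival_def by (rule sets.sets_Collect_countable_Ex)
qed

lemma times_law: "distr (uniform_measure M (has_jumps k)) (\<Pi>\<^sub>M i\<in>{1..k}. borel) (times k) = jump_time_law M N t k"
  unfolding jump_time_law_def has_jumps_def times_def[abs_def] ..

lemma heights_law: "distr M (\<Pi>\<^sub>M i\<in>{1..k}. borel) (heights k) = jump_height_law M \<eta> k"
  unfolding jump_height_law_def heights_def[abs_def] ..

lemma compensated_cong:
  "(\<And>j. j \<in> {1..k} \<Longrightarrow> u j = u' j) \<Longrightarrow> (\<And>j. j \<in> {1..k} \<Longrightarrow> h j = h' j) \<Longrightarrow> w r = w' r \<Longrightarrow>
    compensated b k u h w r = compensated b k u' h' w' r"
  unfolding compensated_def by (auto intro!: sum.cong)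

lemma rational_iff:
  assumes \<omega>: "\<omega> \<in> space M"
  shows "(\<forall>r\<in>rationals. compensated b k u h (rational_path \<omega>) r \<le> c) \<longleftrightarrow> (\<forall>r\<in>{0..<t}. compensated b k u h (\<lambda>r. B r \<omega>) r \<le> c)"
proof -
  have w: "continuous_on {0..} (\<lambda>r. B r \<omega>)" using BM \<omega> by (simp add: standard_brownian_motion_def)
  have "compensated b k u h (rational_path \<omega>) r = compensated b k u h (\<lambda>r. B r \<omega>) r" if "r \<in> rationals" for r
    using that by (intro compensated_cong) (auto simp: rational_path_def)
  moreover have "compensated b k u h (\<lambda>r. B r \<omega>) r \<le> c"
    if "\<forall>r\<in>rationals. compensated b k u h (\<lambda>r. B r \<omega>) r \<le> c" "r \<in> {0..<t}" for r
  proof (rule rational_bound[where g = "compensated b k u h (\<lambda>r. B r \<omega>)" and t = t])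
    show "(compensated b k u h (\<lambda>r. B r \<omega>) \<longlongrightarrow> compensated b k u h (\<lambda>r. B r \<omega>) x) (at_right x)"
      if "0 \<le> x" "x < t" for x
      by (rule compensated_right_continuous[OF w b_right[OF that] that(1)])
    show "compensated b k u h (\<lambda>r. B r \<omega>) x \<le> c" if "x \<in> \<rat>" "0 \<le> x" "x < t" for x
      using \<open>\<forall>r\<in>rationals. _\<close> that by (simp add: rationals_def)
  qed (use that(2) in auto)
  ultimately show ?thesis by (auto simp: rationals_def)
qed

lemma sup_iff:
  assumes \<omega>: "\<omega> \<in> has_jumps k"
  shows "(SUP r\<in>{0..<t}. ereal (jump_BM B N \<eta> r \<omega> - b r)) < 0 \<longleftrightarrow> (times k \<omega>, heights k \<omega>, rational_path \<omega>) \<in> survival k"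
proof -
  have sp: "\<omega> \<in> space M" and Nt: "N t \<omega> = int k" using \<omega> by (auto simp: has_jumps_def)
  interpret counting_path N \<omega> by (rule counting_path[OF N sp])
  have "jump_BM B N \<eta> r \<omega> - b r = compensated b k (times k \<omega>) (heights k \<omega>) (\<lambda>r. B r \<omega>) r" if "r \<in> {0..<t}" for r
  proof -
    have "(\<Sum>j = 1..nat (N r \<omega>). \<eta> j \<omega>) = (\<Sum>j = 1..k. if times k \<omega> j \<le> r then heights k \<omega> j else 0)"
      using that t_pos by (subst sum_jumps[OF Nt]) (auto intro!: sum.cong simp: times_def heights_def)
    then show ?thesis by (simp add: jump_BM_def compensated_def)
  qed
  then have "(SUP r\<in>{0..<t}. ereal (jump_BM B N \<eta> r \<omega> - b r)) < 0 \<longleftrightarrow>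
      (\<exists>q. \<forall>r\<in>{0..<t}. compensated b k (times k \<omega>) (heights k \<omega>) (\<lambda>r. B r \<omega>) r \<le> - inverse (real (Suc q)))"
    unfolding SUP_less_zero_iff by simp
  moreover have "(times k \<omega>, heights k \<omega>, rational_path \<omega>) \<in> space ((\<Pi>\<^sub>M i\<in>{1..k}. borel) \<Otimes>\<^sub>M ((\<Pi>\<^sub>M i\<in>{1..k}. borel) \<Otimes>\<^sub>M (\<Pi>\<^sub>M r\<in>rationals. borel)))"
    by (auto simp: space_pair_measure space_PiM times_def heights_def rational_path_def)
  ultimately show ?thesis
    unfolding survival_def using rational_iff[OF sp] by simp
qed

lemma jump_simplex_in_sets: "jump_simplex k t \<in> sets (\<Pi>\<^sub>M i\<in>{1..k}. borel)"
proof -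
  let ?P = "\<Pi>\<^sub>M i\<in>{1..k}. (borel :: real measure)"
  have c: "(\<lambda>u. u i) \<in> borel_measurable ?P" if "i \<in> {1..k}" for i
    using that by (rule measurable_component_singleton)
  have "Measurable.pred ?P (\<lambda>u. (\<forall>i\<in>{1..k}. 0 < u i \<and> u i < t) \<and> (\<forall>i\<in>{1..<k}. u i < u (Suc i)))"
    using c by (intro pred_intros_logic pred_intros_finite) (auto simp: pred_def intro!: borel_measurable_less)
  moreover have "jump_simplex k t = {u \<in> space ?P. (\<forall>i\<in>{1..k}. 0 < u i \<and> u i < t) \<and> (\<forall>i\<in>{1..<k}. u i < u (Suc i))}"
    by (auto simp: jump_simplex_def space_PiM PiE_def)
  ultimately show ?thesis by (simp add: pred_def)
qed

lemma has_jumps_events: "has_jumps k \<in> events"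
  using has_jumps_in_sigma mutually_independentD(2)[OF indep] by auto

lemma measurable_events:
  "times k \<in> measurable M (\<Pi>\<^sub>M i\<in>{1..k}. borel)" "heights k \<in> measurable M (\<Pi>\<^sub>M i\<in>{1..k}. borel)"
  "rational_path \<in> measurable M (\<Pi>\<^sub>M r\<in>rationals. borel)"
proof -
  note sub = mutually_independentD(1-3)[OF indep, folded sets_process_algebra]
  show "times k \<in> measurable M (\<Pi>\<^sub>M i\<in>{1..k}. borel)"
    by (rule measurable_subalgebra[OF sub(2) space_process_algebra measurable_times])
  show "heights k \<in> measurable M (\<Pi>\<^sub>M i\<in>{1..k}. borel)"
    by (rule measurable_subalgebra[OF sub(3) space_process_algebra measurable_heights])
  show "rational_path \<in> measurable M (\<Pi>\<^sub>M r\<in>rationals. borel)"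
    by (rule measurable_subalgebra[OF sub(1) space_process_algebra measurable_rational_path])
qed

lemma AE_jump_instance:
  "AE u in jump_time_law M N t k. jump_instance b t n s k u"
proof -
  let ?P = "\<Pi>\<^sub>M i\<in>{1..k}. (borel :: real measure)"
  have c: "(\<lambda>u. u i) \<in> borel_measurable ?P" if "i \<in> {1..k}" for i
    using that by (rule measurable_component_singleton)
  have "{u \<in> space ?P. \<forall>i\<in>{1..<n}. \<forall>j\<in>{1..k}. u j \<noteq> s i} \<in> sets ?P"
  proof -
    have "Measurable.pred ?P (\<lambda>u. \<forall>i\<in>{1..<n}. \<forall>j\<in>{1..k}. u j \<noteq> s i)"
      using c by (intro pred_intros_finite) (auto simp: pred_def intro!: borel_measurable_neq)
    then show ?thesis by (simp add: pred_def)
  qed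
  moreover have "AE \<omega> in uniform_measure M (has_jumps k). \<forall>i\<in>{1..<n}. \<forall>j\<in>{1..k}. times k \<omega> j \<noteq> s i"
  proof (rule AE_uniform_measureI[OF has_jumps_events])
    show "AE \<omega> in M. \<omega> \<in> has_jumps k \<longrightarrow> (\<forall>i\<in>{1..<n}. \<forall>j\<in>{1..k}. times k \<omega> j \<noteq> s i)"
      using distinct_times
    proof eventually_elim
      case (elim \<omega>)
      show ?case
      proof (intro impI ballI)
        fix i j assume \<omega>: "\<omega> \<in> has_jumps k" and i: "i \<in> {1..<n}" and j: "j \<in> {1..k}"
        have sp: "\<omega> \<in> space M" and Nt: "N t \<omega> = int k" using \<omega> by (auto simp: has_jumps_def)
        interpret counting_path N \<omega> by (rule counting_path[OF N sp])
        \<comment> \<open>On N t = k the first k jump times are finite, so their real versions can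
          be compared with \<open>s i\<close>.\<close>
        have "jump_time N j \<omega> \<le> ereal t" using jump_time_le_iff[of t j] Nt t_pos j by simp
        then obtain c where "jump_time N j \<omega> = ereal c"
          using jump_time_nonneg[of j] by (cases "jump_time N j \<omega>") auto
        then show "times k \<omega> j \<noteq> s i" using elim i j by (auto simp: times_def)
      qed
    qed
  qed
  ultimately have "AE u in jump_time_law M N t k. \<forall>i\<in>{1..<n}. \<forall>j\<in>{1..k}. u j \<noteq> s i"
    unfolding times_law[symmetric] using measurable_events(1)[of k]
    by (subst AE_distr_iff) auto
  with simplex[of k] show ?thesis
  proof eventually_elim
    case (elim u)
    then show ?case
      by (intro jump_instance.intro jump_setting_axioms jump_instance_axioms.intro) auto
  qed
qed

lemma emeasure_survival:
  assumes "jump_instance b t n s k u" and su: "u \<in> space (\<Pi>\<^sub>M i\<in>{1..k}. borel)" and sh: "h \<in> space (\<Pi>\<^sub>M i\<in>{1..k}. borel)"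
  shows "emeasure M {\<omega> \<in> space M. (u, h, rational_path \<omega>) \<in> survival k} = ennreal (segment_integral b t n s k u h)"
proof -
  interpret jump_instance b t n s k u h by fact
  have "rational_path \<omega> \<in> space (\<Pi>\<^sub>M r\<in>rationals. borel)" for \<omega>
    by (auto simp: space_PiM rational_path_def)
  then have "(u, h, rational_path \<omega>) \<in> survival k \<longleftrightarrow>
      (\<exists>q. \<forall>r\<in>{0..<t}. compensated b k u h (\<lambda>r. B r \<omega>) r \<le> - inverse (real (Suc q)))" if "\<omega> \<in> space M" for \<omega>
    using su sh rational_iff[OF that] by (simp add: survival_def space_pair_measure)
  then have "{\<omega> \<in> space M. (u, h, rational_path \<omega>) \<in> survival k} =
      {\<omega> \<in> space M. \<exists>q. \<forall>r\<in>{0..<t}. compensated b k u h (\<lambda>r. B r \<omega>) r \<le> - inverse (real (Suc q))}"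
    by blast
  then show ?thesis using brownian_segment(1)[OF prob_space_axioms BM] by simp
qed

lemma emeasure_surviving:
  "emeasure M {\<omega> \<in> has_jumps k. (times k \<omega>, heights k \<omega>, rational_path \<omega>) \<in> survival k} =
    emeasure M (has_jumps k) * (\<integral>\<^sup>+u. \<integral>\<^sup>+h. emeasure M {\<omega> \<in> space M. (u, h, rational_path \<omega>) \<in> survival k}
      \<partial>jump_height_law M \<eta> k \<partial>jump_time_law M N t k)"
  unfolding times_law[symmetric] heights_law[symmetric]
proof (rule emeasure_conditional_product[OF measurable_events has_jumps_events _ survival_in_sets])
  fix C D E assume C: "C \<in> sets (\<Pi>\<^sub>M i\<in>{1..k}. (borel :: real measure))" and D: "D \<in> sets (\<Pi>\<^sub>M i\<in>{1..k}. (borel :: real measure))"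
    and E: "E \<in> sets (\<Pi>\<^sub>M r\<in>rationals. (borel :: real measure))"
  have "has_jumps k \<inter> times k -` C = has_jumps k \<inter> (times k -` C \<inter> space (process_algebra M {0..} N))"
    by (auto simp: has_jumps_def)
  also have "\<dots> \<in> sets (process_algebra M {0..} N)"
    by (intro sets.Int measurable_sets[OF measurable_times C]) (simp add: sets_process_algebra has_jumps_in_sigma)
  finally have 1: "has_jumps k \<inter> times k -` C \<in> process_sigma M {0..} N" by (simp add: sets_process_algebra)
  have 2: "heights k -` D \<inter> space M \<in> process_sigma M {1..} \<eta>"
    using measurable_sets[OF measurable_heights D] by (simp add: sets_process_algebra)
  have 3: "rational_path -` E \<inter> space M \<in> process_sigma M {0..} B"
    using measurable_sets[OF measurable_rational_path E] by (simp add: sets_process_algebra)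
  from mutually_independentD(4)[OF indep 1 2 3]
  show "prob (has_jumps k \<inter> times k -` C \<inter> (heights k -` D \<inter> space M) \<inter> (rational_path -` E \<inter> space M)) =
      prob (has_jumps k \<inter> times k -` C) * prob (heights k -` D \<inter> space M) * prob (rational_path -` E \<inter> space M)" .
qed

lemma surviving_events: "{\<omega> \<in> has_jumps k. (times k \<omega>, heights k \<omega>, rational_path \<omega>) \<in> survival k} \<in> events"
proof -
  note [measurable] = measurable_events has_jumps_events survival_in_sets
  have "{\<omega> \<in> has_jumps k. (times k \<omega>, heights k \<omega>, rational_path \<omega>) \<in> survival k} =
      has_jumps k \<inter> {\<omega> \<in> space M. (times k \<omega>, heights k \<omega>, rational_path \<omega>) \<in> survival k}"
    by (auto simp: has_jumps_def)
  also have "\<dots> \<in> events" by measurable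
  finally show ?thesis .
qed

text \<open>The conditional product formula with \<open>ennreal\<close> integrals is turned into
  Bochner integrals. The integrand lies in [0, 1], but for the jump times only almost
  surely.\<close>

lemma term_eq:
  "prob (has_jumps k) * (LINT u:jump_simplex k t|jump_time_law M N t k. (LINT h|jump_height_law M \<eta> k. segment_integral b t n s k u h)) =
   prob {\<omega> \<in> has_jumps k. (times k \<omega>, heights k \<omega>, rational_path \<omega>) \<in> survival k}"
\<comment> \<open>In the null case the conditional law is not a probability measure; both sides
  vanish because of the factor in front.\<close>
proof (cases "prob (has_jumps k) = 0")
  case True
  have "prob {\<omega> \<in> has_jumps k. (times k \<omega>, heights k \<omega>, rational_path \<omega>) \<in> survival k} \<le> prob (has_jumps k)"
    by (intro finite_measure_mono has_jumps_events) auto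
  then show ?thesis using True measure_nonneg[of M "{\<omega> \<in> has_jumps k. (times k \<omega>, heights k \<omega>, rational_path \<omega>) \<in> survival k}"]
    by simp
next
  case False
  let ?P = "\<Pi>\<^sub>M i\<in>{1..k}. (borel :: real measure)"
  let ?F = "jump_time_law M N t k"
  let ?G = "jump_height_law M \<eta> k"
  let ?seg = "segment_integral b t n s k"
  have setsF: "sets ?F = sets ?P" and setsG: "sets ?G = sets ?P"
    by (simp_all add: jump_time_law_def jump_height_law_def)
  have spF: "space ?F = space ?P" and spG: "space ?G = space ?P"
    by (simp_all add: jump_time_law_def jump_height_law_def)
  have "prob_space (uniform_measure M (has_jumps k))"
    using False by (intro prob_space_uniform_measure) (auto simp: emeasure_eq_measure)
  then interpret F: prob_space ?F
    unfolding times_law[symmetric] using measurable_events(1)[of k] by (intro prob_space.prob_space_distr) auto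
  interpret G: prob_space ?G
    unfolding heights_law[symmetric] using measurable_events(2)[of k] by (intro prob_space_distr)
  have seg: "(\<lambda>(u, h). ?seg u h) \<in> borel_measurable (?F \<Otimes>\<^sub>M ?G)"
    using measurable_segment_integral[OF n b_borel]
    by (simp add: setsF setsG cong: measurable_cong_sets sets_pair_measure_cong)
  define I where "I u = (\<integral>h. ?seg u h \<partial>?G)" for u
  have I_meas [measurable]: "I \<in> borel_measurable ?F"
    unfolding I_def[abs_def] using seg by (rule G.borel_measurable_lebesgue_integral)
  have inner: "(\<integral>\<^sup>+h. emeasure M {\<omega> \<in> space M. (u, h, rational_path \<omega>) \<in> survival k} \<partial>?G) = ennreal (I u) \<and> 0 \<le> I u \<and> I u \<le> 1"
    if inst: "jump_instance b t n s k u" and u: "u \<in> space ?P" for u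
  proof -
    have bounds: "0 \<le> ?seg u h" "?seg u h \<le> 1" for h
      using jump_instance.brownian_segment(2,3)[OF inst prob_space_axioms BM] .
    have "u \<in> space ?F" using u spF by simp
    from measurable_Pair2[OF seg this] have m: "?seg u \<in> borel_measurable ?G" by simp
    have int: "integrable ?G (?seg u)"
      using bounds by (intro G.integrable_const_bound[where B = 1] m) auto
    have "(\<integral>\<^sup>+h. emeasure M {\<omega> \<in> space M. (u, h, rational_path \<omega>) \<in> survival k} \<partial>?G) = (\<integral>\<^sup>+h. ennreal (?seg u h) \<partial>?G)"
      using emeasure_survival[OF inst u] by (intro nn_integral_cong) (simp add: spG)
    also have "\<dots> = ennreal (I u)"
      unfolding I_def using int bounds by (intro nn_integral_eq_integral) auto
    finally show ?thesis
      using G.integral_le_const[OF int, of 1] bounds unfolding I_def by (auto intro!: integral_nonneg_AE)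
  qed
  let ?J = "\<lambda>u. indicator (jump_simplex k t) u *\<^sub>R I u"
  have simplexF: "jump_simplex k t \<in> sets ?F" using jump_simplex_in_sets setsF by simp
  \<comment> \<open>Restricting to the simplex changes nothing almost surely, and almost every u
    yields a \<open>jump_instance\<close>.\<close>
  have ae: "AE u in ?F. (\<integral>\<^sup>+h. emeasure M {\<omega> \<in> space M. (u, h, rational_path \<omega>) \<in> survival k} \<partial>?G) = ennreal (?J u) \<and> 0 \<le> ?J u \<and> ?J u \<le> 1"
    using AE_jump_instance[of k] simplex[of k] AE_space
  proof eventually_elim
    case (elim u)
    then show ?case using inner[of u] spF by simp
  qed
  have J_meas: "?J \<in> borel_measurable ?F"
    using simplexF by measurable
  have "integrable ?F ?J"
    using ae by (intro F.integrable_const_bound[where B = 1] J_meas) auto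
  moreover have "(\<integral>\<^sup>+u. \<integral>\<^sup>+h. emeasure M {\<omega> \<in> space M. (u, h, rational_path \<omega>) \<in> survival k} \<partial>?G \<partial>?F) = (\<integral>\<^sup>+u. ennreal (?J u) \<partial>?F)"
    using ae by (intro nn_integral_cong_AE) auto
  moreover have "AE u in ?F. 0 \<le> ?J u" using ae by eventually_elim blast
  ultimately have "emeasure M {\<omega> \<in> has_jumps k. (times k \<omega>, heights k \<omega>, rational_path \<omega>) \<in> survival k} =
      ennreal (prob (has_jumps k)) * ennreal (\<integral>u. ?J u \<partial>?F)" "0 \<le> (\<integral>u. ?J u \<partial>?F)"
    unfolding emeasure_surviving by (auto simp: nn_integral_eq_integral emeasure_eq_measure intro: integral_nonneg_AE)
  then have "prob {\<omega> \<in> has_jumps k. (times k \<omega>, heights k \<omega>, rational_path \<omega>) \<in> survival k} = prob (has_jumps k) * (\<integral>u. ?J u \<partial>?F)"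
    by (simp add: emeasure_eq_measure ennreal_mult[symmetric])
  then show ?thesis unfolding set_lebesgue_integral_def I_def by simp
qed

lemma series:
  "(\<lambda>k. prob (has_jumps k) *
      (LINT u:jump_simplex k t|jump_time_law M N t k. (LINT h|jump_height_law M \<eta> k. segment_integral b t n s k u h)))
    sums prob {\<omega> \<in> space M. (SUP r\<in>{0..<t}. ereal (jump_BM B N \<eta> r \<omega> - b r)) < 0}"
proof -
  let ?E = "\<lambda>k. {\<omega> \<in> has_jumps k. (times k \<omega>, heights k \<omega>, rational_path \<omega>) \<in> survival k}"
  have "(\<lambda>k. prob (?E k)) sums prob (\<Union>k. ?E k)"
    using surviving_events by (intro finite_measure_UNION) (auto simp: disjoint_family_on_def has_jumps_def)
  moreover have "(\<Union>k. ?E k) = {\<omega> \<in> space M. (SUP r\<in>{0..<t}. ereal (jump_BM B N \<eta> r \<omega> - b r)) < 0}"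
  proof (intro set_eqI iffI)
    fix \<omega> assume "\<omega> \<in> (\<Union>k. ?E k)"
    then obtain k where "\<omega> \<in> ?E k" by blast
    then show "\<omega> \<in> {\<omega> \<in> space M. (SUP r\<in>{0..<t}. ereal (jump_BM B N \<eta> r \<omega> - b r)) < 0}"
      using sup_iff[of \<omega> k] by (auto simp: has_jumps_def)
  next
    fix \<omega> assume \<omega>: "\<omega> \<in> {\<omega> \<in> space M. (SUP r\<in>{0..<t}. ereal (jump_BM B N \<eta> r \<omega> - b r)) < 0}"
    then interpret counting_path N \<omega> by (intro counting_path[OF N]) simp
    have "\<omega> \<in> has_jumps (nat (N t \<omega>))"
      using \<omega> nonneg[of t] t_pos by (simp add: has_jumps_def)
    then have "\<omega> \<in> ?E (nat (N t \<omega>))" using sup_iff \<omega> by blast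
    then show "\<omega> \<in> (\<Union>k. ?E k)" by blast
  qed
  ultimately show ?thesis by (simp only: term_eq)
qed

end

theorem theorem3p1:
  fixes M :: "'a measure"
    and B :: "real \<Rightarrow> 'a \<Rightarrow> real"
    and N :: "real \<Rightarrow> 'a \<Rightarrow> int"
    and \<eta> :: "nat \<Rightarrow> 'a \<Rightarrow> real"
    and b :: "real \<Rightarrow> real"
    and s :: "nat \<Rightarrow> real"
    and n :: nat
    and t :: real
  assumes "prob_space M"
    and "standard_brownian_motion M B"
    and "jump_counting_process M N"
    and "\<forall>i\<ge>1. \<eta> i \<in> borel_measurable M"
    and "mutually_independent M B N \<eta>"
    and "n \<ge> 1" and "s 0 = 0" and "s n = t" and "\<forall>i<n. s i < s (Suc i)"
    and "\<forall>k. AE u in jump_time_law M N t k. u \<in> jump_simplex k t"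
    and "AE \<omega> in M. \<forall>i\<in>{1..<n}. \<forall>k\<ge>1. jump_time N k \<omega> \<noteq> ereal (s i)"
    and "\<forall>i<n. \<exists>c d. \<forall>x\<in>{s i..s (Suc i)}. b x = c + d * x"
    and "b 0 \<ge> 0"
  shows "(\<lambda>k. measure M {\<omega> \<in> space M. N t \<omega> = int k} *
            (LINT u:jump_simplex k t|jump_time_law M N t k.
               (LINT h|jump_height_law M \<eta> k. segment_integral b t n s k u h)))
         sums measure M {\<omega> \<in> space M. (SUP r\<in>{0..<t}. ereal (jump_BM B N \<eta> r \<omega> - b r)) < 0}"
proof -
  interpret S: jump_setting b t n s
    using assms by unfold_locales auto
  \<comment> \<open>Outside \<open>[0, t]\<close> the boundary is arbitrary, hence possibly not measurable. It is evaluated there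
    only when \<open>grid\<close> is indexed beyond its length, which yields one of countably many junk values.\<close>
  define J where "J = range (nth ([] :: real list))"
  define b' where "b' x = (if x \<in> {0..t} \<union> J then b x else 0)" for x
  \<comment> \<open>On [0, t] the boundary is continuous, and the points of J outside add changes on
    a countable set only.\<close>
  have "b' \<in> borel_measurable borel"
  proof (rule measurable_discrete_difference[where X = J])
    show "(\<lambda>x. indicator {0..t} x *\<^sub>R b x) \<in> borel_measurable borel"
      by (rule borel_measurable_continuous_on_indicator[OF _ S.b_continuous]) simp
    show "countable J" by (simp add: J_def)
  qed (auto simp: b'_def indicator_def)
  moreover have s_range: "s i \<in> {0..t}" if "i \<le> n" for i
    using that S.s_strict_mono[of 0 i] S.s_strict_mono[of i n] assms(7,8) by (cases "i = 0"; cases "i = n") auto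
  moreover have "\<exists>c d. \<forall>x\<in>{s i..s (Suc i)}. b' x = c + d * x" if i: "i < n" for i
  proof -
    have "b' x = b x" if "x \<in> {s i..s (Suc i)}" for x
      using that s_range[of i] s_range[of "Suc i"] i by (auto simp: b'_def)
    then show ?thesis using assms(12) i by simp
  qed
  moreover have "0 \<le> b' 0" using assms(13) S.t_pos by (simp add: b'_def)
  ultimately interpret J: jump_model M b' t n s B N \<eta>
    using assms by (intro jump_model.intro jump_model_axioms.intro jump_setting.intro) auto
  have level: "level b k u h x = level b' k u h x" if "x \<in> {0..t} \<union> J" for k u h x
    using that by (simp add: level_def b'_def)
  \<comment> \<open>The equality is claimed on the simplex, where all grid points lie in [0, t];
    elsewhere the indicator in the set integral is 0.\<close>
  have seg: "segment_integral b t n s k u = segment_integral b' t n s k u" if u: "u \<in> jump_simplex k t" for k u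
  proof (rule ext)
    fix h
    have "grid n s k u ! i \<in> {0..t} \<union> J" for i
    proof (cases "i < length (grid n s k u)")
      case True
      then have "grid n s k u ! i \<in> set (grid n s k u)" by (rule nth_mem)
      also have "set (grid n s k u) = insert 0 (u ` {1..k} \<union> s ` {1..<n})"
        unfolding grid_def by (rule set_sorted_list_of_set) simp
      also have "\<dots> \<subseteq> {0..t}"
        using u s_range S.t_pos by (fastforce simp: jump_simplex_def intro: less_imp_le)
      finally show ?thesis by simp
    next
      case False
      then show ?thesis using nth_overflow[of "grid n s k u" i] by (simp add: J_def)
    qed
    then have "level b k u h (grid n s k u ! i) = level b' k u h (grid n s k u ! i)" for i
      by (rule level)
    moreover have "level b k u h t = level b' k u h t" using S.t_pos by (intro level) simp
    ultimately show "segment_integral b t n s k u h = segment_integral b' t n s k u h"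
      unfolding segment_integral_def Let_def by (simp only:)
  qed
  have "(LINT u:jump_simplex k t|jump_time_law M N t k. (LINT h|jump_height_law M \<eta> k. segment_integral b t n s k u h)) =
      (LINT u:jump_simplex k t|jump_time_law M N t k. (LINT h|jump_height_law M \<eta> k. segment_integral b' t n s k u h))" for k
    unfolding set_lebesgue_integral_def
    by (intro Bochner_Integration.integral_cong refl) (auto simp: indicator_def seg)
  moreover have "(SUP r\<in>{0..<t}. ereal (jump_BM B N \<eta> r \<omega> - b r)) = (SUP r\<in>{0..<t}. ereal (jump_BM B N \<eta> r \<omega> - b' r))" for \<omega>
    by (intro SUP_cong refl) (simp add: b'_def)
  ultimately show ?thesis
    using J.series unfolding J.has_jumps_def by simp
qed

end
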